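(* Let $G$ be a group with subgroups $A$ and $B$ such that $G=AB$, where $A$ is abelian and $B$ is locally quaternion. Then $G$ is soluble.
   Context: Groups are not assumed finite. $G=AB$ means $G=\{ab\mid a\in A,\ b\in B\}$. A locally quaternion group is a group $B=X\langle y\rangle$ in which $X$ is a quasicyclic $2$-subgroup (isomorphic to $\mathbb{Z}(2^\infty)$) of index $2$ and $y\in B\setminus X$ is an element of order $4$ with $y^2\in X$ and $y^{-1}xy=x^{-1}$ for all $x\in X$ (this group is unique up to isomorphism). *)

theory Defs
  imports Complex_Main "HOL-Algebra.Solvable_Groups" "HOL-Algebra.Multiplicative_Group"
begin

text \<open>The quasicyclic group \<open>\<int>(p\<^sup>\<infinity>)\<close>, for \<open>p\<close> prime, realised as the multiplicative group of all
  complex roots of unity of \<open>p\<close>-power order.\<close>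

definition quasicyclic_group :: "nat \<Rightarrow> complex monoid" where
  "quasicyclic_group p = \<lparr>carrier = {z. \<exists>n. z ^ (p ^ n) = 1}, monoid.mult = (*), one = 1\<rparr>"

lemma comm_group_quasicyclic_group:
  assumes "p > 0"
  shows "comm_group (quasicyclic_group p)"
proof (rule comm_groupI)
  fix x y
  assume "x \<in> carrier (quasicyclic_group p)" "y \<in> carrier (quasicyclic_group p)"
  then obtain m n where "x ^ (p ^ m) = 1" "y ^ (p ^ n) = 1"
    by (auto simp: quasicyclic_group_def)
  then have "(x * y) ^ (p ^ (m + n)) = 1"
    by (simp add: power_mult_distrib power_add power_mult)
      (metis mult.commute power_mult power_one)
  then show "x \<otimes>\<^bsub>quasicyclic_group p\<^esub> y \<in> carrier (quasicyclic_group p)"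
    by (auto simp: quasicyclic_group_def)
next
  fix x
  assume "x \<in> carrier (quasicyclic_group p)"
  then obtain n where n: "x ^ (p ^ n) = 1"
    by (auto simp: quasicyclic_group_def)
  then have "x \<noteq> 0"
    using assms by (auto simp: power_0_left)
  then have "inverse x * x = 1" "inverse x ^ (p ^ n) = 1"
    using n by (simp_all add: power_inverse)
  then show "\<exists>y\<in>carrier (quasicyclic_group p).
      y \<otimes>\<^bsub>quasicyclic_group p\<^esub> x = \<one>\<^bsub>quasicyclic_group p\<^esub>"
    by (auto simp: quasicyclic_group_def intro!: bexI[of _ "inverse x"])
qed (auto simp: quasicyclic_group_def)

definition locally_quaternion :: "('a, 'b) monoid_scheme \<Rightarrow> bool" where
  "locally_quaternion B \<longleftrightarrow> group B \<and>
     (\<exists>X y. subgroup X B \<and>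
        B\<lparr>carrier := X\<rparr> \<cong> quasicyclic_group 2 \<and>
        card (rcosets\<^bsub>B\<^esub> X) = 2 \<and>
        y \<in> carrier B - X \<and>
        group.ord B y = 4 \<and>
        y [^]\<^bsub>B\<^esub> (2::nat) \<in> X \<and>
        (\<forall>x\<in>X. inv\<^bsub>B\<^esub> y \<otimes>\<^bsub>B\<^esub> x \<otimes>\<^bsub>B\<^esub> y = inv\<^bsub>B\<^esub> x) \<and>
        carrier B = X <#>\<^bsub>B\<^esub> generate B {y})"

end

theory Submission
  imports Defs
begin

text \<open>Let \<open>X\<close> be the quasicyclic subgroup of \<open>B\<close> and \<open>y\<close> the element inverting it, and write
\<open>B = X \<union> Y\<close> with \<open>Y = X y\<close>.  Since \<open>X\<close> has index 2 in \<open>B\<close>, Ito's argument for a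
product of two abelian groups does not apply to \<open>G = A B\<close> directly; it does apply to every normal
subgroup of the form \<open>H = (A \<inter> H) (X \<inter> H)\<close> (predicate \<open>factorised\<close>), and shows that such an
\<open>H\<close> is soluble.  These subgroups are closed under unions of chains, so there is a maximal one, and
modulo it no nontrivial one is left (\<open>reduce_to_irreducible\<close>).  The quotient of the quasicyclic
group \<open>X\<close> is again quasicyclic or trivial, but \<open>B\<close> may have turned from a locally quaternion group
into a locally dihedral one, so both kinds are treated.  The point of passing to a maximal \<open>H\<close>
is that factoring out one finite subgroup of \<open>X\<close> after the other need not end.

Suppose then that \<open>G\<close> is irreducible in this sense and \<open>X\<close> is nontrivial.  Let \<open>z\<close> be the
involution of \<open>X\<close>; it is central in \<open>B\<close>, so its class is \<open>{inv a z a | a \<in> A}\<close>, and an element of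
\<open>A\<close> commuting with \<open>z\<close> commutes with the whole class.  Playing the centraliser \<open>K\<close> of the class
against irreducibility shows that either \<open>G\<close> is soluble by Ito's theorem, or \<open>z\<close> commutes with no
nontrivial element of \<open>A\<close> (\<open>solvable_or_z_notin_K\<close>, \<open>trivial_centralizer\<close>).  In the second case
\<open>A\<close> acts regularly on the class of \<open>z\<close> and \<open>B\<close> is the centraliser of \<open>z\<close>.

If \<open>B\<close> is locally dihedral, every \<open>k \<in> Y\<close> is an involution.  For \<open>a \<noteq> 1\<close> in \<open>A\<close> an
equation \<open>a k = k' e\<close> with \<open>k, k' \<in> Y\<close> and \<open>e \<in> A\<close> can hold only for finitely many
\<open>k\<close>, since up to finitely many exceptions it forces \<open>e = a\<close>, and two such \<open>k\<close> would make \<open>a\<close> commute with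
\<open>z\<close>.  So, up to finite sets, \<open>a\<close> moves the cosets \<open>k A\<close> with \<open>k \<in> Y\<close> to cosets \<open>x A\<close> with
\<open>x \<in> X\<close> and conversely.  For \<open>a\<close>, \<open>b\<close> and \<open>a b\<close> all different from 1 this is impossible.

If \<open>B\<close> is locally quaternion, \<open>z\<close> is the only involution of \<open>B\<close> and \<open>G\<close> acts on the class
of \<open>z\<close> as a Frobenius group.  For \<open>a \<in> A\<close> with \<open>a z \<in> X A\<close> Ito's computation still works with
\<open>z\<close> as one of the two elements, and shows that the products \<open>inv a z a z\<close> of two conjugates of
\<open>z\<close> commute for these \<open>a\<close> (\<open>u_commute\<close>).  An \<open>a\<close> with \<open>a z \<in> Y A\<close> produces an element
\<open>c \<in> A\<close> of order 4 which rotates a square of conjugates of \<open>z\<close>; this makes \<open>c\<^sup>2\<close> the only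
involution of \<open>A\<close>, and there are at most two such \<open>a\<close> (\<open>finite_not_P\<close>).  As \<open>A\<close> is infinite,
translations then show that all products of two conjugates of \<open>z\<close> commute
(\<open>u_commute_all\<close>).  They generate an abelian normal subgroup modulo which \<open>z\<close> is central, and modulo
\<open>z\<close> the group \<open>B\<close> is locally dihedral.\<close>

section \<open>Extensions of soluble groups and products of two abelian subgroups\<close>

context group
begin

lemma inv_mult_cancel: "x \<in> carrier G \<Longrightarrow> w \<in> carrier G \<Longrightarrow> inv x \<otimes> (x \<otimes> w) = w"
  by (simp add: m_assoc[symmetric])

lemma mult_inv_cancel: "x \<in> carrier G \<Longrightarrow> w \<in> carrier G \<Longrightarrow> x \<otimes> (inv x \<otimes> w) = w"
  by (simp add: m_assoc[symmetric])

lemmas word_simps = m_assoc inv_mult_group inv_mult_cancel mult_inv_cancel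

lemma generate_commute:
  assumes "S \<subseteq> carrier G" "g \<in> carrier G" "\<And>s. s \<in> S \<Longrightarrow> s \<otimes> g = g \<otimes> s" "h \<in> generate G S"
  shows "h \<otimes> g = g \<otimes> h"
  using assms(4)
proof (induction rule: generate.induct)
  case (inv s)
  then have s: "s \<in> carrier G" "s \<otimes> g = g \<otimes> s" using assms by auto
  have "inv s \<otimes> g = inv s \<otimes> (g \<otimes> s) \<otimes> inv s" using s(1) assms(2) by (simp add: word_simps)
  also have "g \<otimes> s = s \<otimes> g" using s(2) by simp
  also have "inv s \<otimes> (s \<otimes> g) \<otimes> inv s = g \<otimes> inv s" using s(1) assms(2) by (simp add: word_simps)
  finally show ?case .
next
  case (eng h1 h2)
  then have c: "h1 \<in> carrier G" "h2 \<in> carrier G" using assms(1) generate_in_carrier by auto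
  have "h1 \<otimes> h2 \<otimes> g = h1 \<otimes> (h2 \<otimes> g)" using c assms(2) by (simp add: m_assoc)
  also have "\<dots> = (h1 \<otimes> g) \<otimes> h2" unfolding eng.IH(2) using c assms(2) by (simp add: m_assoc)
  also have "\<dots> = g \<otimes> (h1 \<otimes> h2)" unfolding eng.IH(1) using c assms(2) by (simp add: m_assoc)
  finally show ?case .
qed (use assms in auto)

lemma abelian_generate:
  assumes "S \<subseteq> carrier G" "\<And>s t. s \<in> S \<Longrightarrow> t \<in> S \<Longrightarrow> s \<otimes> t = t \<otimes> s"
    and "g \<in> generate G S" "h \<in> generate G S"
  shows "g \<otimes> h = h \<otimes> g"
proof -
  have gc: "g \<in> carrier G" "h \<in> carrier G" using assms generate_in_carrier by auto
  have "s \<otimes> h = h \<otimes> s" if "s \<in> S" for s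
    using generate_commute[OF assms(1) _ _ assms(4), of s] assms(1,2) that by auto
  then show ?thesis using generate_commute[OF assms(1) gc(2) _ assms(3)] by blast
qed

lemma solvable_extension:
  assumes "L \<lhd> G" "solvable (G\<lparr>carrier := L\<rparr>)" "solvable (G Mod L)"
  shows "solvable G"
proof -
  interpret L: normal L G by fact
  have sub: "subgroup L G" by (rule L.subgroup_axioms)
  interpret GL: group "G\<lparr>carrier := L\<rparr>" by (rule subgroup_imp_group[OF sub])
  interpret Q: group "G Mod L" by (rule L.factorgroup_is_group)
  have h1: "group_hom (G\<lparr>carrier := L\<rparr>) G id"
    using L.subset by unfold_locales (auto simp: hom_def)
  have h2: "group_hom G (G Mod L) ((#>) L)"
    using L.r_coset_hom_Mod by unfold_locales
  show ?thesis
  proof (rule solvable_condition[OF h1 h2])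
    show "(#>) L ` carrier G = carrier (G Mod L)" by (simp add: carrier_FactGroup)
    show "kernel G (G Mod L) ((#>) L) \<subseteq> id ` carrier (G\<lparr>carrier := L\<rparr>)"
      using rcos_self[OF _ sub] by (auto simp: kernel_def)
  qed (use assms in auto)
qed

lemma abelian_solvable:
  assumes "\<And>x w. x \<in> carrier G \<Longrightarrow> w \<in> carrier G \<Longrightarrow> x \<otimes> w = w \<otimes> x"
  shows "solvable G"
proof -
  interpret comm_group G by (rule group_comm_groupI) (use assms in auto)
  have "(derived G ^^ 1) (carrier G) = {\<one>}" by (simp add: derived_eq_singleton)
  then show ?thesis using solvable_iff_trivial_derived_seq by blast
qed

lemma solvable_abelian_extension:
  assumes "L \<lhd> G" "\<And>x w. x \<in> L \<Longrightarrow> w \<in> L \<Longrightarrow> x \<otimes> w = w \<otimes> x" "solvable (G Mod L)"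
  shows "solvable G"
proof (rule solvable_extension[OF assms(1) _ assms(3)])
  interpret L: normal L G by fact
  interpret GL: group "G\<lparr>carrier := L\<rparr>" by (rule subgroup_imp_group[OF L.subgroup_axioms])
  show "solvable (G\<lparr>carrier := L\<rparr>)" by (rule GL.abelian_solvable) (use assms in auto)
qed

text \<open>Ito's theorem: a product of two abelian subgroups is metabelian.  For \<open>u\<close>, \<open>u'\<close> in \<open>U\<close> and \<open>v\<close>, \<open>v'\<close> in \<open>V\<close> write
  \<open>inv u' v u' = u\<^sub>2 v\<^sub>2\<close> and \<open>inv v' u v' = v\<^sub>3 u\<^sub>3\<close>.  Conjugating the commutator \<open>[u,v]\<close> by
  \<open>u'\<close> only changes \<open>v\<close> to \<open>v\<^sub>2\<close>, conjugating it by \<open>v'\<close> only changes \<open>u\<close> to \<open>u\<^sub>3\<close>.  So \<open>u'\<close> and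
  \<open>v'\<close> act by commuting permutations on these commutators, and \<open>[u',v']\<close> fixes all of them.  The commutators thus generate an abelian
  normal subgroup, modulo which \<open>U\<close> and \<open>V\<close> commute.\<close>

theorem ito:
  assumes U: "subgroup U G" and V: "subgroup V G"
    and cU: "\<And>u u'. u \<in> U \<Longrightarrow> u' \<in> U \<Longrightarrow> u \<otimes> u' = u' \<otimes> u"
    and cV: "\<And>v v'. v \<in> V \<Longrightarrow> v' \<in> V \<Longrightarrow> v \<otimes> v' = v' \<otimes> v"
    and UV: "\<And>g. g \<in> carrier G \<Longrightarrow> \<exists>u\<in>U. \<exists>v\<in>V. g = u \<otimes> v"
  shows "solvable G"
proof -
  interpret U: subgroup U G by fact
  interpret V: subgroup V G by fact
  have VU: "\<exists>v\<in>V. \<exists>u\<in>U. g = v \<otimes> u" if g: "g \<in> carrier G" for g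
  proof -
    obtain u v where "u \<in> U" "v \<in> V" "inv g = u \<otimes> v" using UV[OF inv_closed[OF g]] by blast
    moreover then have "g = inv v \<otimes> inv u" using g by (metis inv_inv inv_mult_group U.mem_carrier V.mem_carrier)
    ultimately show ?thesis using U.m_inv_closed V.m_inv_closed by blast
  qed
  define comm where "comm u v = inv u \<otimes> inv v \<otimes> u \<otimes> v" for u v
  define S where "S = {comm u v | u v. u \<in> U \<and> v \<in> V}"
  define L where "L = generate G S"
  have comm_car: "u \<in> U \<Longrightarrow> v \<in> V \<Longrightarrow> comm u v \<in> carrier G" for u v by (simp add: comm_def)
  then have S_car: "S \<subseteq> carrier G" unfolding S_def by blast
  have conjU: "inv u' \<otimes> comm u v \<otimes> u' = comm u v2"
    if "u \<in> U" "v \<in> V" "u' \<in> U" "u2 \<in> U" "v2 \<in> V" "inv u' \<otimes> v \<otimes> u' = u2 \<otimes> v2" for u v u' u2 v2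
  proof -
    have cc: "u \<in> carrier G" "v \<in> carrier G" "u' \<in> carrier G" "u2 \<in> carrier G" "v2 \<in> carrier G"
      using that by auto
    have e: "inv u' \<otimes> u \<otimes> u' = u" using cU[OF that(1) that(3)] cc by (simp add: word_simps)
    have "inv u' \<otimes> comm u v \<otimes> u' = inv (inv u' \<otimes> u \<otimes> u') \<otimes> inv (inv u' \<otimes> v \<otimes> u') \<otimes> (inv u' \<otimes> u \<otimes> u') \<otimes> (inv u' \<otimes> v \<otimes> u')"
      unfolding comm_def using cc by (simp add: word_simps)
    also have "\<dots> = inv u \<otimes> inv (u2 \<otimes> v2) \<otimes> u \<otimes> (u2 \<otimes> v2)" unfolding e that(6) ..
    also have "\<dots> = inv u \<otimes> inv v2 \<otimes> inv u2 \<otimes> (u \<otimes> u2) \<otimes> v2" using cc by (simp add: word_simps)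
    also have "\<dots> = comm u v2" unfolding cU[OF that(1) that(4)] comm_def using cc by (simp add: word_simps)
    finally show ?thesis .
  qed
  have conjV: "inv v' \<otimes> comm u v \<otimes> v' = comm u3 v"
    if "u \<in> U" "v \<in> V" "v' \<in> V" "u3 \<in> U" "v3 \<in> V" "inv v' \<otimes> u \<otimes> v' = v3 \<otimes> u3" for u v v' u3 v3
  proof -
    have cc: "u \<in> carrier G" "v \<in> carrier G" "v' \<in> carrier G" "u3 \<in> carrier G" "v3 \<in> carrier G"
      using that by auto
    have e: "inv v' \<otimes> v \<otimes> v' = v" using cV[OF that(2) that(3)] cc by (simp add: word_simps)
    have i: "inv v3 \<otimes> inv v = inv v \<otimes> inv v3" using cV[OF that(2,5)] cc by (metis inv_mult_group)
    have "inv v' \<otimes> comm u v \<otimes> v' = inv (inv v' \<otimes> u \<otimes> v') \<otimes> inv (inv v' \<otimes> v \<otimes> v') \<otimes> (inv v' \<otimes> u \<otimes> v') \<otimes> (inv v' \<otimes> v \<otimes> v')"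
      unfolding comm_def using cc by (simp add: word_simps)
    also have "\<dots> = inv (v3 \<otimes> u3) \<otimes> inv v \<otimes> (v3 \<otimes> u3) \<otimes> v" unfolding e that(6) ..
    also have "\<dots> = inv u3 \<otimes> (inv v3 \<otimes> inv v) \<otimes> v3 \<otimes> u3 \<otimes> v" using cc by (simp add: word_simps)
    also have "\<dots> = comm u3 v" unfolding i comm_def using cc by (simp add: word_simps)
    finally show ?thesis .
  qed
  have decU: "\<exists>u2\<in>U. \<exists>v2\<in>V. inv u' \<otimes> v \<otimes> u' = u2 \<otimes> v2" if "u' \<in> U" "v \<in> V" for u' v
    using UV that by simp
  have decV: "\<exists>v3\<in>V. \<exists>u3\<in>U. inv v' \<otimes> u \<otimes> v' = v3 \<otimes> u3" if "v' \<in> V" "u \<in> U" for u v'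
    using VU that by simp
  have S_conj: "inv g \<otimes> s \<otimes> g \<in> S" if s: "s \<in> S" and g: "g \<in> carrier G" for s g
  proof -
    obtain u v where uv: "u \<in> U" "v \<in> V" "s = comm u v" using s S_def by blast
    obtain u' v' where g': "u' \<in> U" "v' \<in> V" "g = u' \<otimes> v'" using UV[OF g] by blast
    obtain u2 v2 where 2: "u2 \<in> U" "v2 \<in> V" "inv u' \<otimes> v \<otimes> u' = u2 \<otimes> v2" using decU[OF g'(1) uv(2)] by blast
    obtain u3 v3 where 3: "u3 \<in> U" "v3 \<in> V" "inv v' \<otimes> u \<otimes> v' = v3 \<otimes> u3" using decV[OF g'(2) uv(1)] by blast
    have "inv g \<otimes> s \<otimes> g = inv v' \<otimes> (inv u' \<otimes> comm u v \<otimes> u') \<otimes> v'"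
      using g' uv comm_car by (simp add: word_simps)
    also have "\<dots> = comm u3 v2" using conjU[OF uv(1,2) g'(1) 2] conjV[OF uv(1) 2(2) g'(2) 3] by simp
    finally show ?thesis using 2 3 S_def by blast
  qed
  have S_comm: "s \<otimes> t = t \<otimes> s" if s: "s \<in> S" and t: "t \<in> S" for s t
  proof -
    obtain u v where uv: "u \<in> U" "v \<in> V" "s = comm u v" using s S_def by blast
    obtain u' v' where g': "u' \<in> U" "v' \<in> V" "t = comm u' v'" using t S_def by blast
    have i: "inv u' \<in> U" "inv v' \<in> V" using g' by auto
    obtain u2 v2 where 2: "u2 \<in> U" "v2 \<in> V" "inv (inv u') \<otimes> v \<otimes> inv u' = u2 \<otimes> v2" using decU[OF i(1) uv(2)] by blast
    obtain u3 v3 where 3: "u3 \<in> U" "v3 \<in> V" "inv (inv v') \<otimes> u \<otimes> inv v' = v3 \<otimes> u3" using decV[OF i(2) uv(1)] by blast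
    have sc: "s \<in> carrier G" "u' \<in> carrier G" "v' \<in> carrier G" using s S_car g' by auto
    have e: "inv (inv v') \<otimes> (inv (inv u') \<otimes> s \<otimes> inv u') \<otimes> inv v' = inv (inv u') \<otimes> (inv (inv v') \<otimes> s \<otimes> inv v') \<otimes> inv u'"
      using conjU[OF uv(1,2) i(1) 2] conjV[OF uv(1) 2(2) i(2) 3]
        conjV[OF uv(1,2) i(2) 3] conjU[OF 3(1) uv(2) i(1) 2] uv(3) by simp
    define p q where "p = inv u' \<otimes> inv v'" and "q = inv v' \<otimes> inv u'"
    have pq: "p \<in> carrier G" "q \<in> carrier G" using sc p_def q_def by auto
    have e': "inv p \<otimes> s \<otimes> p = inv q \<otimes> s \<otimes> q"
      using e sc unfolding p_def q_def by (simp add: word_simps)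
    \<comment> \<open>conjugation by \<open>u'\<^sup>-\<^sup>1\<close> and \<open>v'\<^sup>-\<^sup>1\<close> in either order agrees on \<open>s\<close>, and \<open>t\<close> is the
      quotient of the two orders\<close>
    have t: "t = p \<otimes> inv q" unfolding g'(3) comm_def p_def q_def using sc by (simp add: word_simps)
    have "s \<otimes> t = p \<otimes> (inv p \<otimes> s \<otimes> p) \<otimes> inv q" unfolding t using sc pq by (simp add: word_simps)
    also have "\<dots> = t \<otimes> s" unfolding t e' using sc pq by (simp add: word_simps)
    finally show ?thesis .
  qed
  have L: "L \<lhd> G" unfolding L_def
  proof (rule normal_generateI[OF S_car])
    fix s g assume "s \<in> S" "g \<in> carrier G"
    then show "g \<otimes> s \<otimes> inv g \<in> S" using S_conj[of s "inv g"] by simp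
  qed
  interpret L: normal L G by fact
  interpret Q: group "G Mod L" by (rule L.factorgroup_is_group)
  have hom: "L #> (g \<otimes> h) = (L #> g) \<otimes>\<^bsub>G Mod L\<^esub> (L #> h)" if "g \<in> carrier G" "h \<in> carrier G" for g h
    using that by (simp add: L.rcos_sum)
  have mc: "L #> g \<in> carrier (G Mod L)" if "g \<in> carrier G" for g using that by (auto simp: carrier_FactGroup)
  have uv_comm: "(L #> u) \<otimes>\<^bsub>G Mod L\<^esub> (L #> v) = (L #> v) \<otimes>\<^bsub>G Mod L\<^esub> (L #> u)" if "u \<in> U" "v \<in> V" for u v
  proof -
    have "comm (inv u) (inv v) \<in> L" unfolding L_def S_def using that by (intro generate.incl) auto
    moreover have "u \<otimes> v = comm (inv u) (inv v) \<otimes> (v \<otimes> u)" using that by (simp add: comm_def word_simps)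
    moreover have "comm (inv u) (inv v) \<in> carrier G" using that comm_car by simp
    ultimately have "L #> (u \<otimes> v) = L #> (v \<otimes> u)"
      using that by (metis L.subset L.subgroup_axioms coset_join2 coset_mult_assoc m_closed U.mem_carrier V.mem_carrier)
    then show ?thesis using hom that by simp
  qed
  have "solvable (G Mod L)"
  proof (rule Q.abelian_solvable)
    fix P Q assume "P \<in> carrier (G Mod L)" "Q \<in> carrier (G Mod L)"
    then obtain g h where gh: "g \<in> carrier G" "P = L #> g" "h \<in> carrier G" "Q = L #> h"
      by (auto simp: carrier_FactGroup)
    obtain u v u' v' where d: "u \<in> U" "v \<in> V" "g = u \<otimes> v" "u' \<in> U" "v' \<in> V" "h = u' \<otimes> v'"
      using UV gh by metis
    let ?u = "L #> u" and ?v = "L #> v" and ?u' = "L #> u'" and ?v' = "L #> v'"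
    have c: "?u \<in> carrier (G Mod L)" "?v \<in> carrier (G Mod L)" "?u' \<in> carrier (G Mod L)" "?v' \<in> carrier (G Mod L)"
      using d mc by auto
    have com: "?u \<otimes>\<^bsub>G Mod L\<^esub> ?u' = ?u' \<otimes>\<^bsub>G Mod L\<^esub> ?u" "?v \<otimes>\<^bsub>G Mod L\<^esub> ?v' = ?v' \<otimes>\<^bsub>G Mod L\<^esub> ?v"
      using cU[OF d(1,4)] cV[OF d(2,5)] hom d by (metis U.mem_carrier, metis V.mem_carrier)
    have "P \<otimes>\<^bsub>G Mod L\<^esub> Q = ?u \<otimes>\<^bsub>G Mod L\<^esub> (?v \<otimes>\<^bsub>G Mod L\<^esub> ?u') \<otimes>\<^bsub>G Mod L\<^esub> ?v'"
      unfolding gh d using c d hom by (simp del: mult_FactGroup add: Q.m_assoc)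
    also have "\<dots> = (?u' \<otimes>\<^bsub>G Mod L\<^esub> ?u) \<otimes>\<^bsub>G Mod L\<^esub> (?v' \<otimes>\<^bsub>G Mod L\<^esub> ?v)"
      unfolding uv_comm[OF d(4,2), symmetric] com[symmetric] using c by (simp del: mult_FactGroup add: Q.m_assoc)
    also have "\<dots> = ?u' \<otimes>\<^bsub>G Mod L\<^esub> (?u \<otimes>\<^bsub>G Mod L\<^esub> ?v') \<otimes>\<^bsub>G Mod L\<^esub> ?v"
      using c by (simp del: mult_FactGroup add: Q.m_assoc)
    also have "\<dots> = Q \<otimes>\<^bsub>G Mod L\<^esub> P"
      unfolding uv_comm[OF d(1,5)] gh d using c d hom by (simp del: mult_FactGroup add: Q.m_assoc)
    finally show "P \<otimes>\<^bsub>G Mod L\<^esub> Q = Q \<otimes>\<^bsub>G Mod L\<^esub> P" .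
  qed
  then show ?thesis
    using solvable_abelian_extension[OF L] abelian_generate[OF S_car S_comm] unfolding L_def by blast
qed

end

lemma (in group) conj_pow:
  assumes "g \<in> carrier G" "x \<in> carrier G"
  shows "(inv g \<otimes> x \<otimes> g) [^] (n::nat) = inv g \<otimes> x [^] n \<otimes> g"
proof (induction n)
  case (Suc n)
  then show ?case using assms by (simp add: word_simps)
qed (use assms in simp)

lemma (in group) subgroup_pow_closed:
  assumes "subgroup H G" "x \<in> H"
  shows "x [^] (n::nat) \<in> H"
proof -
  interpret H: subgroup H G by fact
  show ?thesis by (induction n) (use assms in auto)
qed

section \<open>Products of an abelian group and a locally dihedral or quaternion group\<close>

text \<open>The properties of a quasicyclic 2-group \<open>X\<close> and of the element \<open>y\<close> are stated so that they pass to
homomorphic images: \<open>X\<close> is a divisible 2-group whose cyclic subgroups form a chain.  The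
square of \<open>y\<close> is inverted and fixed by \<open>y\<close>, so it is 1 or the involution of \<open>X\<close>; both the
dihedral and the quaternion type are included, and so is \<open>X = {1}\<close>.\<close>

locale abelian_dihedral_product = group G for G (structure) +
  fixes A X :: "'a set" and y :: 'a
  assumes A_subgroup: "subgroup A G"
    and A_comm: "\<And>a a'. a \<in> A \<Longrightarrow> a' \<in> A \<Longrightarrow> a \<otimes> a' = a' \<otimes> a"
    and X_subgroup: "subgroup X G"
    and X_comm: "\<And>x x'. x \<in> X \<Longrightarrow> x' \<in> X \<Longrightarrow> x \<otimes> x' = x' \<otimes> x"
    and y_carrier: "y \<in> carrier G"
    and y_inverts: "\<And>x. x \<in> X \<Longrightarrow> x \<otimes> y = y \<otimes> inv x"
    and y_square: "y \<otimes> y \<in> X"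
    and X_sqrt: "\<And>x. x \<in> X \<Longrightarrow> \<exists>w\<in>X. w \<otimes> w = x"
    and X_chain: "\<And>x w. x \<in> X \<Longrightarrow> w \<in> X \<Longrightarrow> (\<exists>n::nat. x = w [^] n) \<or> (\<exists>n::nat. w = x [^] n)"
    and X_torsion: "\<And>x. x \<in> X \<Longrightarrow> \<exists>n::nat. x [^] ((2::nat) ^ n) = \<one>"
    and factorisation: "\<And>g. g \<in> carrier G \<Longrightarrow> \<exists>a\<in>A. \<exists>x\<in>X. g = a \<otimes> x \<or> g = a \<otimes> (x \<otimes> y)"
begin

sublocale A: subgroup A G by (rule A_subgroup)
sublocale X: subgroup X G by (rule X_subgroup)

definition Y where "Y = (\<lambda>x. x \<otimes> y) ` X"

abbreviation B where "B \<equiv> X \<union> Y"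

lemma Y_carrier [simp]: "k \<in> Y \<Longrightarrow> k \<in> carrier G"
  using y_carrier by (auto simp: Y_def)

lemma B_carrier: "b \<in> B \<Longrightarrow> b \<in> carrier G" by auto

lemma XY_mult [simp]: "x \<in> X \<Longrightarrow> k \<in> Y \<Longrightarrow> x \<otimes> k \<in> Y"
  using y_carrier by (auto simp: Y_def m_assoc[symmetric])

lemma Y_inverts: "x \<in> X \<Longrightarrow> k \<in> Y \<Longrightarrow> x \<otimes> k = k \<otimes> inv x"
proof -
  assume x: "x \<in> X" and "k \<in> Y"
  then obtain w where w: "w \<in> X" "k = w \<otimes> y" by (auto simp: Y_def)
  have "x \<otimes> k = (x \<otimes> w) \<otimes> y" using x w y_carrier by (simp add: m_assoc)
  also have "x \<otimes> w = w \<otimes> x" using X_comm x w by simp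
  also have "w \<otimes> x \<otimes> y = w \<otimes> (x \<otimes> y)" using x w y_carrier by (simp add: m_assoc)
  also have "x \<otimes> y = y \<otimes> inv x" using y_inverts x by simp
  also have "w \<otimes> (y \<otimes> inv x) = k \<otimes> inv x" unfolding w(2) using x w(1) y_carrier by (simp add: m_assoc)
  finally show ?thesis .
qed

lemma YX_mult [simp]: "x \<in> X \<Longrightarrow> k \<in> Y \<Longrightarrow> k \<otimes> x \<in> Y"
  using Y_inverts[of "inv x" k] XY_mult[of "inv x" k] by simp

lemma y_in_Y: "y \<in> Y" using y_carrier by (auto simp: Y_def intro!: image_eqI[of _ _ \<one>])

lemma Y_square: "k \<in> Y \<Longrightarrow> k \<otimes> k = y \<otimes> y"
proof -
  assume "k \<in> Y"
  then obtain w where w: "w \<in> X" "k = w \<otimes> y" by (auto simp: Y_def)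
  have "k \<otimes> k = (w \<otimes> y) \<otimes> w \<otimes> y" using w y_carrier by (simp add: m_assoc)
  also have "\<dots> = y \<otimes> (inv w \<otimes> w) \<otimes> y" unfolding y_inverts[OF w(1)] using w y_carrier by (simp add: m_assoc)
  finally show ?thesis using w y_carrier by simp
qed

lemma YY_mult [simp]: "k \<in> Y \<Longrightarrow> k' \<in> Y \<Longrightarrow> k \<otimes> k' \<in> X"
proof -
  assume k: "k \<in> Y" and k': "k' \<in> Y"
  then obtain w where w: "w \<in> X" "k = w \<otimes> y" by (auto simp: Y_def)
  obtain v where v: "v \<in> X" "k' = v \<otimes> y" using k' by (auto simp: Y_def)
  have "k \<otimes> k' = w \<otimes> (y \<otimes> v) \<otimes> y" using w v y_carrier by (simp add: m_assoc)
  also have "y \<otimes> v = inv v \<otimes> y" using y_inverts[of "inv v"] v by simp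
  also have "w \<otimes> (inv v \<otimes> y) \<otimes> y = w \<otimes> inv v \<otimes> (y \<otimes> y)" using w v y_carrier by (simp add: m_assoc)
  finally show ?thesis using w v y_square by simp
qed

lemma Y_inv [simp]: "k \<in> Y \<Longrightarrow> inv k \<in> Y"
proof -
  assume k: "k \<in> Y"
  have "inv (k \<otimes> k) \<otimes> k = inv k" using k by (simp add: word_simps)
  moreover have "inv (k \<otimes> k) \<otimes> k \<in> Y" using k by (intro XY_mult X.m_inv_closed YY_mult)
  ultimately show ?thesis by simp
qed

lemma B_subgroup: "subgroup B G"
proof (rule subgroupI)
  show "B \<noteq> {}" using X.one_closed by blast
qed auto

lemma factor_AB: "g \<in> carrier G \<Longrightarrow> \<exists>a\<in>A. \<exists>b\<in>B. g = a \<otimes> b"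
  using factorisation[of g] unfolding Y_def by blast

lemma factor_BA: "g \<in> carrier G \<Longrightarrow> \<exists>b\<in>B. \<exists>a\<in>A. g = b \<otimes> a"
proof -
  assume g: "g \<in> carrier G"
  obtain a b where ab: "a \<in> A" "b \<in> B" "inv g = a \<otimes> b" using factor_AB[OF inv_closed[OF g]] by blast
  then have "g = inv (a \<otimes> b)" using g by (metis inv_inv)
  then have "g = inv b \<otimes> inv a" using ab inv_mult_group[of a b] by auto
  then show ?thesis using ab subgroup.m_inv_closed[OF B_subgroup] A.m_inv_closed by blast
qed

lemma trivial_X_solvable:
  assumes "X = {\<one>}"
  shows "solvable G"
proof (rule ito[OF A_subgroup B_subgroup A_comm])
  have "y \<otimes> y = \<one>" "Y = {y}" unfolding Y_def using y_square assms y_carrier by auto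
  then show "\<And>v v'. v \<in> B \<Longrightarrow> v' \<in> B \<Longrightarrow> v \<otimes> v' = v' \<otimes> v" using assms y_carrier by auto
qed (use factor_AB in auto)

lemma hom_image:
  assumes h: "group_hom G K h" and surj: "h ` carrier G = carrier K"
  shows "abelian_dihedral_product K (h ` A) (h ` X) (h y)"
proof -
  interpret h: group_hom G K h by fact
  note [simp] = y_carrier
  have pw: "h x [^]\<^bsub>K\<^esub> n = h (x [^] n)" if "x \<in> carrier G" for x and n :: nat
    using that h.hom_nat_pow by simp
  show ?thesis
  proof (intro abelian_dihedral_product.intro abelian_dihedral_product_axioms.intro)
    show "group K" by (rule h.H.is_group)
    show "subgroup (h ` A) K" "subgroup (h ` X) K"
      using h.subgroup_img_is_subgroup A_subgroup X_subgroup by auto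
    show "h y \<otimes>\<^bsub>K\<^esub> h y \<in> h ` X" using y_square h.hom_mult[OF y_carrier y_carrier] by (metis image_eqI)
    show "h y \<in> carrier K" by simp
    fix a a' assume "a \<in> h ` A" "a' \<in> h ` A"
    then show "a \<otimes>\<^bsub>K\<^esub> a' = a' \<otimes>\<^bsub>K\<^esub> a" using A_comm by (metis (no_types, lifting) h.hom_mult imageE A.mem_carrier)
  next
    fix a a' assume "a \<in> h ` X" "a' \<in> h ` X"
    then show "a \<otimes>\<^bsub>K\<^esub> a' = a' \<otimes>\<^bsub>K\<^esub> a" using X_comm by (metis (no_types, lifting) h.hom_mult imageE X.mem_carrier)
  next
    fix g assume "g \<in> carrier K"
    then obtain g' where g': "g' \<in> carrier G" "g = h g'" using surj by blast
    obtain a x where "a \<in> A" "x \<in> X" "g' = a \<otimes> x \<or> g' = a \<otimes> (x \<otimes> y)" using factorisation[OF g'(1)] by blast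
    then have "h a \<in> h ` A" "h x \<in> h ` X" "g = h a \<otimes>\<^bsub>K\<^esub> h x \<or> g = h a \<otimes>\<^bsub>K\<^esub> (h x \<otimes>\<^bsub>K\<^esub> h y)"
      using g' by auto
    then show "\<exists>a\<in>h ` A. \<exists>x\<in>h ` X. g = a \<otimes>\<^bsub>K\<^esub> x \<or> g = a \<otimes>\<^bsub>K\<^esub> (x \<otimes>\<^bsub>K\<^esub> h y)"
      by blast
  next
    fix x assume "x \<in> h ` X"
    then obtain x' where x': "x' \<in> X" "x = h x'" by blast
    show "\<exists>w\<in>h ` X. w \<otimes>\<^bsub>K\<^esub> w = x" using X_sqrt[OF x'(1)] x'(2) by auto
    show "\<exists>n::nat. x [^]\<^bsub>K\<^esub> ((2::nat) ^ n) = \<one>\<^bsub>K\<^esub>"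
      using X_torsion[OF x'(1)] x' pw by (metis h.hom_one X.mem_carrier)
    show "x \<otimes>\<^bsub>K\<^esub> h y = h y \<otimes>\<^bsub>K\<^esub> inv\<^bsub>K\<^esub> x" 
      using y_inverts[OF x'(1)] x' by (metis h.hom_mult h.hom_inv X.mem_carrier X.m_inv_closed y_carrier)
    fix w assume "w \<in> h ` X"
    then obtain w' where w': "w' \<in> X" "w = h w'" by blast
    show "(\<exists>n::nat. x = w [^]\<^bsub>K\<^esub> n) \<or> (\<exists>n::nat. w = x [^]\<^bsub>K\<^esub> n)"
      using X_chain[OF x'(1) w'(1)] x' w' pw by (metis X.mem_carrier)
  qed
qed

lemma quotient:
  assumes "L \<lhd> G"
  shows "abelian_dihedral_product (G Mod L) ((#>) L ` A) ((#>) L ` X) (L #> y)"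
proof -
  interpret L: normal L G by fact
  interpret Q: group "G Mod L" by (rule L.factorgroup_is_group)
  have h: "group_hom G (G Mod L) ((#>) L)"
    using L.r_coset_hom_Mod by unfold_locales
  show ?thesis using hom_image[OF h] by (simp add: carrier_FactGroup)
qed

lemma y_square_inverse: "(y \<otimes> y) \<otimes> (y \<otimes> y) = \<one>"
proof -
  have "y \<otimes> (y \<otimes> y) = y \<otimes> inv (y \<otimes> y)"
    using y_inverts[OF y_square] y_carrier by (simp add: m_assoc)
  then have "y \<otimes> y = inv (y \<otimes> y)" using y_carrier by simp
  then show ?thesis by (metis m_closed r_inv y_carrier)
qed

end

text \<open>From now on \<open>X\<close> is nontrivial.  Its cyclic subgroups form a chain, so its involution \<open>z\<close> is unique
and is a power of every nontrivial element of \<open>X\<close>; this is how statements about \<open>z\<close> control all of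
\<open>X\<close>.\<close>

locale abelian_dihedral_product_inv = abelian_dihedral_product +
  fixes z
  assumes z_X: "z \<in> X" and z_ne: "z \<noteq> \<one>" and z_sq: "z \<otimes> z = \<one>"
begin

lemma z_carrier [simp]: "z \<in> carrier G" using z_X by simp

lemma z_inv [simp]: "inv z = z" using z_sq z_carrier by (metis inv_equality)

lemma z_cancel [simp]: "g \<in> carrier G \<Longrightarrow> z \<otimes> (z \<otimes> g) = g"
  by (simp add: m_assoc[symmetric] z_sq)

lemma z_pow: "z [^] (n::nat) \<in> {\<one>, z}"
  by (induction n) (auto simp: z_sq)

lemma z_power: "x \<in> X \<Longrightarrow> x \<noteq> \<one> \<Longrightarrow> \<exists>n::nat. z = x [^] n"
proof -
  assume x: "x \<in> X" "x \<noteq> \<one>"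
  from X_chain[OF x(1) z_X] show ?thesis
  proof
    assume "\<exists>n::nat. x = z [^] n"
    then have "x = z" using z_pow x by fastforce
    then have "z = x [^] (1::nat)" by simp
    then show ?thesis by blast
  qed
qed

lemma X_involution: "x \<in> X \<Longrightarrow> x \<otimes> x = \<one> \<Longrightarrow> x \<noteq> \<one> \<Longrightarrow> x = z"
proof -
  assume x: "x \<in> X" "x \<otimes> x = \<one>" "x \<noteq> \<one>"
  have "x [^] (n::nat) \<in> {\<one>, x}" for n by (induction n) (use x in auto)
  then show ?thesis using z_power[OF x(1,3)] z_ne by (metis empty_iff insert_iff)
qed

lemma z_central_B: "b \<in> B \<Longrightarrow> b \<otimes> z = z \<otimes> b"
  using X_comm z_X Y_inverts[OF z_X, of b] by auto

lemma commute_z: "x \<in> X \<Longrightarrow> x \<noteq> \<one> \<Longrightarrow> g \<in> carrier G \<Longrightarrow> x \<otimes> g = g \<otimes> x \<Longrightarrow> z \<otimes> g = g \<otimes> z"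
  using z_power group_commutes_pow X.mem_carrier by metis

text \<open>A common element \<open>k\<close> of \<open>X\<close> and \<open>Y\<close> would centralise and invert \<open>X\<close>, although \<open>X\<close> contains
square roots of \<open>z\<close>.\<close>

lemma XY_disjoint: "X \<inter> Y = {}"
proof (rule ccontr)
  assume "X \<inter> Y \<noteq> {}"
  then obtain k where k: "k \<in> X" "k \<in> Y" by blast
  obtain w where w: "w \<in> X" "w \<otimes> w = z" using X_sqrt[OF z_X] by blast
  have "k \<otimes> w = k \<otimes> inv w" using Y_inverts[OF w(1) k(2)] X_comm[OF k(1) w(1)] by simp
  then have "w = inv w" using k w by simp
  then have "w \<otimes> w = \<one>" using w by (metis r_inv X.mem_carrier)
  then show False using w z_ne by simp
qed

text \<open>Squaring is onto \<open>X\<close> but identifies \<open>z\<close> and 1.\<close>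

lemma infinite_X: "infinite X"
proof
  assume fin: "finite X"
  have "(\<lambda>x. x \<otimes> x) ` X = X" using X_sqrt by (force simp: image_iff)
  then have "inj_on (\<lambda>x. x \<otimes> x) X" using fin by (metis finite_surj_inj subset_refl)
  then show False using z_X z_ne z_sq X.one_closed by (auto dest: inj_onD[of _ _ z \<one>])
qed

lemma infinite_Y: "infinite Y"
proof -
  have "inj_on (\<lambda>x. x \<otimes> y) X" using y_carrier by (auto simp: inj_on_def)
  then show ?thesis unfolding Y_def using infinite_X finite_imageD by blast
qed

end

lemma (in abelian_dihedral_product) obtain_involution:
  assumes "X \<noteq> {\<one>}"
  obtains z where "abelian_dihedral_product_inv G A X y z"
proof -
  obtain x where x: "x \<in> X" "x \<noteq> \<one>" using assms X.one_closed by blast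
  define n where "n = (LEAST n::nat. x [^] ((2::nat) ^ n) = \<one>)"
  have n: "x [^] ((2::nat) ^ n) = \<one>" unfolding n_def using LeastI_ex[OF X_torsion[OF x(1)]] .
  then have "n \<noteq> 0" using x by (auto intro: ccontr)
  then obtain m where m: "n = Suc m" by (cases n) auto
  have "x [^] ((2::nat) ^ m) \<noteq> \<one>" using not_less_Least[of m "\<lambda>n. x [^] ((2::nat) ^ n) = \<one>"] m n_def by auto
  moreover have "x [^] ((2::nat) ^ m) \<otimes> x [^] ((2::nat) ^ m) = \<one>"
    using n m x by (simp add: nat_pow_mult mult_2)
  moreover have "x [^] ((2::nat) ^ m) \<in> X" using subgroup_pow_closed[OF X_subgroup x(1)] by simp
  ultimately have "abelian_dihedral_product_inv G A X y (x [^] ((2::nat) ^ m))"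
    by unfold_locales
  then show thesis by (rule that)
qed

section \<open>Factorised normal subgroups\<close>

context abelian_dihedral_product
begin

definition factorised where
  "factorised F \<longleftrightarrow> F \<lhd> G \<and> (\<forall>g\<in>F. \<exists>a\<in>A \<inter> F. \<exists>x\<in>X \<inter> F. g = a \<otimes> x)"

lemma factorised_solvable:
  assumes "factorised F"
  shows "solvable (G\<lparr>carrier := F\<rparr>)"
proof -
  interpret F: normal F G using assms factorised_def by blast
  interpret GF: group "G\<lparr>carrier := F\<rparr>" by (rule subgroup_imp_group[OF F.subgroup_axioms])
  show ?thesis
  proof (rule GF.ito)
    show "subgroup (A \<inter> F) (G\<lparr>carrier := F\<rparr>)" "subgroup (X \<inter> F) (G\<lparr>carrier := F\<rparr>)"
      using subgroups_Inter_pair[OF A_subgroup F.subgroup_axioms]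
        subgroups_Inter_pair[OF X_subgroup F.subgroup_axioms] F.subgroup_axioms
      by (auto intro: subgroup_incl)
  qed (use A_comm X_comm assms in \<open>auto simp: factorised_def\<close>)
qed

lemma exists_maximal_factorised:
  "\<exists>H. factorised H \<and> (\<forall>F. factorised F \<longrightarrow> H \<subseteq> F \<longrightarrow> F = H)"
proof -
  have "\<exists>H\<in>Collect factorised. \<forall>F\<in>Collect factorised. H \<subseteq> F \<longrightarrow> F = H"
  proof (rule subset_Zorn_nonempty)
    have "factorised {\<one>}"
      using one_is_normal A.one_closed X.one_closed by (auto simp: factorised_def)
    then show "Collect factorised \<noteq> {}" by blast
    fix C assume C: "C \<noteq> {}" "subset.chain (Collect factorised) C"
    have fac: "factorised F" if "F \<in> C" for F
      using C(2) that by (auto simp: subset.chain_def)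
    then have nrm: "F \<lhd> G" if "F \<in> C" for F using that factorised_def by blast
    then have sub: "subgroup F G" if "F \<in> C" for F using that normal_imp_subgroup by blast
    have lin: "F \<subseteq> F' \<or> F' \<subseteq> F" if "F \<in> C" "F' \<in> C" for F F'
      using C(2) that by (auto simp: subset.chain_def)
    have "subgroup (\<Union>C) G"
    proof (rule subgroupI)
      show "\<Union>C \<subseteq> carrier G" using sub subgroup.subset by blast
      show "\<Union>C \<noteq> {}" using C(1) sub subgroup.one_closed by blast
      fix g assume "g \<in> \<Union>C"
      then obtain F where F: "F \<in> C" "g \<in> F" by blast
      then show "inv g \<in> \<Union>C" using subgroup.m_inv_closed[OF sub[OF F(1)] F(2)] by blast
      fix h assume "h \<in> \<Union>C"
      then obtain F' where F': "F' \<in> C" "h \<in> F'" by blast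
      from lin[OF F(1) F'(1)] obtain E where E: "E \<in> C" "g \<in> E" "h \<in> E" using F F' by blast
      then show "g \<otimes> h \<in> \<Union>C" using subgroup.m_closed[OF sub[OF E(1)] E(2,3)] by blast
    qed
    moreover have "g \<otimes> h \<otimes> inv g \<in> \<Union>C" if "g \<in> carrier G" "h \<in> \<Union>C" for g h
    proof -
      from that obtain F where F: "F \<in> C" "h \<in> F" by blast
      then have "g \<otimes> h \<otimes> inv g \<in> F" using nrm[OF F(1)] that(1) unfolding normal_inv_iff by blast
      then show ?thesis using F by blast
    qed
    ultimately have "\<Union>C \<lhd> G" unfolding normal_inv_iff by blast
    moreover have "\<exists>a\<in>A \<inter> \<Union>C. \<exists>x\<in>X \<inter> \<Union>C. g = a \<otimes> x" if "g \<in> \<Union>C" for g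
    proof -
      from that obtain F where F: "F \<in> C" "g \<in> F" by blast
      then obtain a x where "a \<in> A \<inter> F" "x \<in> X \<inter> F" "g = a \<otimes> x"
        using fac[OF F(1)] unfolding factorised_def by blast
      then show ?thesis using F(1) by blast
    qed
    ultimately show "\<Union>C \<in> Collect factorised" by (simp add: factorised_def)
  qed
  then show ?thesis by auto
qed

text \<open>The preimage \<open>E\<close> of a factorised subgroup of \<open>G / H\<close> is factorised, because \<open>H\<close> is: in
\<open>g = h (a x)\<close> the element \<open>h \<in> H\<close> can be moved between \<open>a\<close> and \<open>x\<close> and split there.\<close>

lemma maximal_quotient:
  assumes H: "factorised H" and max: "\<And>F. factorised F \<Longrightarrow> H \<subseteq> F \<Longrightarrow> F = H"
    and F: "abelian_dihedral_product.factorised (G Mod H) ((#>) H ` A) ((#>) H ` X) F"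
  shows "F = {\<one>\<^bsub>G Mod H\<^esub>}"
proof -
  have Hn: "H \<lhd> G" using H factorised_def by blast
  interpret H: normal H G by fact
  interpret Q: abelian_dihedral_product "G Mod H" "(#>) H ` A" "(#>) H ` X" "H #> y"
    by (rule quotient[OF Hn])
  interpret h: group_hom G "G Mod H" "(#>) H"
    using H.r_coset_hom_Mod by unfold_locales
  have Fn: "F \<lhd> G Mod H" using F Q.factorised_def by blast
  interpret F: normal F "G Mod H" by fact
  define E where "E = {g \<in> carrier G. H #> g \<in> F}"
  have one: "H #> h = \<one>\<^bsub>G Mod H\<^esub>" if "h \<in> H" for h
    using that H.subgroup_axioms by (simp add: coset_join2 H.mem_carrier)
  have HE: "H \<subseteq> E" using one F.one_closed H.mem_carrier by (auto simp: E_def)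
  have "subgroup E G"
  proof (rule subgroupI)
    show "E \<subseteq> carrier G" by (auto simp: E_def)
    show "E \<noteq> {}" using HE H.one_closed by blast
    fix g assume g: "g \<in> E"
    then show "inv g \<in> E" using F.m_inv_closed[of "H #> g"] by (simp add: E_def)
    fix h assume h: "h \<in> E"
    then show "g \<otimes> h \<in> E" using g F.m_closed[of "H #> g" "H #> h"] by (simp add: E_def)
  qed
  moreover have "g \<otimes> h \<otimes> inv g \<in> E" if "g \<in> carrier G" "h \<in> E" for g h
    using that Fn[unfolded Q.normal_inv_iff] h.hom_closed by (auto simp: E_def simp del: mult_FactGroup)
  ultimately have En: "E \<lhd> G" unfolding normal_inv_iff by blast
  interpret E: normal E G by fact
  have "\<exists>a\<in>A \<inter> E. \<exists>x\<in>X \<inter> E. g = a \<otimes> x" if g: "g \<in> E" for g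
  proof -
    have gc: "g \<in> carrier G" "H #> g \<in> F" using g unfolding E_def by blast+
    obtain P Q where PQ: "P \<in> (#>) H ` A \<inter> F" "Q \<in> (#>) H ` X \<inter> F" "H #> g = P \<otimes>\<^bsub>G Mod H\<^esub> Q"
      using F[unfolded Q.factorised_def, THEN conjunct2, rule_format, OF gc(2)] by blast
    then obtain a x where ax: "a \<in> A" "H #> a \<in> F" "x \<in> X" "H #> x \<in> F"
        "H #> g = (H #> a) \<otimes>\<^bsub>G Mod H\<^esub> (H #> x)"
      by auto
    have "H #> g = H #> (a \<otimes> x)" unfolding ax(5) using ax(1,3) h.hom_mult[of a x] by simp
    then have "g \<in> H #> (a \<otimes> x)" using gc rcos_self[OF gc(1) H.subgroup_axioms] by simp
    then obtain h where h: "h \<in> H" "g = h \<otimes> (a \<otimes> x)" by (auto simp: r_coset_def)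
    have "inv a \<otimes> h \<otimes> a \<in> H" using H.inv_op_closed1 ax h by simp
    then obtain a' x' where ax': "a' \<in> A \<inter> H" "x' \<in> X \<inter> H" "inv a \<otimes> h \<otimes> a = a' \<otimes> x'"
      using H unfolding factorised_def by blast
    have hc: "h \<in> carrier G" using h H.mem_carrier by blast
    have "g = a \<otimes> (inv a \<otimes> h \<otimes> a) \<otimes> x" using h ax hc by (simp add: word_simps)
    also have "\<dots> = (a \<otimes> a') \<otimes> (x' \<otimes> x)" unfolding ax'(3) using ax ax' by (simp add: m_assoc)
    finally have "g = (a \<otimes> a') \<otimes> (x' \<otimes> x)" .
    moreover have "a \<in> E" "x \<in> E" using ax(1-4) A.mem_carrier X.mem_carrier unfolding E_def by blast+
    moreover have "a' \<in> E" "x' \<in> E" using ax'(1,2) HE by blast+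
    ultimately have "g = (a \<otimes> a') \<otimes> (x' \<otimes> x)" "a \<otimes> a' \<in> E" "x' \<otimes> x \<in> E"
      using E.m_closed by blast+
    moreover have "a \<otimes> a' \<in> A" "x' \<otimes> x \<in> X" using ax(1,3) ax'(1,2) by blast+
    ultimately show ?thesis by blast
  qed
  then have "factorised E" using En factorised_def by blast
  then have E: "E = H" using max HE by blast
  have "F \<subseteq> {\<one>\<^bsub>G Mod H\<^esub>}"
  proof
    fix f assume f: "f \<in> F"
    then obtain g where g: "g \<in> carrier G" "f = H #> g"
      using F.subset by (auto simp: carrier_FactGroup)
    then have "g \<in> E" using f unfolding E_def by blast
    then have "g \<in> H" unfolding E .
    then show "f \<in> {\<one>\<^bsub>G Mod H\<^esub>}" unfolding g(2) singleton_iff by (rule one)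
  qed
  moreover have "{\<one>\<^bsub>G Mod H\<^esub>} \<subseteq> F" by (simp only: F.one_closed insert_subset empty_subsetI simp_thms)
  ultimately show ?thesis by (rule subset_antisym)
qed

lemma solvable_if_quotient:
  assumes "factorised H" "solvable (G Mod H)"
  shows "solvable G"
proof (rule solvable_extension[OF _ factorised_solvable[OF assms(1)] assms(2)])
  show "H \<lhd> G" using assms(1) unfolding factorised_def by (rule conjunct1)
qed

end

section \<open>The centraliser of the class of the involution\<close>

context group
begin

definition cent where "cent g = {h \<in> carrier G. h \<otimes> g = g \<otimes> h}"

lemma cent_subgroup: "g \<in> carrier G \<Longrightarrow> subgroup (cent g) G"
proof (rule subgroupI)
  assume g: "g \<in> carrier G"
  show "cent g \<subseteq> carrier G" "cent g \<noteq> {}" using g by (auto simp: cent_def)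
  fix a assume a: "a \<in> cent g"
  then have ac: "a \<in> carrier G" by (simp add: cent_def)
  have "inv a \<otimes> g = inv a \<otimes> (g \<otimes> a) \<otimes> inv a" using ac g by (simp add: word_simps)
  also have "g \<otimes> a = a \<otimes> g" using a by (simp add: cent_def)
  also have "inv a \<otimes> (a \<otimes> g) \<otimes> inv a = g \<otimes> inv a" using ac g by (simp add: word_simps)
  finally have "inv a \<otimes> g = g \<otimes> inv a" .
  then show "inv a \<in> cent g" using a by (auto simp: cent_def)
  fix b assume b: "b \<in> cent g"
  then have bc: "b \<in> carrier G" by (simp add: cent_def)
  have "a \<otimes> b \<otimes> g = a \<otimes> (b \<otimes> g)" using ac bc g by (simp add: m_assoc)
  also have "b \<otimes> g = g \<otimes> b" using b by (simp add: cent_def)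
  also have "a \<otimes> (g \<otimes> b) = (a \<otimes> g) \<otimes> b" using ac bc g by (simp add: m_assoc)
  also have "a \<otimes> g = g \<otimes> a" using a by (simp add: cent_def)
  also have "g \<otimes> a \<otimes> b = g \<otimes> (a \<otimes> b)" using ac bc g by (simp add: m_assoc)
  finally have "a \<otimes> b \<otimes> g = g \<otimes> (a \<otimes> b)" .
  then show "a \<otimes> b \<in> cent g" using a b by (auto simp: cent_def)
qed

lemma cent_sym: "g \<in> carrier G \<Longrightarrow> h \<in> cent g \<Longrightarrow> g \<in> cent h"
  by (simp add: cent_def)

lemma cent_carrier: "h \<in> cent g \<Longrightarrow> h \<in> carrier G"
  by (simp add: cent_def)

lemmas cent_mult = subgroup.m_closed[OF cent_subgroup]
lemmas cent_inv = subgroup.m_inv_closed[OF cent_subgroup]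

lemma cent_self: "g \<in> carrier G \<Longrightarrow> g \<in> cent g"
  by (simp add: cent_def)

lemma cent_cancel_left:
  assumes "g \<in> carrier G" "a \<in> cent g" "b \<in> carrier G" "a \<otimes> b \<in> cent g"
  shows "b \<in> cent g"
proof -
  have "inv a \<otimes> (a \<otimes> b) \<in> cent g" using assms cent_mult cent_inv by blast
  then show ?thesis using assms cent_carrier[OF assms(2)] by (simp add: word_simps)
qed

lemma cent_cancel_right:
  assumes "g \<in> carrier G" "b \<in> cent g" "a \<in> carrier G" "a \<otimes> b \<in> cent g"
  shows "a \<in> cent g"
proof -
  have "(a \<otimes> b) \<otimes> inv b \<in> cent g" using assms cent_mult cent_inv by blast
  then show ?thesis using assms cent_carrier[OF assms(2)] by (simp add: word_simps)
qed

lemma cent_conj: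
  assumes "g \<in> carrier G" "h \<in> carrier G" "k \<in> cent g"
  shows "inv h \<otimes> k \<otimes> h \<in> cent (inv h \<otimes> g \<otimes> h)"
proof -
  have k: "k \<in> carrier G" "k \<otimes> g = g \<otimes> k" using assms(3) by (auto simp: cent_def)
  have "(inv h \<otimes> k \<otimes> h) \<otimes> (inv h \<otimes> g \<otimes> h) = inv h \<otimes> (k \<otimes> g) \<otimes> h"
    using k(1) assms(1,2) by (simp add: word_simps)
  also have "\<dots> = (inv h \<otimes> g \<otimes> h) \<otimes> (inv h \<otimes> k \<otimes> h)"
    unfolding k(2) using k(1) assms(1,2) by (simp add: word_simps)
  finally show ?thesis using k(1) assms(1,2) by (simp add: cent_def)
qed

end

context abelian_dihedral_product_inv
begin

definition zc where "zc h = inv h \<otimes> z \<otimes> h"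

lemma zc_carrier [simp]: "h \<in> carrier G \<Longrightarrow> zc h \<in> carrier G"
  by (simp add: zc_def)

lemma zc_sq: "h \<in> carrier G \<Longrightarrow> zc h \<otimes> zc h = \<one>"
  by (simp add: zc_def word_simps)

lemma zc_mult: "g \<in> carrier G \<Longrightarrow> h \<in> carrier G \<Longrightarrow> zc (g \<otimes> h) = inv h \<otimes> zc g \<otimes> h"
  by (simp add: zc_def word_simps)

lemma zc_B: "b \<in> B \<Longrightarrow> zc b = z"
proof -
  assume b: "b \<in> B"
  have "inv b \<otimes> z \<otimes> b = inv b \<otimes> (b \<otimes> z)"
    unfolding z_central_B[OF b] using B_carrier[OF b] by (simp add: m_assoc)
  then show ?thesis using B_carrier[OF b] by (simp add: zc_def word_simps)
qed

lemma zc_mult_B: "b \<in> B \<Longrightarrow> h \<in> carrier G \<Longrightarrow> zc (b \<otimes> h) = zc h"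
  unfolding zc_mult[OF B_carrier] zc_B by (simp only: zc_def)

text \<open>As \<open>z\<close> is central in \<open>B\<close> and \<open>G = B A\<close>, its conjugates under \<open>A\<close> are all its conjugates.\<close>

lemma zc_A: "g \<in> carrier G \<Longrightarrow> \<exists>a\<in>A. zc g = zc a"
proof -
  assume g: "g \<in> carrier G"
  obtain b a where ba: "b \<in> B" "a \<in> A" "g = b \<otimes> a" using factor_BA[OF g] by blast
  then have "zc g = zc a" using zc_mult_B[OF ba(1) A.mem_carrier[OF ba(2)]] by simp
  then show ?thesis using ba(2) by blast
qed

lemma B_cent_z: "B \<subseteq> cent z"
  using z_central_B B_carrier by (auto simp: cent_def)

lemma A_cent_A: "a \<in> A \<Longrightarrow> a' \<in> A \<Longrightarrow> a \<in> cent a'"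
  using A_comm by (simp add: cent_def)

lemma commute_z_cent: "x \<in> X \<Longrightarrow> x \<noteq> \<one> \<Longrightarrow> g \<in> carrier G \<Longrightarrow> x \<in> cent g \<Longrightarrow> z \<in> cent g"
  using commute_z[of x g] unfolding cent_def by simp

end

locale irreducible_product = abelian_dihedral_product_inv +
  assumes irreducible: "factorised F \<Longrightarrow> F = {\<one>}"
begin

lemma normal_in_A: "F \<lhd> G \<Longrightarrow> F \<subseteq> A \<Longrightarrow> F = {\<one>}"
proof -
  assume F: "F \<lhd> G" "F \<subseteq> A"
  interpret F: normal F G by fact
  have "\<exists>a\<in>A \<inter> F. \<exists>x\<in>X \<inter> F. g = a \<otimes> x" if "g \<in> F" for g
    using that F(2) X.one_closed F.one_closed F.mem_carrier by (intro bexI[of _ g] bexI[of _ \<one>]) auto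
  then have "factorised F" using F(1) by (simp add: factorised_def)
  then show ?thesis by (rule irreducible)
qed

lemma normal_in_X: "F \<lhd> G \<Longrightarrow> F \<subseteq> X \<Longrightarrow> F = {\<one>}"
proof -
  assume F: "F \<lhd> G" "F \<subseteq> X"
  interpret F: normal F G by fact
  have "\<exists>a\<in>A \<inter> F. \<exists>x\<in>X \<inter> F. g = a \<otimes> x" if "g \<in> F" for g
    using that F(2) A.one_closed F.one_closed X.mem_carrier by (intro bexI[of _ \<one>] bexI[of _ g]) auto
  then have "factorised F" using F(1) by (simp add: factorised_def)
  then show ?thesis by (rule irreducible)
qed

lemma central_in_A:
  assumes "a \<in> A" "B \<subseteq> cent a"
  shows "a = \<one>"
proof -
  define F where "F = {a \<in> A. \<forall>g\<in>carrier G. a \<in> cent g}"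
  have "F \<lhd> G" unfolding normal_inv_iff
  proof (intro conjI ballI)
    show "subgroup F G"
    proof (rule subgroupI)
      show "F \<subseteq> carrier G" by (auto simp: F_def)
      have "\<one> \<in> F" using A.one_closed by (simp add: F_def cent_def)
      then show "F \<noteq> {}" by blast
      fix a assume a: "a \<in> F"
      then show "inv a \<in> F" using cent_inv by (simp add: F_def)
      fix b assume b: "b \<in> F"
      show "a \<otimes> b \<in> F" using a b cent_mult by (simp add: F_def)
    qed
    fix g h assume g: "g \<in> carrier G" and h: "h \<in> F"
    then have "g \<otimes> h = h \<otimes> g" "h \<in> carrier G" by (simp_all add: F_def cent_def)
    then have "g \<otimes> h \<otimes> inv g = h" using g by (simp add: m_assoc)
    then show "g \<otimes> h \<otimes> inv g \<in> F" using h by simp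
  qed
  moreover have "F \<subseteq> A" by (auto simp: F_def)
  moreover have "a \<in> F"
  proof -
    have "a \<in> cent g" if g: "g \<in> carrier G" for g
    proof -
      obtain a' b where "a' \<in> A" "b \<in> B" "g = a' \<otimes> b" using factor_AB[OF g] by blast
      then have "g \<in> cent a" using cent_mult[OF A.mem_carrier[OF assms(1)]] A_cent_A[OF _ assms(1)] assms(2) by blast
      then show ?thesis using cent_sym[OF A.mem_carrier[OF assms(1)]] by blast
    qed
    then show ?thesis using assms(1) F_def by blast
  qed
  ultimately show ?thesis using normal_in_A by blast
qed

lemma z_not_central: "\<not> A \<subseteq> cent z"
proof
  assume A: "A \<subseteq> cent z"
  have c: "g \<otimes> z = z \<otimes> g" if g: "g \<in> carrier G" for g
  proof -
    obtain a b where "a \<in> A" "b \<in> B" "g = a \<otimes> b" using factor_AB[OF g] by blast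
    then have "g \<in> cent z" using cent_mult[OF z_carrier] A B_cent_z by blast
    then show ?thesis by (simp add: cent_def)
  qed
  have "{\<one>, z} \<lhd> G" unfolding normal_inv_iff
  proof (intro conjI ballI)
    show "subgroup {\<one>, z} G" by (rule subgroupI) (auto simp: z_sq)
    fix g h assume g: "g \<in> carrier G" and h: "h \<in> {\<one>, z}"
    show "g \<otimes> h \<otimes> inv g \<in> {\<one>, z}" using g h c[OF g] by (auto simp: m_assoc)
  qed
  then have "{\<one>, z} = {\<one>}" using normal_in_X z_X X.one_closed by blast
  then show False using z_ne by blast
qed

text \<open>A nontrivial common element has \<open>z\<close> as a power, and then \<open>z\<close> commutes with \<open>A\<close>.\<close>

lemma A_X_disjoint: "x \<in> A \<Longrightarrow> x \<in> X \<Longrightarrow> x = \<one>"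
proof (rule ccontr)
  assume x: "x \<in> A" "x \<in> X" "x \<noteq> \<one>"
  obtain n where "z = x [^] (n::nat)" using z_power[OF x(2,3)] by blast
  then have "z \<in> A" using subgroup_pow_closed[OF A_subgroup x(1)] by simp
  then have "A \<subseteq> cent z" using A_cent_A by blast
  then show False using z_not_central by blast
qed

text \<open>The centraliser of the conjugacy class of \<open>z\<close>.\<close>

definition K where "K = {g \<in> carrier G. \<forall>h\<in>carrier G. g \<in> cent (zc h)}"

lemma K_normal: "K \<lhd> G"
  unfolding normal_inv_iff
proof (intro conjI ballI)
  show "subgroup K G"
  proof (rule subgroupI)
    show "K \<subseteq> carrier G" by (auto simp: K_def)
    show "K \<noteq> {}" by (auto simp: K_def cent_def)
    fix a assume a: "a \<in> K"
    then show "inv a \<in> K" using cent_inv by (simp add: K_def)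
    fix b assume b: "b \<in> K"
    show "a \<otimes> b \<in> K" using a b cent_mult by (simp add: K_def)
  qed
  fix g k assume g: "g \<in> carrier G" and k: "k \<in> K"
  have "g \<otimes> k \<otimes> inv g \<in> cent (zc h)" if h: "h \<in> carrier G" for h
  proof -
    have "k \<in> cent (zc (h \<otimes> g))" using k g h by (simp add: K_def)
    then have "inv (inv g) \<otimes> k \<otimes> inv g \<in> cent (inv (inv g) \<otimes> zc (h \<otimes> g) \<otimes> inv g)"
      using cent_conj[of "zc (h \<otimes> g)" "inv g" k] g h by simp
    moreover have "inv (inv g) \<otimes> zc (h \<otimes> g) \<otimes> inv g = zc h"
      using g h by (simp add: zc_def word_simps)
    ultimately show ?thesis using g by simp
  qed
  then show "g \<otimes> k \<otimes> inv g \<in> K" using g k by (simp add: K_def)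
qed

sublocale K: normal K G by (rule K_normal)

lemma K_I: "g \<in> carrier G \<Longrightarrow> (\<And>a. a \<in> A \<Longrightarrow> g \<in> cent (zc a)) \<Longrightarrow> g \<in> K"
proof -
  assume g: "g \<in> carrier G" and c: "\<And>a. a \<in> A \<Longrightarrow> g \<in> cent (zc a)"
  have "g \<in> cent (zc h)" if h: "h \<in> carrier G" for h
  proof -
    obtain a where "a \<in> A" "zc h = zc a" using zc_A[OF h] by blast
    then show ?thesis using c by simp
  qed
  then show ?thesis using g unfolding K_def by blast
qed

text \<open>This is where commutativity of \<open>A\<close> enters: the class of \<open>z\<close> consists of conjugates under \<open>A\<close>.  It
makes \<open>K\<close> the product of \<open>A \<inter> K\<close> and \<open>B \<inter> K\<close>.\<close>

lemma A_K: "a \<in> A \<Longrightarrow> a \<in> cent z \<Longrightarrow> a \<in> K"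
proof (rule K_I)
  fix a' assume a: "a \<in> A" "a \<in> cent z" "a' \<in> A"
  have "inv a' \<otimes> a \<otimes> a' = a" using A_comm[OF a(1,3)] a by (simp add: word_simps)
  then show "a \<in> cent (zc a')" using cent_conj[OF z_carrier, of a' a] a by (simp add: zc_def)
qed simp

lemma K_D: "g \<in> K \<Longrightarrow> h \<in> carrier G \<Longrightarrow> g \<in> cent (zc h)"
  unfolding K_def by blast

lemma K_cent_z: "K \<subseteq> cent z"
proof
  fix g assume "g \<in> K"
  then have "g \<in> cent (zc \<one>)" using K_D by blast
  moreover have "zc \<one> = z" by (simp add: zc_def)
  ultimately show "g \<in> cent z" by simp
qed

lemma K_factor:
  assumes "g \<in> K"
  shows "\<exists>a\<in>A \<inter> K. \<exists>b\<in>B \<inter> K. g = a \<otimes> b"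
proof -
  obtain a b where ab: "a \<in> A" "b \<in> B" "g = a \<otimes> b" using factor_AB[OF K.mem_carrier[OF assms]] by blast
  have "a \<in> cent z"
    using cent_cancel_right[OF z_carrier subsetD[OF B_cent_z ab(2)] A.mem_carrier[OF ab(1)]]
      subsetD[OF K_cent_z assms] ab(3) by simp
  then have a: "a \<in> K" using A_K ab by blast
  have "inv a \<otimes> g = b" using ab B_carrier[OF ab(2)] by (simp add: word_simps)
  then have "b \<in> K" using a assms K.m_closed K.m_inv_closed by metis
  then show ?thesis using a ab by blast
qed

text \<open>As \<open>k\<close> inverts \<open>X\<close>, the commutators of \<open>k\<close> with the elements of \<open>X\<close> are the squares in
\<open>X\<close>, that is, all of \<open>X\<close>.\<close>

lemma normal_contains_B:
  assumes "F \<lhd> G" "k \<in> F" "k \<in> Y"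
  shows "B \<subseteq> F"
proof -
  interpret F: normal F G by fact
  have X: "x \<in> F" if x: "x \<in> X" for x
  proof -
    obtain w where w: "w \<in> X" "w \<otimes> w = x" using X_sqrt[OF x] by blast
    have "w \<otimes> k \<otimes> inv w \<in> F" using F.inv_op_closed2 w assms by simp
    then have "w \<otimes> k \<otimes> inv w \<otimes> inv k \<in> F" using assms by simp
    moreover have "k \<otimes> inv w = w \<otimes> k" using Y_inverts w assms by simp
    then have "w \<otimes> k \<otimes> inv w \<otimes> inv k = x" using w(1) assms(3) unfolding w(2)[symmetric] by (simp add: m_assoc)
    ultimately show ?thesis by simp
  qed
  moreover have "k' \<in> F" if k': "k' \<in> Y" for k'
  proof -
    have "k' \<otimes> inv k \<in> F" using X k' assms by simp
    then have "k' \<otimes> inv k \<otimes> k \<in> F" using assms by blast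
    then show ?thesis using k' assms by (simp add: m_assoc)
  qed
  ultimately show ?thesis by blast
qed

lemma K_Mod_solvable: "X \<subseteq> K \<Longrightarrow> solvable (G Mod K)"
proof -
  assume X: "X \<subseteq> K"
  interpret Q: abelian_dihedral_product "G Mod K" "(#>) K ` A" "(#>) K ` X" "K #> y"
    by (rule quotient[OF K_normal])
  have "K #> x = K" if "x \<in> X" for x
    using coset_join2[OF X.mem_carrier[OF that] K.subgroup_axioms] X that by blast
  then have "(#>) K ` X = {K}" using X.one_closed by blast
  then have "(#>) K ` X = {\<one>\<^bsub>G Mod K\<^esub>}" by simp
  then show ?thesis by (rule Q.trivial_X_solvable)
qed

text \<open>Let \<open>z \<in> K\<close>.  By irreducibility \<open>K\<close> is not the product of \<open>A \<inter> K\<close> and \<open>X \<inter> K\<close>, so \<open>K\<close> meets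
\<open>Y\<close> and contains \<open>B\<close>.  Take a conjugate \<open>?d\<close> of \<open>z\<close> different from \<open>z\<close> and write it
as \<open>c b\<close> with \<open>c \<in> A\<close> and \<open>b \<in> B\<close>; all of \<open>K\<close> commutes with \<open>?d\<close>, and \<open>b\<^sup>2\<close> lies in
\<open>A \<inter> X = 1\<close>.  If \<open>b \<in> X\<close>, then \<open>b\<close> is 1 or \<open>z\<close>, so \<open>c\<close> is central in \<open>G\<close> and hence trivial, which is
absurd.  If \<open>b \<in> Y\<close>, then \<open>b\<close> commutes with \<open>A0 = A \<inter> K\<close>, and \<open>K = (A0 \<union> A0 b) X\<close> is
a product of two abelian subgroups, while \<open>G / K\<close> is a quotient of \<open>A\<close>.\<close>

lemma solvable_or_z_notin_K: "solvable G \<or> z \<notin> K"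
proof (rule disjCI, simp)
  assume zK: "z \<in> K"
  have "\<exists>k. k \<in> K \<and> k \<in> Y"
  proof (rule ccontr)
    assume "\<nexists>k. k \<in> K \<and> k \<in> Y"
    then have "B \<inter> K \<subseteq> X \<inter> K" by blast
    then have "\<exists>a\<in>A \<inter> K. \<exists>x\<in>X \<inter> K. g = a \<otimes> x" if "g \<in> K" for g
      using K_factor[OF that] by (meson subsetD)
    then have "factorised K" using K_normal unfolding factorised_def by simp
    then have "K = {\<one>}" by (rule irreducible)
    then show False using zK z_ne by simp
  qed
  then have BK: "B \<subseteq> K" using normal_contains_B[OF K_normal] by blast
  obtain a where a: "a \<in> A" "a \<notin> cent z" using z_not_central by blast
  let ?d = "zc a"
  have dc: "?d \<in> carrier G" using a by simp
  have K_d: "K \<subseteq> cent ?d" using K_D a(1) A.mem_carrier by blast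
  obtain c b where cb: "c \<in> A" "b \<in> B" "?d = c \<otimes> b" using factor_AB[OF dc] by blast
  have bc: "b \<in> carrier G" using cb(2) B_carrier by blast
  have d_z: "?d \<in> cent z" using K_d zK cent_sym[OF dc] by blast
  have c_z: "c \<in> cent z"
    using cent_cancel_right[OF z_carrier subsetD[OF B_cent_z cb(2)] A.mem_carrier[OF cb(1)]]
      d_z cb(3) by simp
  have cK: "c \<in> K" using A_K cb c_z by blast
  have "c \<in> cent ?d" using K_d cK by blast
  then have cb_comm: "c \<in> cent b"
    using cent_cancel_left[of c c b] cb bc cent_self[of c] cent_sym[of ?d c] cent_sym[of c b] dc by (metis A.mem_carrier)
  have "c \<otimes> c \<otimes> (b \<otimes> b) = c \<otimes> (c \<otimes> b) \<otimes> b" using cb(1) bc by (simp add: m_assoc)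
  also have "c \<otimes> b = b \<otimes> c" using cb_comm by (simp add: cent_def)
  also have "c \<otimes> (b \<otimes> c) \<otimes> b = ?d \<otimes> ?d" unfolding cb(3) using cb(1) bc by (simp add: m_assoc)
  also have "\<dots> = \<one>" using zc_sq a by simp
  finally have "b \<otimes> b = inv (c \<otimes> c)" using cb(1) bc by (metis A.mem_carrier inv_equality inv_inv m_closed)
  then have "b \<otimes> b \<in> A" using cb(1) by simp
  moreover have "b \<otimes> b \<in> X" using cb(2) by auto
  ultimately have bb: "b \<otimes> b = \<one>" using A_X_disjoint by blast
  show "solvable G"
  proof (cases "b \<in> X")
    case True
    have "B \<subseteq> cent c"
    proof -
      have b1z: "b = \<one> \<or> b = z" using X_involution[OF True bb] by blast
      have "b' \<in> cent c" if b': "b' \<in> B" for b'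
      proof -
        have "b' \<in> cent ?d" using BK K_d b' by blast
        then have "?d \<in> cent b'" using cent_sym[OF dc] by blast
        moreover have "b \<in> cent b'"
          using b1z B_cent_z b' cent_sym[OF z_carrier, of b'] by (auto simp: cent_def)
        ultimately have "c \<in> cent b'" using cent_cancel_right[of b' b c] cb B_carrier[OF b'] by auto
        then show ?thesis using cent_sym B_carrier[OF b'] by blast
      qed
      then show ?thesis by blast
    qed
    then have "c = \<one>" using central_in_A cb by blast
    then have "?d = b" unfolding cb(3) using bc by simp
    then have "?d = \<one> \<or> ?d = z" using X_involution[OF True bb] by metis
    moreover have "?d \<noteq> \<one>"
    proof
      assume d1: "?d = \<one>"
      have "z = a \<otimes> ?d \<otimes> inv a" using a(1) by (simp add: zc_def word_simps)
      also have "\<dots> = \<one>" unfolding d1 using a(1) by simp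
      finally show False using z_ne by simp
    qed
    moreover have "?d \<noteq> z"
    proof
      assume dz: "?d = z"
      have "z \<otimes> a = a \<otimes> ?d" using a(1) by (simp add: zc_def word_simps)
      then have "z \<otimes> a = a \<otimes> z" unfolding dz .
      then show False using a by (simp add: cent_def)
    qed
    ultimately show ?thesis by blast
  next
    case False
    then have bY: "b \<in> Y" using cb(2) by blast
    define A0 where "A0 = A \<inter> cent z"
    have A0K: "A0 \<subseteq> K" using A_K A0_def by blast
    have A0_sub: "subgroup A0 G" unfolding A0_def
      by (rule subgroups_Inter_pair[OF A_subgroup cent_subgroup[OF z_carrier]])
    interpret A0: subgroup A0 G by fact
    have A0_b: "a0 \<in> cent b" if a0: "a0 \<in> A0" for a0
    proof -
      have "?d \<in> cent a0" using A0K K_d a0 cent_sym[OF dc] by blast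
      moreover have "c \<in> cent a0" using A_cent_A a0 cb(1) A0_def by blast
      ultimately have "b \<in> cent a0" using cent_cancel_left[of a0 c b] cb bc a0 by auto
      then show ?thesis using cent_sym[OF A0.mem_carrier[OF a0]] by blast
    qed
    define U where "U = A0 \<union> (\<lambda>a. a \<otimes> b) ` A0"
    have U_I: "a0 \<in> U" "a0 \<otimes> b \<in> U" if "a0 \<in> A0" for a0
      unfolding U_def using that by auto
    have binv: "inv b = b" using bb bc by (metis inv_equality)
    have 1: "a1 \<otimes> (a0 \<otimes> b) = (a1 \<otimes> a0) \<otimes> b" if "a0 \<in> A0" "a1 \<in> A0" for a0 a1
      using that bc by (simp add: m_assoc)
    have 2: "(a0 \<otimes> b) \<otimes> a1 = (a0 \<otimes> a1) \<otimes> b" if "a0 \<in> A0" "a1 \<in> A0" for a0 a1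
      using that bc A0_b[of a1] by (simp add: m_assoc cent_def)
    have 3: "(a0 \<otimes> b) \<otimes> (a1 \<otimes> b) = a0 \<otimes> a1" if "a0 \<in> A0" "a1 \<in> A0" for a0 a1
    proof -
      have "(a0 \<otimes> b) \<otimes> (a1 \<otimes> b) = a0 \<otimes> (b \<otimes> a1) \<otimes> b" using that bc by (simp add: m_assoc)
      also have "b \<otimes> a1 = a1 \<otimes> b" using that A0_b[of a1] by (simp add: cent_def)
      also have "a0 \<otimes> (a1 \<otimes> b) \<otimes> b = a0 \<otimes> a1 \<otimes> (b \<otimes> b)" using that bc by (simp add: m_assoc)
      finally show ?thesis using bb that by simp
    qed

    have A0_comm: "a0 \<otimes> a1 = a1 \<otimes> a0" if "a0 \<in> A0" "a1 \<in> A0" for a0 a1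
      using A_comm that unfolding A0_def by blast
    have U_comm: "u \<otimes> u' = u' \<otimes> u" if u: "u \<in> U" and u': "u' \<in> U" for u u'
    proof -
      obtain a0 where a0: "a0 \<in> A0" "u = a0 \<or> u = a0 \<otimes> b" using u unfolding U_def by blast
      obtain a1 where a1: "a1 \<in> A0" "u' = a1 \<or> u' = a1 \<otimes> b" using u' unfolding U_def by blast
      show ?thesis using a0(2) a1(2)
        by (elim disjE) (simp_all only: 1[OF a0(1) a1(1)] 1[OF a1(1) a0(1)] 2[OF a0(1) a1(1)]
            2[OF a1(1) a0(1)] 3[OF a0(1) a1(1)] 3[OF a1(1) a0(1)] A0_comm[OF a1(1) a0(1)])
    qed
    have U_sub: "subgroup U G"
    proof (rule subgroupI)
      show "U \<subseteq> carrier G" using bc by (auto simp: U_def)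
      show "U \<noteq> {}" using A0.one_closed unfolding U_def by blast
      fix u assume u: "u \<in> U"
      have inv_ab: "inv (a0 \<otimes> b) = inv a0 \<otimes> b" if a0: "a0 \<in> A0" for a0
      proof -
        have "inv (a0 \<otimes> b) = b \<otimes> inv a0" using a0 bc by (simp add: inv_mult_group binv)
        also have "\<dots> = inv a0 \<otimes> b" using A0_b[OF A0.m_inv_closed[OF a0]] by (simp add: cent_def)
        finally show ?thesis .
      qed
      obtain a0 where a0: "a0 \<in> A0" "u = a0 \<or> u = a0 \<otimes> b" using u unfolding U_def by blast
      show "inv u \<in> U" using a0(2) inv_ab[OF a0(1)] U_I[OF A0.m_inv_closed[OF a0(1)]] by metis
      fix v assume v: "v \<in> U"
      obtain a1 where a1: "a1 \<in> A0" "v = a1 \<or> v = a1 \<otimes> b" using v unfolding U_def by blast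
      have "u \<otimes> v = a0 \<otimes> a1 \<or> u \<otimes> v = (a0 \<otimes> a1) \<otimes> b"
        using a0(2) a1(2) 1[OF a1(1) a0(1)] 2[OF a0(1) a1(1)] 3[OF a0(1) a1(1)] by auto
      then show "u \<otimes> v \<in> U" using U_I[OF A0.m_closed[OF a0(1) a1(1)]] by metis
    qed
    have bK: "b \<in> K" using BK cb(2) by blast
    have UK: "U \<subseteq> K" using A0K K.m_closed[OF _ bK] unfolding U_def by blast
    have XK: "X \<subseteq> K" using BK by blast
    interpret GK: group "G\<lparr>carrier := K\<rparr>" by (rule subgroup_imp_group[OF K.subgroup_axioms])
    have "solvable (G\<lparr>carrier := K\<rparr>)"
    proof (rule GK.ito)
      show "subgroup U (G\<lparr>carrier := K\<rparr>)" "subgroup X (G\<lparr>carrier := K\<rparr>)"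
        using subgroup_incl[OF U_sub K.subgroup_axioms UK] subgroup_incl[OF X_subgroup K.subgroup_axioms XK] .
      fix g assume "g \<in> carrier (G\<lparr>carrier := K\<rparr>)"
      then have gK: "g \<in> K" by simp
      obtain a' b' where ab': "a' \<in> A \<inter> K" "b' \<in> B" "g = a' \<otimes> b'" using K_factor[OF gK] by blast
      have a'0: "a' \<in> A0" using ab'(1) K_cent_z unfolding A0_def by blast
      have "\<exists>u\<in>U. \<exists>v\<in>X. g = u \<otimes> v"
      proof (cases "b' \<in> X")
        case True
        then show ?thesis using ab'(3) U_I(1)[OF a'0] by blast
      next
        case False
        then have b'Y: "b' \<in> Y" using ab' by blast
        have "b \<otimes> b' \<in> X" using b'Y bY by simp
        moreover have "a' \<otimes> b \<in> U" using U_I(2)[OF a'0] .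
        moreover have "g = (a' \<otimes> b) \<otimes> (b \<otimes> b')"
        proof -
          have "(a' \<otimes> b) \<otimes> (b \<otimes> b') = a' \<otimes> ((b \<otimes> b) \<otimes> b')" using a'0 bc b'Y by (simp add: m_assoc)
          then show ?thesis using bb ab'(3) b'Y by simp
        qed
        ultimately show ?thesis by blast
      qed
      then show "\<exists>u\<in>U. \<exists>v\<in>X. g = u \<otimes>\<^bsub>G\<lparr>carrier := K\<rparr>\<^esub> v" by simp
    next
      show "u \<otimes>\<^bsub>G\<lparr>carrier := K\<rparr>\<^esub> u' = u' \<otimes>\<^bsub>G\<lparr>carrier := K\<rparr>\<^esub> u" if "u \<in> U" "u' \<in> U" for u u'
        using U_comm[OF that] by simp
      show "x \<otimes>\<^bsub>G\<lparr>carrier := K\<rparr>\<^esub> x' = x' \<otimes>\<^bsub>G\<lparr>carrier := K\<rparr>\<^esub> x" if "x \<in> X" "x' \<in> X" for x x'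
        using X_comm[OF that] by simp
    qed
    then show ?thesis using solvable_extension[OF K_normal _ K_Mod_solvable[OF XK]] by simp
  qed
qed

text \<open>If \<open>z \<notin> K\<close>, then \<open>K \<inter> B\<close> is trivial, so that \<open>K\<close> is a normal subgroup inside \<open>A\<close>, hence
trivial; and \<open>K\<close> contains every element of \<open>A\<close> commuting with \<open>z\<close>.\<close>

lemma trivial_centralizer:
  assumes "z \<notin> K" "a \<in> A" "a \<in> cent z"
  shows "a = \<one>"
proof -
  have "K \<subseteq> A"
  proof
    fix g assume "g \<in> K"
    then obtain a b where ab: "a \<in> A" "b \<in> B" "b \<in> K" "g = a \<otimes> b" using K_factor by blast
    have "b \<notin> Y" using normal_contains_B[OF K_normal ab(3)] assms(1) z_X by blast
    then have bX: "b \<in> X" using ab by blast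
    have "b = \<one>"
    proof (rule ccontr)
      assume "b \<noteq> \<one>"
      then obtain n where "z = b [^] (n::nat)" using z_power[OF bX] by blast
      then show False using assms(1) subgroup_pow_closed[OF K.subgroup_axioms ab(3)] by simp
    qed
    then show "g \<in> A" using ab by simp
  qed
  then have "K = {\<one>}" using normal_in_A[OF K_normal] by blast
  then show ?thesis using A_K assms by blast
qed

end

section \<open>Exact factorisations\<close>

text \<open>Now \<open>B\<close> is the centraliser of \<open>z\<close>, the intersection of \<open>A\<close> and \<open>B\<close> is trivial, and
\<open>B\<close> acts regularly on the cosets of \<open>A\<close>.\<close>

locale nondegenerate_product = irreducible_product +
  assumes z_notin_K: "z \<notin> K"
begin

lemma cent_z_A: "a \<in> A \<Longrightarrow> a \<in> cent z \<Longrightarrow> a = \<one>"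
  using trivial_centralizer[OF z_notin_K] .

lemma cent_z_B: "g \<in> cent z \<Longrightarrow> g \<in> B"
proof -
  assume g: "g \<in> cent z"
  obtain a b where ab: "a \<in> A" "b \<in> B" "g = a \<otimes> b" using factor_AB[OF cent_carrier[OF g]] by blast
  have "a \<in> cent z"
    using cent_cancel_right[OF z_carrier subsetD[OF B_cent_z ab(2)] A.mem_carrier[OF ab(1)]] g ab(3) by simp
  then have "g = b" using cent_z_A[OF ab(1)] ab(3) B_carrier[OF ab(2)] by simp
  then show ?thesis using ab(2) by simp
qed

lemma A_B_disjoint: "g \<in> A \<Longrightarrow> g \<in> B \<Longrightarrow> g = \<one>"
  using cent_z_A subsetD[OF B_cent_z] by blast

lemma factor_unique:
  assumes "b \<in> B" "b' \<in> B" "a \<in> A" "a' \<in> A" "b \<otimes> a = b' \<otimes> a'"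
  shows "b = b'" "a = a'"
proof -
  have c: "b \<in> carrier G" "b' \<in> carrier G" using B_carrier assms(1,2) by auto
  have "inv b' \<otimes> b = inv b' \<otimes> (b \<otimes> a) \<otimes> inv a" using c assms(3) by (simp add: m_assoc)
  also have "\<dots> = a' \<otimes> inv a" unfolding assms(5) using c assms(3,4) by (simp add: word_simps)
  finally have e: "inv b' \<otimes> b = a' \<otimes> inv a" .
  have "inv b' \<otimes> b \<in> B"
    using subgroup.m_closed[OF B_subgroup subgroup.m_inv_closed[OF B_subgroup assms(2)] assms(1)] .
  moreover have "a' \<otimes> inv a \<in> A" using assms(3,4) by simp
  ultimately have 1: "a' \<otimes> inv a = \<one>" using A_B_disjoint e by metis
  have "b = b' \<otimes> (inv b' \<otimes> b)" using c by (simp add: word_simps)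
  then show bb: "b = b'" unfolding e 1 using c by simp
  then show "a = a'" using assms(3-5) c by simp
qed

text \<open>If \<open>A\<close> were finite, the class of \<open>z\<close> would be finite, so two elements of the infinite group \<open>X\<close>
would act on it in the same way.  Their quotient \<open>w\<close>, and with it \<open>z\<close>, would centralise the class.\<close>

lemma infinite_A: "infinite A"
proof
  assume fin: "finite A"
  define f where "f x = restrict (\<lambda>a. zc (a \<otimes> x)) A" for x
  have "f ` X \<subseteq> A \<rightarrow>\<^sub>E zc ` A"
  proof
    fix h assume "h \<in> f ` X"
    then obtain x where x: "x \<in> X" "h = f x" by blast
    have "zc (a \<otimes> x) \<in> zc ` A" if "a \<in> A" for a
      using zc_A[of "a \<otimes> x"] that x(1) by auto
    then show "h \<in> A \<rightarrow>\<^sub>E zc ` A" unfolding x(2) f_def by auto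
  qed
  then have "finite (f ` X)" using fin finite_PiE[of A "\<lambda>_. zc ` A"] finite_subset by blast
  then have "\<not> inj_on f X" using infinite_X finite_imageD by blast
  then obtain x x' where x: "x \<in> X" "x' \<in> X" "f x = f x'" "x \<noteq> x'" by (auto simp: inj_on_def)
  define w where "w = x \<otimes> inv x'"
  have "x = w \<otimes> x'" using x(1,2) unfolding w_def by (simp add: m_assoc)
  then have w: "w \<in> X" "w \<noteq> \<one>" using x unfolding w_def by auto
  have "z \<in> cent (zc a)" if a: "a \<in> A" for a
  proof -
    have "zc (a \<otimes> x) = zc (a \<otimes> x')" using x(3) a unfolding f_def by (metis restrict_apply')
    then have e: "inv x \<otimes> zc a \<otimes> x = inv x' \<otimes> zc a \<otimes> x'" using zc_mult a x by simp
    have "w \<otimes> (zc a) = x \<otimes> (inv x' \<otimes> zc a \<otimes> x') \<otimes> inv x'" unfolding w_def using x(1,2) a by (simp add: word_simps)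
    also have "\<dots> = zc a \<otimes> w" unfolding e[symmetric] w_def using x(1,2) a by (simp add: word_simps)
    finally have "w \<in> cent (zc a)" using w(1) by (simp add: cent_def)
    then show ?thesis using commute_z_cent[OF w] a by simp
  qed
  then have "z \<in> K" using K_I[OF z_carrier] by blast
  then show False using z_notin_K by blast
qed

text \<open>If \<open>z\<close> normalised \<open>A\<close>, it would invert \<open>A\<close>; the squares \<open>a\<^sup>2 = a z a\<^sup>-\<^sup>1 z\<close> would
  then be the products \<open>z\<^sup>g z\<close> and form a normal subgroup inside \<open>A\<close>.\<close>

lemma z_not_normalizes: "\<not> (\<forall>a\<in>A. z \<otimes> a \<otimes> z \<in> A)"
proof
  assume n: "\<forall>a\<in>A. z \<otimes> a \<otimes> z \<in> A"
  have inverts: "z \<otimes> a \<otimes> z = inv a" if a: "a \<in> A" for a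
  proof -
    let ?p = "a \<otimes> (z \<otimes> a \<otimes> z)"
    have "?p \<otimes> z = a \<otimes> (z \<otimes> a)" using a by (simp add: m_assoc z_sq)
    also have "\<dots> = z \<otimes> ((z \<otimes> a \<otimes> z) \<otimes> a)" using a by (simp add: m_assoc)
    also have "(z \<otimes> a \<otimes> z) \<otimes> a = ?p" using A_comm n a by blast
    finally have "?p \<in> cent z" using a by (simp add: cent_def)
    then have "?p = \<one>" using cent_z_A n a by blast
    then show ?thesis using a by (metis A.mem_carrier inv_equality inv_inv m_closed z_carrier)
  qed
  define M where "M = (\<lambda>a. a \<otimes> a) ` A"
  have sq: "a \<otimes> a = a \<otimes> z \<otimes> inv a \<otimes> z" if a: "a \<in> A" for a
    using inverts[of "inv a"] a by (simp add: m_assoc)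
  have "M \<lhd> G" unfolding normal_inv_iff
  proof (intro conjI ballI)
    show "subgroup M G"
    proof (rule subgroupI)
      show "M \<subseteq> carrier G" by (auto simp: M_def)
      show "M \<noteq> {}" using A.one_closed unfolding M_def by blast
      fix m assume "m \<in> M"
      then obtain a where a: "a \<in> A" "m = a \<otimes> a" unfolding M_def by blast
      have "inv m = inv a \<otimes> inv a" using a by (simp add: inv_mult_group)
      then show "inv m \<in> M" using a unfolding M_def by blast
      fix m' assume "m' \<in> M"
      then obtain a' where a': "a' \<in> A" "m' = a' \<otimes> a'" unfolding M_def by blast
      have "m \<otimes> m' = a \<otimes> (a \<otimes> a') \<otimes> a'" using a a' by (simp add: m_assoc)
      also have "a \<otimes> a' = a' \<otimes> a" using A_comm a(1) a'(1) by blast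
      also have "a \<otimes> (a' \<otimes> a) \<otimes> a' = (a \<otimes> a') \<otimes> (a \<otimes> a')" using a(1) a'(1) by (simp add: m_assoc)
      finally have "m \<otimes> m' = (a \<otimes> a') \<otimes> (a \<otimes> a')" .
      then show "m \<otimes> m' \<in> M" using A.m_closed[OF a(1) a'(1)] unfolding M_def by blast
    qed
    fix g m assume g: "g \<in> carrier G" and "m \<in> M"
    then obtain a where a: "a \<in> A" "m = a \<otimes> a" unfolding M_def by blast
    obtain c b where cb: "c \<in> A" "b \<in> B" "g = c \<otimes> b" using factor_AB[OF g] by blast
    have bc: "b \<in> carrier G" using B_carrier cb by blast
    obtain e f where ef: "e \<in> A" "f \<in> B" "b \<otimes> a = e \<otimes> f"
      using factor_AB[of "b \<otimes> a"] a(1) bc by auto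
    have fc: "f \<in> carrier G" using B_carrier ef by blast
    have "b \<otimes> m \<otimes> inv b = (b \<otimes> a) \<otimes> z \<otimes> inv a \<otimes> (z \<otimes> inv b)" unfolding a(2) sq[OF a(1)] using a(1) bc by (simp add: m_assoc)
    also have "z \<otimes> inv b = inv b \<otimes> z"
      using z_central_B[OF subgroup.m_inv_closed[OF B_subgroup cb(2)]] by simp
    also have "(b \<otimes> a) \<otimes> z \<otimes> inv a \<otimes> (inv b \<otimes> z) = (b \<otimes> a) \<otimes> z \<otimes> inv (b \<otimes> a) \<otimes> z"
      using a(1) bc by (simp add: word_simps)
    also have "\<dots> = e \<otimes> (f \<otimes> z) \<otimes> inv f \<otimes> inv e \<otimes> z" unfolding ef(3) using ef(1) fc by (simp add: word_simps)
    also have "\<dots> = e \<otimes> z \<otimes> inv e \<otimes> z" unfolding z_central_B[OF ef(2)] using ef(1) fc by (simp add: word_simps)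
    also have "\<dots> = e \<otimes> e" using sq[OF ef(1)] by simp
    finally have 1: "b \<otimes> m \<otimes> inv b = e \<otimes> e" .
    have "g \<otimes> m \<otimes> inv g = c \<otimes> (b \<otimes> m \<otimes> inv b) \<otimes> inv c" unfolding cb(3) using cb(1) bc a by (simp add: word_simps)
    also have "\<dots> = e \<otimes> e" unfolding 1 A_comm[OF cb(1) A.m_closed[OF ef(1) ef(1)]] using cb(1) ef(1) by (simp add: m_assoc)
    finally show "g \<otimes> m \<otimes> inv g \<in> M" using ef(1) unfolding M_def by blast
  qed
  moreover have "M \<subseteq> A" unfolding M_def by auto
  ultimately have M1: "M = {\<one>}" by (rule normal_in_A)
  have "a = \<one>" if a: "a \<in> A" for a
  proof -
    have aa: "a \<otimes> a = \<one>" using M1 a unfolding M_def by blast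
    then have "inv a = a" using a by (simp add: inv_equality)
    then have "z \<otimes> (z \<otimes> a \<otimes> z) = z \<otimes> a" using inverts[OF a] by simp
    then have "a \<otimes> z = z \<otimes> a" using a by (simp add: m_assoc)
    then show ?thesis using cent_z_A[OF a] a by (simp add: cent_def)
  qed
  then have "A \<subseteq> {\<one>}" by blast
  then show False using infinite_A finite_subset by blast
qed

lemma X_normalizer:
  assumes x: "x \<in> X" and n: "\<And>a. a \<in> A \<Longrightarrow> inv x \<otimes> a \<otimes> x \<in> A"
  shows "x = \<one>"
proof (rule ccontr)
  assume "x \<noteq> \<one>"
  then obtain n where n': "z = x [^] (n::nat)" using z_power[OF x] by blast
  have "inv (x [^] m) \<otimes> a \<otimes> x [^] m \<in> A" if "a \<in> A" for a and m :: nat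
    using that
  proof (induction m arbitrary: a)
    case (Suc m)
    have "inv (x [^] Suc m) \<otimes> a \<otimes> x [^] Suc m = inv x \<otimes> (inv (x [^] m) \<otimes> a \<otimes> x [^] m) \<otimes> x"
      using Suc.prems x by (simp add: word_simps)
    then show ?case using n Suc by simp
  qed simp
  from this[of _ n] have "z \<otimes> a \<otimes> z \<in> A" if "a \<in> A" for a
    using that unfolding n'[symmetric] by simp
  then show False using z_not_normalizes by blast
qed

text \<open>Conjugation maps \<open>z\<close>, as a power of \<open>x\<close>, to an involution of \<open>X\<close>, that is, to \<open>z\<close> itself.\<close>

lemma A_conj_X:
  assumes "x \<in> X" "x \<noteq> \<one>" "a \<in> A" "a \<otimes> x \<otimes> inv a \<in> X"
  shows "a = \<one>"
proof -
  obtain n where n: "z = x [^] (n::nat)" using z_power assms by blast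
  have "a \<otimes> z \<otimes> inv a = (a \<otimes> x \<otimes> inv a) [^] n"
    using conj_pow[of "inv a" x n] assms(1,3) n by simp
  then have X: "a \<otimes> z \<otimes> inv a \<in> X" using subgroup_pow_closed[OF X_subgroup assms(4)] by simp
  have sq: "(a \<otimes> z \<otimes> inv a) \<otimes> (a \<otimes> z \<otimes> inv a) = \<one>" using assms(3) by (simp add: word_simps)
  have ne: "a \<otimes> z \<otimes> inv a \<noteq> \<one>"
  proof
    assume e: "a \<otimes> z \<otimes> inv a = \<one>"
    have "z = inv a \<otimes> (a \<otimes> z \<otimes> inv a) \<otimes> a" using assms(3) by (simp add: word_simps)
    then show False unfolding e using assms(3) z_ne by simp
  qed
  have e: "a \<otimes> z \<otimes> inv a = z" using X_involution[OF X sq ne] .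
  have "a \<otimes> z = (a \<otimes> z \<otimes> inv a) \<otimes> a" using assms(3) by (simp add: word_simps)
  then have "a \<otimes> z = z \<otimes> a" unfolding e .
  then show ?thesis using cent_z_A[OF assms(3)] assms(3) by (simp add: cent_def)
qed

text \<open>The two orbits of \<open>X\<close> on the cosets of \<open>A\<close>, as subsets of the group.\<close>

definition XA where "XA = {x \<otimes> a | x a. x \<in> X \<and> a \<in> A}"
definition YA where "YA = {k \<otimes> a | k a. k \<in> Y \<and> a \<in> A}"

lemma XA_or_YA: "g \<in> carrier G \<Longrightarrow> g \<in> XA \<or> g \<in> YA"
  using factor_BA[of g] unfolding XA_def YA_def by blast

lemma XA_YA_disjoint: "g \<in> XA \<Longrightarrow> g \<notin> YA"
proof
  assume "g \<in> XA" "g \<in> YA"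
  then obtain x a k a' where *: "x \<in> X" "a \<in> A" "k \<in> Y" "a' \<in> A" "x \<otimes> a = k \<otimes> a'"
    unfolding XA_def YA_def by blast
  then have "x = k" using factor_unique(1)[of x k a a'] by blast
  then show False using * XY_disjoint by blast
qed

end

section \<open>The dihedral case\<close>

text \<open>Here every \<open>k \<in> Y\<close> is an involution.  It is exceptional if some \<open>t \<noteq> 1\<close> in \<open>A\<close>
stays in \<open>A\<close> under conjugation by \<open>k\<close>, equivalently if \<open>t\<close> fixes the coset \<open>k A\<close>.\<close>

locale dihedral_product = nondegenerate_product +
  assumes y_involution: "y \<otimes> y = \<one>"
begin

lemma Y_sq [simp]: "k \<in> Y \<Longrightarrow> k \<otimes> k = \<one>"
  using Y_square y_involution by simp

lemma Y_inverse [simp]: "k \<in> Y \<Longrightarrow> inv k = k"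
  by (rule inv_equality) auto

lemma Y_cancel [simp]: "k \<in> Y \<Longrightarrow> g \<in> carrier G \<Longrightarrow> k \<otimes> (k \<otimes> g) = g"
  by (simp add: m_assoc[symmetric])

lemma X_cent_A: "t \<in> A \<Longrightarrow> t \<noteq> \<one> \<Longrightarrow> x \<in> X \<Longrightarrow> x \<in> cent t \<Longrightarrow> x = \<one>"
proof (rule ccontr)
  assume t: "t \<in> A" "t \<noteq> \<one>" and x: "x \<in> X" "x \<in> cent t" "x \<noteq> \<one>"
  have "z \<in> cent t" using commute_z_cent[OF x(1,3) A.mem_carrier[OF t(1)] x(2)] .
  then have "t \<in> cent z" by (rule cent_sym[OF A.mem_carrier[OF t(1)]])
  then show False using cent_z_A[OF t(1)] t(2) by simp
qed

text \<open>By \<open>X_cent_A\<close> the centraliser of \<open>t\<close> in \<open>B\<close> meets \<open>X\<close> trivially, so it has order at most 2, and the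
centraliser of \<open>t\<close> in \<open>G\<close> is \<open>A\<close> or of the form \<open>A \<union> A \<kappa>\<close>.\<close>

lemma Y_cent_A:
  assumes t: "t \<in> A" "t \<noteq> \<one>" and k: "k \<in> Y" "k \<in> cent t" and k': "k' \<in> Y" "k' \<in> cent t"
  shows "k = k'"
proof -
  have "k \<otimes> k' = \<one>"
    using X_cent_A[OF t, of "k \<otimes> k'"] k k' cent_mult[OF A.mem_carrier[OF t(1)]] by simp
  then show ?thesis using k(1) k'(1) by (metis Y_carrier Y_inverse inv_equality)
qed

definition stab where "stab k = {a \<in> A. k \<otimes> a \<otimes> k \<in> A}"

definition exceptional where "exceptional = {k \<in> Y. \<exists>t\<in>stab k. t \<noteq> \<one>}"

lemma stab_A: "a \<in> stab k \<Longrightarrow> a \<in> A"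
  by (simp add: stab_def)

lemma conj_cent_stab:
  assumes k: "k \<in> Y" and t: "t \<in> stab k" and a: "a \<in> A"
  shows "k \<otimes> a \<otimes> k \<in> cent t"
proof -
  have s: "k \<otimes> t \<otimes> k \<in> A" "t \<in> A" using t by (auto simp: stab_def)
  have "inv k \<otimes> a \<otimes> k \<in> cent (inv k \<otimes> (k \<otimes> t \<otimes> k) \<otimes> k)"
    using cent_conj[OF A.mem_carrier[OF s(1)] Y_carrier[OF k] A_cent_A[OF a s(1)]] .
  moreover have "inv k \<otimes> (k \<otimes> t \<otimes> k) \<otimes> k = t" using k s by (simp add: m_assoc)
  ultimately show ?thesis using k by simp
qed

lemma outside_stab:
  assumes k: "k \<in> Y" and t: "t \<in> stab k" "t \<noteq> \<one>" and a: "a \<in> A" "a \<notin> stab k"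
  shows "\<exists>c\<in>A. \<exists>\<kappa>\<in>Y. \<kappa> \<in> cent t \<and> k \<otimes> a \<otimes> k = c \<otimes> \<kappa>"
proof -
  have gc: "k \<otimes> a \<otimes> k \<in> carrier G" using k a by simp
  obtain c b where cb: "c \<in> A" "b \<in> B" "k \<otimes> a \<otimes> k = c \<otimes> b" using factor_AB[OF gc] by blast
  have tA: "t \<in> A" using stab_A[OF t(1)] .
  have b: "b \<in> cent t"
    using cent_cancel_left[OF A.mem_carrier[OF tA] A_cent_A[OF cb(1) tA] B_carrier[OF cb(2)]]
      conj_cent_stab[OF k t(1) a(1)] cb(3) by simp
  have "b \<notin> X"
  proof
    assume "b \<in> X"
    then have "b = \<one>" using X_cent_A[OF tA t(2)] b by blast
    then have "k \<otimes> a \<otimes> k \<in> A" using cb by simp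
    then show False using a by (simp add: stab_def)
  qed
  then show ?thesis using cb b by blast
qed

text \<open>The conjugate of \<open>A\<close> under \<open>k\<close> lies in the centraliser \<open>A \<union> A \<kappa>\<close> of \<open>t\<close>, so the elements
that stay in \<open>A\<close> form a subgroup of index at most 2.\<close>

lemma stab_index:
  assumes k: "k \<in> Y" and t: "t \<in> stab k" "t \<noteq> \<one>" and a: "a \<in> A" "a' \<in> A"
    and same: "a \<in> stab k \<longleftrightarrow> a' \<in> stab k"
  shows "a \<otimes> inv a' \<in> stab k"
proof -
  have e: "k \<otimes> (a \<otimes> inv a') \<otimes> k = (k \<otimes> a \<otimes> k) \<otimes> inv (k \<otimes> a' \<otimes> k)"
    using k a by (simp add: word_simps)
  have "(k \<otimes> a \<otimes> k) \<otimes> inv (k \<otimes> a' \<otimes> k) \<in> A"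
  proof (cases "a \<in> stab k")
    case True
    then show ?thesis using same by (simp add: stab_def)
  next
    case False
    then have False': "a' \<notin> stab k" using same by blast
    have tA: "t \<in> A" using stab_A[OF t(1)] .
    obtain c \<kappa> where c: "c \<in> A" "\<kappa> \<in> Y" "\<kappa> \<in> cent t" "k \<otimes> a \<otimes> k = c \<otimes> \<kappa>"
      using outside_stab[OF k t a(1) False] by blast
    obtain c' \<kappa>' where c': "c' \<in> A" "\<kappa>' \<in> Y" "\<kappa>' \<in> cent t" "k \<otimes> a' \<otimes> k = c' \<otimes> \<kappa>'"
      using outside_stab[OF k t a(2) False'] by blast
    have "\<kappa>' = \<kappa>" using Y_cent_A[OF tA t(2)] c c' by blast
    then have "(k \<otimes> a \<otimes> k) \<otimes> inv (k \<otimes> a' \<otimes> k) = c \<otimes> inv c'"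
      unfolding c(4) c'(4) using c c' by (simp add: inv_mult_group m_assoc)
    then show ?thesis using c c' by simp
  qed
  then show ?thesis using e a by (simp add: stab_def)
qed

text \<open>Two subgroups of index at most 2 in the infinite group \<open>A\<close> have a nontrivial intersection.\<close>

lemma stab_meet:
  assumes "k \<in> exceptional" "k' \<in> exceptional"
  shows "\<exists>t\<in>A. t \<noteq> \<one> \<and> t \<in> stab k \<and> t \<in> stab k'"
proof (rule ccontr)
  assume none: "\<not> ?thesis"
  obtain t where t: "k \<in> Y" "t \<in> stab k" "t \<noteq> \<one>" using assms(1) unfolding exceptional_def by blast
  obtain t' where t': "k' \<in> Y" "t' \<in> stab k'" "t' \<noteq> \<one>" using assms(2) unfolding exceptional_def by blast
  have "inj_on (\<lambda>a. (a \<in> stab k, a \<in> stab k')) A"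
  proof (rule inj_onI)
    fix a a' assume a: "a \<in> A" "a' \<in> A" and "(a \<in> stab k, a \<in> stab k') = (a' \<in> stab k, a' \<in> stab k')"
    then have "a \<otimes> inv a' \<in> stab k" "a \<otimes> inv a' \<in> stab k'"
      using stab_index[OF t a] stab_index[OF t' a] by auto
    then have 1: "a \<otimes> inv a' = \<one>" using none a by (meson A.m_closed A.m_inv_closed)
    have "a = (a \<otimes> inv a') \<otimes> a'" using a by (simp add: m_assoc)
    then show "a = a'" unfolding 1 using a by simp
  qed
  moreover have "finite ((\<lambda>a. (a \<in> stab k, a \<in> stab k')) ` A)"
    by (rule finite_subset[of _ UNIV]) auto
  ultimately show False using infinite_A finite_imageD by blast
qed

text \<open>If \<open>k\<close> does not normalise \<open>A\<close>, then the centraliser of \<open>t\<close> is generated by \<open>A\<close> and its conjugate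
under \<open>k\<close>, and so is normalised by the involution \<open>k\<close>.\<close>

lemma conj_cent:
  assumes k: "k \<in> Y" and t: "t \<in> stab k" "t \<noteq> \<one>" and a: "a \<in> A" "a \<notin> stab k" and g: "g \<in> cent t"
  shows "k \<otimes> g \<otimes> k \<in> cent t"
proof -
  have tA: "t \<in> A" using stab_A[OF t(1)] .
  note tc = A.mem_carrier[OF tA]
  obtain c b where cb: "c \<in> A" "b \<in> B" "g = c \<otimes> b" using factor_AB[OF cent_carrier[OF g]] by blast
  have b: "b \<in> cent t"
    using cent_cancel_left[OF tc A_cent_A[OF cb(1) tA] B_carrier[OF cb(2)]] g cb(3) by simp
  show ?thesis
  proof (cases "b \<in> X")
    case True
    then have "b = \<one>" using X_cent_A[OF tA t(2)] b by blast
    then show ?thesis using conj_cent_stab[OF k t(1) cb(1)] cb by simp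
  next
    case False
    then have bY: "b \<in> Y" using cb(2) by blast
    obtain c' \<kappa> where c': "c' \<in> A" "\<kappa> \<in> Y" "\<kappa> \<in> cent t" "k \<otimes> a \<otimes> k = c' \<otimes> \<kappa>"
      using outside_stab[OF k t a] by blast
    have "\<kappa> = b" using Y_cent_A[OF tA t(2)] c' bY b by blast
    then have "b = inv c' \<otimes> (k \<otimes> a \<otimes> k)" unfolding c'(4) using c'(1) bY by (simp add: word_simps)
    then have "k \<otimes> g \<otimes> k = k \<otimes> (c \<otimes> (inv c' \<otimes> (k \<otimes> a \<otimes> k))) \<otimes> k" using cb(3) by simp
    also have "\<dots> = (k \<otimes> (c \<otimes> inv c') \<otimes> k) \<otimes> a" using cb(1) c'(1) a(1) k by (simp add: m_assoc)
    finally show ?thesis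
      using cent_mult[OF tc conj_cent_stab[OF k t(1), of "c \<otimes> inv c'"] A_cent_A[OF a(1) tA]] cb(1) c'(1) by simp
  qed
qed

text \<open>By \<open>stab_meet\<close> one \<open>t\<close> serves for both \<open>k\<close> and \<open>k'\<close>.  Then \<open>k k' \<in> X\<close> normalises the centraliser
\<open>A \<union> A \<kappa>\<close> of \<open>t\<close>, so it commutes with \<open>\<kappa>\<close>; but \<open>\<kappa>\<close> inverts it.\<close>

lemma exceptional_pair:
  assumes k: "k \<in> exceptional" "a \<in> A" "a \<notin> stab k"
    and k': "k' \<in> exceptional" "a' \<in> A" "a' \<notin> stab k'"
  shows "k \<otimes> k' = \<one> \<or> k \<otimes> k' = z"
proof -
  have Y: "k \<in> Y" "k' \<in> Y" using k k' unfolding exceptional_def by auto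
  obtain t where t: "t \<in> A" "t \<noteq> \<one>" "t \<in> stab k" "t \<in> stab k'" using stab_meet[OF k(1) k'(1)] by blast
  obtain c \<kappa> where c: "c \<in> A" "\<kappa> \<in> Y" "\<kappa> \<in> cent t" "k \<otimes> a \<otimes> k = c \<otimes> \<kappa>"
    using outside_stab[OF Y(1) t(3,2) k(2,3)] by blast
  let ?x = "k \<otimes> k'"
  have x: "?x \<in> X" using Y by simp
  have ix: "inv ?x = k' \<otimes> k" using Y by (simp add: inv_mult_group)
  have "k' \<otimes> (k \<otimes> \<kappa> \<otimes> k) \<otimes> k' \<in> cent t"
    using conj_cent[OF Y(2) t(4,2) k'(2,3) conj_cent[OF Y(1) t(3,2) k(2,3) c(3)]] .
  moreover have "k' \<otimes> (k \<otimes> \<kappa> \<otimes> k) \<otimes> k' = inv ?x \<otimes> \<kappa> \<otimes> ?x" unfolding ix using Y c(2) by (simp add: m_assoc)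
  ultimately have "inv ?x \<otimes> \<kappa> \<otimes> ?x \<in> cent t" by simp
  moreover have "inv ?x \<otimes> \<kappa> \<otimes> ?x \<in> Y" by (rule YX_mult[OF x XY_mult[OF X.m_inv_closed[OF x] c(2)]])
  ultimately have 1: "inv ?x \<otimes> \<kappa> \<otimes> ?x = \<kappa>" using Y_cent_A[OF t(1,2)] c by blast
  have "inv ?x \<otimes> \<kappa> = \<kappa> \<otimes> ?x" using Y_inverts[OF X.m_inv_closed[OF x] c(2)] x by simp
  then have "\<kappa> \<otimes> (?x \<otimes> ?x) = \<kappa>" using 1 x c(2) by (simp add: m_assoc del: YY_mult)
  then have "\<kappa> \<otimes> (\<kappa> \<otimes> (?x \<otimes> ?x)) = \<kappa> \<otimes> \<kappa>" by simp
  then have "?x \<otimes> ?x = \<one>" using x c(2) by (simp del: YY_mult)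
  then show ?thesis using X_involution[OF x] by metis
qed

text \<open>At most two exceptional elements do not normalise \<open>A\<close>, by \<open>exceptional_pair\<close>, and at most one
does, by \<open>X_normalizer\<close>.\<close>

lemma finite_exceptional: "finite exceptional"
proof -
  define E1 where "E1 = {k \<in> exceptional. \<exists>a\<in>A. a \<notin> stab k}"
  define E2 where "E2 = {k \<in> exceptional. \<forall>a\<in>A. a \<in> stab k}"
  have solve: "k' = k \<otimes> (k \<otimes> k')" if "k \<in> Y" "k' \<in> Y" for k k' using that by simp
  have "finite E1"
  proof (cases "E1 = {}")
    case False
    then obtain k where k: "k \<in> E1" by blast
    have "E1 \<subseteq> {k \<otimes> \<one>, k \<otimes> z}"
    proof
      fix k' assume k': "k' \<in> E1"
      have "k \<otimes> k' = \<one> \<or> k \<otimes> k' = z" 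
      proof -
        from k k' obtain a a' where "k \<in> exceptional" "a \<in> A" "a \<notin> stab k" "k' \<in> exceptional" "a' \<in> A" "a' \<notin> stab k'"
          unfolding E1_def by blast
        then show ?thesis by (rule exceptional_pair)
      qed
      then show "k' \<in> {k \<otimes> \<one>, k \<otimes> z}"
      proof -
        have "k \<in> Y" "k' \<in> Y" using k k' unfolding E1_def exceptional_def by blast+
        from solve[OF this] show ?thesis using \<open>k \<otimes> k' = \<one> \<or> k \<otimes> k' = z\<close> by (metis insertCI)
      qed
    qed
    then show ?thesis using finite_subset by blast
  qed simp
  moreover have "finite E2"
  proof (cases "E2 = {}")
    case False
    then obtain k where k: "k \<in> E2" by blast
    have "E2 \<subseteq> {k}"
    proof
      fix k' assume k': "k' \<in> E2"
      have Y: "k \<in> Y" "k' \<in> Y" using k k' unfolding E2_def exceptional_def by auto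
      have x: "k \<otimes> k' \<in> X" using Y by simp
      have "inv (k \<otimes> k') \<otimes> a \<otimes> (k \<otimes> k') \<in> A" if a: "a \<in> A" for a
      proof -
        have "k \<otimes> a \<otimes> k \<in> A" using k a unfolding E2_def stab_def by blast
        then have "k' \<otimes> (k \<otimes> a \<otimes> k) \<otimes> k' \<in> A" using k' unfolding E2_def stab_def by blast
        moreover have "inv (k \<otimes> k') \<otimes> a \<otimes> (k \<otimes> k') = k' \<otimes> (k \<otimes> a \<otimes> k) \<otimes> k'"
          using Y a by (simp add: word_simps)
        ultimately show ?thesis by simp
      qed
      then have "k \<otimes> k' = \<one>" using X_normalizer[OF x] by blast
      then show "k' \<in> {k}" using solve[OF Y] Y by simp
    qed
    then show ?thesis using finite_subset by blast
  qed simp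
  moreover have "exceptional \<subseteq> E1 \<union> E2" unfolding E1_def E2_def by blast
  ultimately show ?thesis using finite_subset by blast
qed

text \<open>Inverting \<open>a k = k' e\<close> gives \<open>e k = k' a\<close>, as \<open>k\<close> and \<open>k'\<close> are involutions.  Hence
\<open>inv e a\<close> stays in \<open>A\<close> under conjugation by \<open>k\<close>, so \<open>e = a\<close> and \<open>a k a\<^sup>-\<^sup>1 = k'\<close>.\<close>

lemma A_conj_Y:
  assumes a: "a \<in> A" and k: "k \<in> Y" "k \<notin> exceptional" and YA: "a \<otimes> k \<in> YA"
  shows "a \<otimes> k \<otimes> inv a \<in> Y"
proof -
  obtain k' e where e: "k' \<in> Y" "e \<in> A" "a \<otimes> k = k' \<otimes> e" using YA unfolding YA_def by blast
  have "inv (a \<otimes> k) = inv (k' \<otimes> e)" unfolding e(3) ..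
  then have i: "k \<otimes> inv a = inv e \<otimes> k'" using a k(1) e(1,2) by (simp add: inv_mult_group)
  have "k \<otimes> (inv e \<otimes> a) \<otimes> k = k \<otimes> inv e \<otimes> (a \<otimes> k)" using a k(1) e(1,2) by (simp add: m_assoc)
  also have "\<dots> = k \<otimes> (inv e \<otimes> k') \<otimes> e" unfolding e(3) using a k(1) e(1,2) by (simp add: m_assoc)
  also have "\<dots> = inv a \<otimes> e" unfolding i[symmetric] using a k(1) e(1,2) by (simp add: m_assoc)
  finally have "k \<otimes> (inv e \<otimes> a) \<otimes> k \<in> A" using a e(2) by simp
  then have "inv e \<otimes> a \<in> stab k" using a e(2) by (simp add: stab_def)
  then have 1: "inv e \<otimes> a = \<one>" using k unfolding exceptional_def by blast
  have "a = e \<otimes> (inv e \<otimes> a)" using a e(2) by (simp add: word_simps)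
  then have "a = e" unfolding 1 using e(2) by simp
  then have "a \<otimes> k \<otimes> inv a = k'" using e a by (simp add: m_assoc)
  then show ?thesis using e(1) by simp
qed

text \<open>If \<open>A_conj_Y\<close> applied to two elements \<open>k\<close>, \<open>k'\<close>, then \<open>a\<close> would conjugate \<open>k k'\<close> into \<open>X\<close>, against
\<open>A_conj_X\<close>.\<close>

lemma finite_YY:
  assumes a: "a \<in> A" "a \<noteq> \<one>"
  shows "finite {k \<in> Y. a \<otimes> k \<in> YA}"
proof -
  let ?F = "{k \<in> Y. a \<otimes> k \<in> YA} - exceptional"
  have "k' = k" if "k \<in> ?F" "k' \<in> ?F" for k k'
  proof (rule ccontr)
    assume ne: "k' \<noteq> k"
    have Y: "k \<in> Y" "k' \<in> Y" using that by auto
    have "(a \<otimes> k \<otimes> inv a) \<otimes> (a \<otimes> k' \<otimes> inv a) \<in> X"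
      using A_conj_Y[OF a(1)] that by simp
    moreover have "(a \<otimes> k \<otimes> inv a) \<otimes> (a \<otimes> k' \<otimes> inv a) = a \<otimes> (k \<otimes> k') \<otimes> inv a"
      using Y a by (simp add: word_simps)
    moreover have "k \<otimes> k' \<noteq> \<one>"
    proof
      assume "k \<otimes> k' = \<one>"
      then have "k \<otimes> (k \<otimes> k') = k \<otimes> \<one>" by simp
      then show False using ne Y by simp
    qed
    ultimately show False using A_conj_X[of "k \<otimes> k'" a] Y a by simp
  qed
  then have one: "\<exists>k. ?F \<subseteq> {k}" by (cases "?F = {}") blast+
  then have "finite ?F" using finite_subset[of ?F] by blast
  then show ?thesis using finite_Diff2[OF finite_exceptional] by blast
qed

text \<open>Left multiplication by \<open>y\<close> exchanges \<open>XA\<close> and \<open>YA\<close>.  Write \<open>a = y c b\<close> with \<open>c \<in> A\<close> and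
\<open>b \<in> B\<close>.  If \<open>b\<close> were in \<open>X\<close>, then \<open>finite_YY\<close> for \<open>c\<close> and for \<open>a\<close> would contradict each other; so
\<open>b \<in> Y\<close>, and \<open>finite_YY\<close> for \<open>c\<close> becomes the claim for \<open>a\<close>.\<close>

lemma finite_XX:
  assumes a: "a \<in> A" "a \<noteq> \<one>"
  shows "finite {x \<in> X. a \<otimes> x \<in> XA}"
proof -
  have yY: "y \<in> Y" by (rule y_in_Y)
  note yc = y_carrier
  obtain c b where cb: "c \<in> A" "b \<in> B" "y \<otimes> a = c \<otimes> b" using factor_AB[of "y \<otimes> a"] a yc by auto
  have bc: "b \<in> carrier G" using B_carrier[OF cb(2)] .
  have "y \<otimes> (y \<otimes> a) = y \<otimes> (c \<otimes> b)" unfolding cb(3) ..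
  then have ae: "a = y \<otimes> c \<otimes> b" using yY a cb(1) bc by (simp add: m_assoc)
  have c1: "c \<noteq> \<one>"
  proof
    assume "c = \<one>"
    then have "a = y \<otimes> b" using ae yc by simp
    then have "a \<in> B" using subgroup.m_closed[OF B_subgroup _ cb(2)] yY by blast
    then show False using A_B_disjoint a by blast
  qed
  have yXA: "y \<otimes> g \<in> YA" if "g \<in> XA" for g
  proof -
    obtain x e where "x \<in> X" "e \<in> A" "g = x \<otimes> e" using \<open>g \<in> XA\<close> unfolding XA_def by blast
    then have "y \<otimes> g = (y \<otimes> x) \<otimes> e" "y \<otimes> x \<in> Y" using yY yc by (auto simp: m_assoc)
    then show ?thesis unfolding YA_def using \<open>e \<in> A\<close> by blast
  qed
  have bY: "b \<in> Y"
  proof (rule ccontr)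
    assume "b \<notin> Y"
    then have bX: "b \<in> X" using cb(2) by blast
    have inj: "inj_on (\<lambda>k. b \<otimes> k) Y" using bc by (auto simp: inj_on_def)
    have "finite ((\<lambda>k. b \<otimes> k) -` {k \<in> Y. c \<otimes> k \<in> YA} \<inter> Y)"
      by (rule finite_vimage_IntI[OF finite_YY[OF cb(1) c1] inj])
    moreover have "Y \<subseteq> ((\<lambda>k. b \<otimes> k) -` {k \<in> Y. c \<otimes> k \<in> YA} \<inter> Y) \<union> {k \<in> Y. a \<otimes> k \<in> YA}"
    proof
      fix k assume k: "k \<in> Y"
      have bk: "b \<otimes> k \<in> Y" using bX k by simp
      have "c \<otimes> (b \<otimes> k) \<in> XA \<or> c \<otimes> (b \<otimes> k) \<in> YA" using XA_or_YA cb(1) bc k by simp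
      moreover have "a \<otimes> k = y \<otimes> (c \<otimes> (b \<otimes> k))" unfolding ae using cb(1) bc yc k by (simp add: m_assoc)
      ultimately show "k \<in> ((\<lambda>k. b \<otimes> k) -` {k \<in> Y. c \<otimes> k \<in> YA} \<inter> Y) \<union> {k \<in> Y. a \<otimes> k \<in> YA}"
        using yXA bk k by auto
    qed
    ultimately show False using finite_YY[OF a] infinite_Y by (meson finite_UnI finite_subset)
  qed
  have inj: "inj_on (\<lambda>x. b \<otimes> x) X" using bc by (auto simp: inj_on_def)
  have "{x \<in> X. a \<otimes> x \<in> XA} \<subseteq> (\<lambda>x. b \<otimes> x) -` {k \<in> Y. c \<otimes> k \<in> YA} \<inter> X"
  proof
    fix x assume "x \<in> {x \<in> X. a \<otimes> x \<in> XA}"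
    then have x: "x \<in> X" "a \<otimes> x \<in> XA" by auto
    have "y \<otimes> (a \<otimes> x) = c \<otimes> (b \<otimes> x)" unfolding ae using yY cb(1) bc yc x(1) by (simp add: m_assoc)
    then have "c \<otimes> (b \<otimes> x) \<in> YA" using yXA[OF x(2)] by simp
    then show "x \<in> (\<lambda>x. b \<otimes> x) -` {k \<in> Y. c \<otimes> k \<in> YA} \<inter> X" using x(1) bY by simp
  qed
  then show ?thesis using finite_vimage_IntI[OF finite_YY[OF cb(1) c1] inj] finite_subset by blast
qed

text \<open>For nearly all \<open>k \<in> Y\<close> the product \<open>b k\<close> lies in \<open>x A\<close> for some \<open>x \<in> X\<close> and \<open>a b k\<close> lies in \<open>XA\<close>, so
\<open>a x \<in> XA\<close>; different \<open>k\<close> have different \<open>x\<close>, and \<open>finite_XX\<close> allows only finitely many \<open>x\<close>.\<close>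

lemma no_dihedral_product: False
proof -
  obtain a where a: "a \<in> A" "a \<noteq> \<one>" using infinite_A by (metis finite.simps insertCI subsetI finite_subset)
  have "infinite (A - {\<one>, inv a})" using infinite_A by simp
  then obtain b where b: "b \<in> A" "b \<noteq> \<one>" "b \<noteq> inv a" by (metis DiffD1 DiffD2 finite.emptyI insertCI ex_in_conv)
  have ab: "a \<otimes> b \<in> A" "a \<otimes> b \<noteq> \<one>"
  proof -
    show "a \<otimes> b \<in> A" using a b by simp
    have "b = inv a \<otimes> (a \<otimes> b)" using a(1) b(1) by (simp add: word_simps)
    then show "a \<otimes> b \<noteq> \<one>" using b(3) a(1) by auto
  qed
  define Y' where "Y' = Y - {k \<in> Y. b \<otimes> k \<in> YA} - {k \<in> Y. (a \<otimes> b) \<otimes> k \<in> YA}"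
  have inf: "infinite Y'" unfolding Y'_def using infinite_Y finite_YY[OF b(1,2)] finite_YY[OF ab] by simp
  have "\<exists>x\<in>X. \<exists>e\<in>A. b \<otimes> k = x \<otimes> e \<and> a \<otimes> x \<in> XA" if k: "k \<in> Y'" for k
  proof -
    have kY: "k \<in> Y" and n: "b \<otimes> k \<notin> YA" "(a \<otimes> b) \<otimes> k \<notin> YA" using k unfolding Y'_def by auto
    have "b \<otimes> k \<in> XA" using n(1) XA_or_YA kY b(1) by (metis A.mem_carrier Y_carrier m_closed)
    then obtain x e where x: "x \<in> X" "e \<in> A" "b \<otimes> k = x \<otimes> e" unfolding XA_def by blast
    have "(a \<otimes> b) \<otimes> k \<in> XA" using n(2) XA_or_YA kY ab(1) by (metis A.mem_carrier Y_carrier m_closed)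
    then obtain x' e' where x': "x' \<in> X" "e' \<in> A" "(a \<otimes> b) \<otimes> k = x' \<otimes> e'" unfolding XA_def by blast
    have "a \<otimes> x = a \<otimes> (b \<otimes> k) \<otimes> inv e" unfolding x(3) using a x(1,2) by (simp add: m_assoc)
    also have "\<dots> = (a \<otimes> b) \<otimes> k \<otimes> inv e" using a b kY x(2) by (simp add: m_assoc)
    also have "\<dots> = x' \<otimes> (e' \<otimes> inv e)" unfolding x'(3) using x' x(2) by (simp add: m_assoc)
    finally have "a \<otimes> x \<in> XA" using x'(1,2) x(2) unfolding XA_def by blast
    then show ?thesis using x by blast
  qed
  then have "\<forall>k\<in>Y'. \<exists>x. x \<in> X \<and> (\<exists>e\<in>A. b \<otimes> k = x \<otimes> e) \<and> a \<otimes> x \<in> XA" by blast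
  then obtain f where f: "\<And>k. k \<in> Y' \<Longrightarrow> f k \<in> X \<and> (\<exists>e\<in>A. b \<otimes> k = f k \<otimes> e) \<and> a \<otimes> f k \<in> XA" by (metis bchoice)
  have "inj_on f Y'"
  proof (rule inj_onI)
    fix k k' assume k: "k \<in> Y'" "k' \<in> Y'" "f k = f k'"
    have Y: "k \<in> Y" "k' \<in> Y" using k unfolding Y'_def by auto
    obtain e where e: "e \<in> A" "b \<otimes> k = f k \<otimes> e" using f[OF k(1)] by blast
    obtain e' where e': "e' \<in> A" "b \<otimes> k' = f k \<otimes> e'" using f[OF k(2)] k(3) by auto
    have fc: "f k \<in> carrier G" using f[OF k(1)] X.mem_carrier by blast
    have "inv k \<otimes> k' = inv (b \<otimes> k) \<otimes> (b \<otimes> k')" using Y b(1) by (simp add: word_simps)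
    also have "\<dots> = inv e \<otimes> e'" unfolding e(2) e'(2) using e(1) e'(1) fc by (simp add: word_simps)
    finally have "inv k \<otimes> k' = inv e \<otimes> e'" .
    moreover have "inv k \<otimes> k' \<in> B" using Y by simp
    moreover have "inv e \<otimes> e' \<in> A" using e e' by simp
    ultimately have "inv k \<otimes> k' = \<one>" using A_B_disjoint by metis
    then have "k \<otimes> (k \<otimes> k') = k \<otimes> \<one>" using Y by simp
    then show "k = k'" using Y by simp
  qed
  moreover have "f ` Y' \<subseteq> {x \<in> X. a \<otimes> x \<in> XA}" using f by blast
  then have "finite (f ` Y')" using finite_XX[OF a] finite_subset by blast
  ultimately show False using inf finite_imageD by blast
qed

end

section \<open>The quaternion case: commuting products of two involutions\<close>

text \<open>The conjugates of the involution \<open>z\<close> under the powers of \<open>h\<close> behave like the vertices of a square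
rotated by \<open>h\<close>, and \<open>w0\<close>, \<open>w1\<close>, \<open>w2\<close>, \<open>h z h\<^sup>-\<^sup>1 z\<close> like its edges: their product is 1.
If two adjacent edges commute, then so do all, and \<open>z\<close> acts on them as a point reflection.\<close>

lemma (in group) square_rotation:
  assumes c: "z \<in> carrier G" "h \<in> carrier G" and zz: "z \<otimes> z = \<one>" and h4: "h \<otimes> h \<otimes> (h \<otimes> h) = \<one>"
    and w0: "w0 = z \<otimes> inv h \<otimes> z \<otimes> h" and w1: "w1 = inv h \<otimes> w0 \<otimes> h" and w2: "w2 = inv h \<otimes> w1 \<otimes> h"
    and comm: "w0 \<otimes> (h \<otimes> z \<otimes> inv h \<otimes> z) = (h \<otimes> z \<otimes> inv h \<otimes> z) \<otimes> w0"
  shows "z \<otimes> w0 \<otimes> z = inv w0" "z \<otimes> w1 \<otimes> z = inv w1" "z \<otimes> w2 \<otimes> z = inv w2"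
    and "w0 \<otimes> w2 = w2 \<otimes> w0" "inv (h \<otimes> h) \<otimes> w0 \<otimes> (h \<otimes> h) = w2" "inv (h \<otimes> h) \<otimes> w2 \<otimes> (h \<otimes> h) = w0"
proof -
  define w3 where "w3 = h \<otimes> z \<otimes> inv h \<otimes> z"
  have zi [simp]: "inv z = z" using zz c by (simp add: inv_equality)
  have zc [simp]: "z \<otimes> (z \<otimes> g) = g" if "g \<in> carrier G" for g using that c zz by (simp add: m_assoc[symmetric])
  have h3: "h \<otimes> (h \<otimes> (h \<otimes> h)) = \<one>" using h4 c by (simp add: m_assoc)
  have "inv h = inv h \<otimes> (h \<otimes> (h \<otimes> (h \<otimes> h)))" unfolding h3 using c by simp
  then have ih: "inv h = h \<otimes> (h \<otimes> h)" using c by (simp add: word_simps)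
  have w0c: "w0 \<in> carrier G" unfolding w0 using c by simp
  have w1c: "w1 \<in> carrier G" unfolding w1 using c w0c by simp
  have w2c: "w2 \<in> carrier G" unfolding w2 using c w1c by simp
  have w3c: "w3 \<in> carrier G" unfolding w3_def using c by simp
  show e2: "inv (h \<otimes> h) \<otimes> w0 \<otimes> (h \<otimes> h) = w2" unfolding w2 w1 using c w0c by (simp add: word_simps)
  have w3: "inv h \<otimes> w2 \<otimes> h = w3"
  proof -
    have "inv h \<otimes> w2 \<otimes> h = (inv h \<otimes> (inv h \<otimes> inv h)) \<otimes> z \<otimes> inv h \<otimes> z \<otimes> (h \<otimes> (h \<otimes> (h \<otimes> h)))"
      unfolding w2 w1 w0 using c by (simp add: word_simps)
    also have "inv h \<otimes> (inv h \<otimes> inv h) = inv (h \<otimes> (h \<otimes> h))" using c by (simp add: word_simps)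
    also have "\<dots> = h" unfolding ih[symmetric] using c by simp
    finally show ?thesis unfolding h3 w3_def using c by simp
  qed
  have w4: "inv h \<otimes> w3 \<otimes> h = w0" unfolding w3_def w0 using c by (simp add: word_simps)
  have "inv (h \<otimes> h) \<otimes> w2 \<otimes> (h \<otimes> h) = inv h \<otimes> (inv h \<otimes> w2 \<otimes> h) \<otimes> h"
    using c w2c by (simp add: word_simps)
  then show "inv (h \<otimes> h) \<otimes> w2 \<otimes> (h \<otimes> h) = w0" unfolding w3 w4 .
  have c03: "w0 \<in> cent w3" using comm w0c unfolding w3_def cent_def by simp
  have c10: "w1 \<in> cent w0" using cent_conj[OF w3c c(2) c03] unfolding w4 w1 .
  then have c01: "w0 \<in> cent w1" by (rule cent_sym[OF w0c])
  have prod: "w0 \<otimes> w1 \<otimes> w2 \<otimes> w3 = \<one>"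
  proof -
    have "w0 \<otimes> w1 \<otimes> w2 \<otimes> w3 = z \<otimes> inv (h \<otimes> (h \<otimes> (h \<otimes> h))) \<otimes> z \<otimes> (h \<otimes> (h \<otimes> (h \<otimes> h)))"
      unfolding w3[symmetric] w2 w1 w0 using c by (simp add: word_simps)
    then show ?thesis unfolding h3 using c zz by simp
  qed
  define p where "p = inv w1 \<otimes> inv w0"
  have pc: "p \<in> carrier G" unfolding p_def using w0c w1c by simp
  have "w2 = p \<otimes> (w0 \<otimes> w1 \<otimes> w2 \<otimes> w3) \<otimes> inv w3"
    unfolding p_def using w0c w1c w2c w3c by (simp add: word_simps)
  then have w2': "w2 = p \<otimes> inv w3" unfolding prod using pc w3c by simp
  have "w0 \<in> cent w2"
  proof -
    have "p \<otimes> inv w3 \<in> cent w0"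
      unfolding p_def using cent_mult[OF w0c cent_mult[OF w0c cent_inv[OF w0c c10] cent_inv[OF w0c cent_self[OF w0c]]]
        cent_inv[OF w0c cent_sym[OF w3c c03]]] .
    then have "w2 \<in> cent w0" using w2' by simp
    then show ?thesis by (rule cent_sym[OF w0c])
  qed
  then show "w0 \<otimes> w2 = w2 \<otimes> w0" by (simp add: cent_def)
  show z0: "z \<otimes> w0 \<otimes> z = inv w0" unfolding w0 using c by (simp add: word_simps zz)
  have z3: "z \<otimes> w3 \<otimes> z = inv w3" unfolding w3_def using c by (simp add: word_simps zz)
  have z01: "z \<otimes> (w0 \<otimes> w1) \<otimes> z = inv (w0 \<otimes> w1)"
    unfolding w1 w0 using c by (simp add: word_simps zz)
  have "z \<otimes> w1 \<otimes> z = inv (z \<otimes> w0 \<otimes> z) \<otimes> (z \<otimes> (w0 \<otimes> w1) \<otimes> z)"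
    using c w0c w1c by (simp add: word_simps zz)
  also have "\<dots> = w0 \<otimes> inv (w0 \<otimes> w1)" unfolding z0 z01 using w0c by simp
  also have "w0 \<otimes> w1 = w1 \<otimes> w0" using c01 by (simp add: cent_def)
  also have "w0 \<otimes> inv (w1 \<otimes> w0) = inv w1" using w0c w1c by (simp add: word_simps)
  finally show z1: "z \<otimes> w1 \<otimes> z = inv w1" .
  have c23: "w2 \<in> cent w3"
  proof -
    have "inv h \<otimes> w1 \<otimes> h \<in> cent (inv h \<otimes> w0 \<otimes> h)" using cent_conj[OF w0c c(2) c10] .
    then have "w2 \<in> cent w1" unfolding w2[symmetric] w1[symmetric] .
    then have "inv h \<otimes> w2 \<otimes> h \<in> cent (inv h \<otimes> w1 \<otimes> h)" by (rule cent_conj[OF w1c c(2)])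
    then have "w3 \<in> cent w2" unfolding w3 w2[symmetric] .
    then show ?thesis by (rule cent_sym[OF w2c])
  qed
  have "p \<otimes> inv w3 \<otimes> w3 \<in> cent w3" using cent_mult[OF w3c c23 cent_self[OF w3c]] w2' by simp
  then have "p \<in> cent w3" using pc w3c by (simp add: m_assoc)
  then have p3: "p \<otimes> w3 = w3 \<otimes> p" by (simp add: cent_def)
  have zp: "z \<otimes> p \<otimes> z = inv p"
  proof -
    have "p = inv (w0 \<otimes> w1)" unfolding p_def using w0c w1c by (simp add: inv_mult_group)
    then have "z \<otimes> p \<otimes> z = inv (z \<otimes> (w0 \<otimes> w1) \<otimes> z)" using c w0c w1c by (simp add: word_simps)
    then show ?thesis unfolding z01 \<open>p = inv (w0 \<otimes> w1)\<close> .
  qed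
  have "z \<otimes> w2 \<otimes> z = (z \<otimes> p \<otimes> z) \<otimes> inv (z \<otimes> w3 \<otimes> z)" unfolding w2' using c pc w3c by (simp add: word_simps)
  also have "\<dots> = inv p \<otimes> w3" unfolding zp z3 using w3c by simp
  also have "\<dots> = inv p \<otimes> (w3 \<otimes> p) \<otimes> inv p" using pc w3c by (simp add: m_assoc)
  also have "\<dots> = w3 \<otimes> inv p" unfolding p3[symmetric] using pc w3c by (simp add: word_simps)
  also have "\<dots> = inv w2" unfolding w2' using pc w3c by (simp add: inv_mult_group)
  finally show "z \<otimes> w2 \<otimes> z = inv w2" .
qed

locale quaternion_product = nondegenerate_product +
  assumes y_square_z: "y \<otimes> y = z"
begin

lemma Y_sq: "k \<in> Y \<Longrightarrow> k \<otimes> k = z"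
  using Y_square y_square_z by simp

lemma Y_inverse: "k \<in> Y \<Longrightarrow> inv k = z \<otimes> k"
proof (rule inv_equality)
  assume k: "k \<in> Y"
  then show "z \<otimes> k \<otimes> k = \<one>" using Y_sq by (simp add: m_assoc z_sq)
qed auto

lemma B_involution:
  assumes "b \<in> B" "b \<otimes> b = \<one>" "b \<noteq> \<one>"
  shows "b = z"
proof (cases "b \<in> X")
  case True
  then show ?thesis using X_involution assms by blast
next
  case False
  then have "b \<otimes> b = z" using Y_sq assms(1) by blast
  then show ?thesis using assms(2) z_ne by simp
qed

text \<open>Every nontrivial element of \<open>B\<close> has \<open>z\<close> as a power, and \<open>z\<close> is the only involution of \<open>B\<close>; so \<open>g\<close>
commutes with \<open>z\<close>.\<close>

lemma frobenius:
  assumes b: "b \<in> B" "b \<noteq> \<one>" and g: "g \<in> carrier G" and c: "inv g \<otimes> b \<otimes> g \<in> B"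
  shows "g \<in> B"
proof -
  have bc: "b \<in> carrier G" using B_carrier b by blast
  have "\<exists>n::nat. z = b [^] n"
  proof (cases "b \<in> X")
    case True
    then show ?thesis using z_power b by blast
  next
    case False
    then have "z = b \<otimes> b" using Y_sq b(1) by auto
    then have "z = b [^] (2::nat)" using bc by (simp add: numeral_2_eq_2)
    then show ?thesis by blast
  qed
  then obtain n where n: "z = b [^] (n::nat)" by blast
  have "inv g \<otimes> z \<otimes> g = (inv g \<otimes> b \<otimes> g) [^] n" using conj_pow[OF g bc] n by simp
  then have zB: "zc g \<in> B" using subgroup_pow_closed[OF B_subgroup c] unfolding zc_def by simp
  have "zc g \<noteq> \<one>"
  proof
    assume 1: "zc g = \<one>"
    have "z = g \<otimes> zc g \<otimes> inv g" unfolding zc_def using g by (simp add: word_simps)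
    then show False unfolding 1 using g z_ne by simp
  qed
  then have e: "zc g = z" using B_involution[OF zB zc_sq[OF g]] by blast
  have "z \<otimes> g = g \<otimes> zc g" unfolding zc_def using g by (simp add: word_simps)
  then have "g \<in> cent z" unfolding e using g by (simp add: cent_def)
  then show ?thesis by (rule cent_z_B)
qed

text \<open>The factor of \<open>g\<close> in \<open>B\<close> commutes with \<open>t\<close>, so by \<open>frobenius\<close> it is trivial or \<open>t\<close> is in \<open>B\<close>.\<close>

lemma cent_A:
  assumes t: "t \<in> A" "t \<noteq> \<one>" and g: "g \<in> cent t"
  shows "g \<in> A"
proof -
  obtain a b where ab: "a \<in> A" "b \<in> B" "g = a \<otimes> b" using factor_AB[OF cent_carrier[OF g]] by blast
  have bc: "b \<in> carrier G" using B_carrier[OF ab(2)] .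
  have "b \<in> cent t"
    using cent_cancel_left[OF A.mem_carrier[OF t(1)] A_cent_A[OF ab(1) t(1)] bc] g ab(3) by simp
  then have bt: "b \<otimes> t = t \<otimes> b" by (simp add: cent_def)
  have "inv t \<otimes> b \<otimes> t = inv t \<otimes> (b \<otimes> t)" using t bc by (simp add: m_assoc)
  also have "\<dots> = b" unfolding bt using t bc by (simp add: word_simps)
  finally have "inv t \<otimes> b \<otimes> t \<in> B" using ab(2) by simp
  then have "b = \<one>" using frobenius[OF ab(2) _ A.mem_carrier[OF t(1)]] A_B_disjoint t by blast
  then show ?thesis using ab by simp
qed

text \<open>Otherwise the centraliser of \<open>z v z\<close>, which is \<open>A\<close>, would contain the conjugate of \<open>A\<close> under
\<open>z\<close>, against \<open>z_not_normalizes\<close>.\<close>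

lemma A_conj_z:
  assumes v: "v \<in> A" "z \<otimes> v \<otimes> z \<in> A"
  shows "v = \<one>"
proof (rule ccontr)
  assume ne: "v \<noteq> \<one>"
  have ne': "z \<otimes> v \<otimes> z \<noteq> \<one>"
  proof
    assume 1: "z \<otimes> v \<otimes> z = \<one>"
    have "v = z \<otimes> (z \<otimes> v \<otimes> z) \<otimes> z" using v(1) by (simp add: m_assoc z_sq)
    then show False unfolding 1 using ne z_sq by simp
  qed
  have "z \<otimes> a \<otimes> z \<in> A" if a: "a \<in> A" for a
    using cent_A[OF v(2) ne'] cent_conj[OF A.mem_carrier[OF v(1)] z_carrier A_cent_A[OF a v(1)]] by simp
  then show False using z_not_normalizes by blast
qed

lemma A_zc_inj:
  assumes "a \<in> A" "a' \<in> A" "zc a = zc a'"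
  shows "a = a'"
proof -
  have "z \<otimes> (a \<otimes> inv a') = a \<otimes> zc a \<otimes> inv a'" using assms(1,2) by (simp add: zc_def word_simps)
  also have "\<dots> = (a \<otimes> inv a') \<otimes> z" unfolding assms(3) using assms(1,2) by (simp add: zc_def word_simps)
  finally have "a \<otimes> inv a' \<in> cent z" using assms(1,2) by (simp add: cent_def)
  then have 1: "a \<otimes> inv a' = \<one>" using cent_z_A assms(1,2) by simp
  have "a = (a \<otimes> inv a') \<otimes> a'" using assms(1,2) by (simp add: m_assoc)
  then show ?thesis unfolding 1 using assms(2) by simp
qed

text \<open>The products of a conjugate of \<open>z\<close> with \<open>z\<close>; all of them are inverted by \<open>z\<close>.\<close>

definition u where "u a = zc a \<otimes> z"

lemma u_carrier [simp]: "a \<in> carrier G \<Longrightarrow> u a \<in> carrier G"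
  by (simp add: u_def)

lemma u_inverse: "a \<in> carrier G \<Longrightarrow> inv (u a) = z \<otimes> zc a"
  by (simp add: u_def zc_def word_simps)

lemma z_inverts_u: "a \<in> carrier G \<Longrightarrow> z \<otimes> u a \<otimes> z = inv (u a)"
  by (simp add: u_inverse) (simp add: u_def m_assoc z_sq)

lemma u_square:
  assumes a: "a \<in> A" and 1: "u a \<otimes> u a = \<one>"
  shows "a = \<one>"
proof -
  have "u a = inv (u a)" using 1 a by (metis A.mem_carrier inv_equality u_carrier)
  then have "zc a \<otimes> z = z \<otimes> zc a" using a by (simp add: u_inverse) (simp add: u_def)
  then have "zc a \<in> cent z" using a by (simp add: cent_def)
  then have B: "zc a \<in> B" by (rule cent_z_B)
  have "zc a \<noteq> \<one>"
  proof
    assume 1: "zc a = \<one>"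
    have "z = a \<otimes> zc a \<otimes> inv a" unfolding zc_def using a by (simp add: word_simps)
    then show False unfolding 1 using a z_ne by simp
  qed
  then have "zc a = z" using B_involution[OF B zc_sq[OF A.mem_carrier[OF a]]] by blast
  then have "zc a = zc \<one>" by (simp add: zc_def)
  then show ?thesis using A_zc_inj[OF a A.one_closed] by blast
qed

lemma u_not_A:
  assumes a: "a \<in> A" "u a \<in> A"
  shows "a = \<one>"
proof -
  have "u a = \<one>" using A_conj_z[OF a(2)] z_inverts_u a by simp
  then show ?thesis using u_square[OF a(1)] by simp
qed

text \<open>The elements \<open>a\<close> for which Ito's computation applies to the commutator \<open>u a\<close> of \<open>a\<close> and \<open>z\<close>: the
factor of \<open>a z\<close> in \<open>B\<close> lies in the abelian group \<open>X\<close>.\<close>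

definition P where "P = {a \<in> A. a \<otimes> z \<in> XA}"

lemma P_A: "a \<in> P \<Longrightarrow> a \<in> A"
  by (simp add: P_def)

text \<open>If \<open>a z = x e\<close> and \<open>\<xi> = z x\<close>, then conjugation by \<open>z\<close> maps \<open>a\<close> to \<open>\<xi> e\<close> and \<open>e\<close> to
\<open>\<xi>\<^sup>-\<^sup>1 a\<close>; similarly for \<open>b\<close> with \<open>\<xi>'\<close> and \<open>f\<close>.  The conjugates of \<open>a\<close> and
\<open>b\<close> commute (\<open>r1\<close>), those of \<open>e\<close> and \<open>f\<close> commute (\<open>r2\<close>), and \<open>\<xi>\<close> commutes with \<open>\<xi>'\<close>; the claim is a
consequence of these three relations.\<close>

lemma u_commute:
  assumes "a \<in> P" "b \<in> P"
  shows "u a \<otimes> u b = u b \<otimes> u a"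
proof -
  have A: "a \<in> A" "b \<in> A" using assms P_A by auto
  obtain x e where x: "x \<in> X" "e \<in> A" "a \<otimes> z = x \<otimes> e" using assms(1) unfolding P_def XA_def by blast
  obtain x' f where x': "x' \<in> X" "f \<in> A" "b \<otimes> z = x' \<otimes> f" using assms(2) unfolding P_def XA_def by blast
  define \<xi> \<xi>' where "\<xi> = z \<otimes> x" and "\<xi>' = z \<otimes> x'"
  have X: "\<xi> \<in> X" "\<xi>' \<in> X" unfolding \<xi>_def \<xi>'_def using x(1) x'(1) z_X by auto
  have c: "a \<in> carrier G" "b \<in> carrier G" "e \<in> carrier G" "f \<in> carrier G" "\<xi> \<in> carrier G" "\<xi>' \<in> carrier G"
    "x \<in> carrier G" "x' \<in> carrier G"
    using A x x' X by auto
  have Xc: "\<xi> \<otimes> \<xi>' = \<xi>' \<otimes> \<xi>" using X_comm X by blast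
  have az: "z \<otimes> a \<otimes> z = \<xi> \<otimes> e" using x(3) c unfolding \<xi>_def by (simp add: m_assoc)
  have bz: "z \<otimes> b \<otimes> z = \<xi>' \<otimes> f" using x'(3) c unfolding \<xi>'_def by (simp add: m_assoc)
  have conj: "z \<otimes> e \<otimes> z = inv \<xi> \<otimes> a" if "z \<otimes> a \<otimes> z = \<xi> \<otimes> e" "\<xi> \<in> X" "a \<in> carrier G" "e \<in> carrier G" for a e \<xi>
  proof -
    have \<xi>c: "\<xi> \<in> carrier G" using that by auto
    have zx: "inv \<xi> \<otimes> z = z \<otimes> inv \<xi>" using X_comm that z_X by blast
    have "inv \<xi> \<otimes> a = inv \<xi> \<otimes> z \<otimes> (z \<otimes> a \<otimes> z) \<otimes> z" using that(3) \<xi>c by (simp add: m_assoc z_sq)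
    also have "\<dots> = z \<otimes> e \<otimes> z" unfolding zx that(1) using that(4) \<xi>c by (simp add: word_simps)
    finally show ?thesis by simp
  qed
  have ez: "z \<otimes> e \<otimes> z = inv \<xi> \<otimes> a" using conj[OF az X(1)] c by blast
  have fz: "z \<otimes> f \<otimes> z = inv \<xi>' \<otimes> b" using conj[OF bz X(2)] c by blast
  have zconj: "(z \<otimes> s \<otimes> z) \<otimes> (z \<otimes> t \<otimes> z) = (z \<otimes> t \<otimes> z) \<otimes> (z \<otimes> s \<otimes> z)" if "s \<in> A" "t \<in> A" for s t
  proof -
    have "(z \<otimes> s \<otimes> z) \<otimes> (z \<otimes> t \<otimes> z) = z \<otimes> (s \<otimes> t) \<otimes> z" using that by (simp add: m_assoc)
    also have "\<dots> = (z \<otimes> t \<otimes> z) \<otimes> (z \<otimes> s \<otimes> z)" unfolding A_comm[OF that] using that by (simp add: m_assoc)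
    finally show ?thesis .
  qed
  have r1: "(\<xi> \<otimes> e) \<otimes> (\<xi>' \<otimes> f) = (\<xi>' \<otimes> f) \<otimes> (\<xi> \<otimes> e)" using zconj[OF A] unfolding az bz .
  have "(inv \<xi> \<otimes> a) \<otimes> (inv \<xi>' \<otimes> b) = (inv \<xi>' \<otimes> b) \<otimes> (inv \<xi> \<otimes> a)" using zconj[OF x(2) x'(2)] unfolding ez fz .
  then have "inv ((inv \<xi> \<otimes> a) \<otimes> (inv \<xi>' \<otimes> b)) = inv ((inv \<xi>' \<otimes> b) \<otimes> (inv \<xi> \<otimes> a))" by simp
  then have r2: "inv b \<otimes> \<xi>' \<otimes> inv a \<otimes> \<xi> = inv a \<otimes> \<xi> \<otimes> inv b \<otimes> \<xi>'" using c by (simp add: inv_mult_group m_assoc)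
  have ua: "u a = inv a \<otimes> (\<xi> \<otimes> e)" unfolding az[symmetric] u_def zc_def using c by (simp add: m_assoc)
  have ub: "u b = inv b \<otimes> (\<xi>' \<otimes> f)" unfolding bz[symmetric] u_def zc_def using c by (simp add: m_assoc)
  have eb: "e \<otimes> inv b = inv b \<otimes> e" using A_comm x(2) A(2) by blast
  have fa: "f \<otimes> inv a = inv a \<otimes> f" using A_comm x'(2) A(1) by blast
  have "u a \<otimes> u b = inv a \<otimes> \<xi> \<otimes> (e \<otimes> inv b) \<otimes> \<xi>' \<otimes> f" unfolding ua ub using c by (simp add: m_assoc)
  also have "\<dots> = inv a \<otimes> \<xi> \<otimes> inv b \<otimes> inv \<xi> \<otimes> ((\<xi> \<otimes> e) \<otimes> (\<xi>' \<otimes> f))" unfolding eb using c by (simp add: word_simps)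
  also have "\<dots> = inv a \<otimes> \<xi> \<otimes> inv b \<otimes> inv \<xi> \<otimes> (\<xi>' \<otimes> \<xi>) \<otimes> inv \<xi> \<otimes> f \<otimes> \<xi> \<otimes> e" unfolding r1 using c by (simp add: word_simps)
  also have "\<dots> = (inv a \<otimes> \<xi> \<otimes> inv b \<otimes> \<xi>') \<otimes> inv \<xi> \<otimes> f \<otimes> \<xi> \<otimes> e" unfolding Xc[symmetric] using c by (simp add: word_simps)
  also have "\<dots> = inv b \<otimes> \<xi>' \<otimes> (inv a \<otimes> f) \<otimes> \<xi> \<otimes> e" unfolding r2[symmetric] using c by (simp add: word_simps)
  also have "\<dots> = u b \<otimes> u a" unfolding fa[symmetric] ua ub using c by (simp add: m_assoc)
  finally show ?thesis .
qed

end

section \<open>The quaternion case: rotations of order four\<close>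

context quaternion_product
begin

lemma P_iff: "a \<in> A \<Longrightarrow> a \<notin> P \<longleftrightarrow> a \<otimes> z \<in> YA"
  using XA_or_YA[of "a \<otimes> z"] XA_YA_disjoint[of "a \<otimes> z"] by (auto simp: P_def)

lemma zA_ratio:
  assumes "c \<in> A" "e \<in> A" "s \<in> carrier G" "v \<in> A" "w \<in> A" "c \<otimes> z = s \<otimes> v" "e \<otimes> z = s \<otimes> w"
  shows "c = e"
proof -
  have "z \<otimes> (inv c \<otimes> e) \<otimes> z = inv (c \<otimes> z) \<otimes> (e \<otimes> z)" using assms(1,2) by (simp add: word_simps)
  also have "\<dots> = inv v \<otimes> w" unfolding assms(6,7) using assms(3-5) by (simp add: word_simps)
  finally have "inv c \<otimes> e = \<one>" using A_conj_z[of "inv c \<otimes> e"] assms(1,2,4,5) by simp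
  then have "c \<otimes> (inv c \<otimes> e) = c \<otimes> \<one>" by simp
  then show ?thesis using assms(1,2) by (simp add: word_simps)
qed

text \<open>Let \<open>a z = k e\<close> with \<open>k \<in> Y\<close>.  As \<open>k\<^sup>2 = z\<close>, the element \<open>e\<close> is in the same situation as \<open>a\<close>, with
\<open>inv k\<close> and \<open>a\<close> in place of \<open>k\<close> and \<open>e\<close>.  With \<open>c = a inv e\<close> the product \<open>z c\<close> is the conjugate of \<open>k\<close>
under \<open>a\<close>; so it has order 4, and its square is the conjugate of \<open>z\<close> under
\<open>a\<close>, by which \<open>c\<close> determines \<open>a\<close>.\<close>

lemma partner:
  assumes a: "a \<in> A" and k: "k \<in> Y" and e: "e \<in> A" and az: "a \<otimes> z = k \<otimes> e"
  shows "e \<otimes> z = inv k \<otimes> a" "e \<notin> P" "a \<notin> P"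
    and "(z \<otimes> (a \<otimes> inv e)) \<otimes> (z \<otimes> (a \<otimes> inv e)) = zc a"
    and "inv a \<otimes> z = z \<otimes> (a \<otimes> inv e) \<otimes> z \<otimes> inv e"
    and "(a \<otimes> inv e \<otimes> z) \<otimes> (a \<otimes> inv e \<otimes> z) = zc e"
    and "e \<noteq> \<one>" "a \<otimes> inv e \<noteq> \<one>"
proof -
  let ?c = "a \<otimes> inv e"
  have car: "a \<in> carrier G" "k \<in> carrier G" "e \<in> carrier G" using a k e by auto
  have "inv k \<otimes> a = inv k \<otimes> (a \<otimes> z) \<otimes> z" using car by (simp add: m_assoc z_sq)
  also have "\<dots> = e \<otimes> z" unfolding az using car by (simp add: word_simps)
  finally show ez: "e \<otimes> z = inv k \<otimes> a" by simp
  have "e \<otimes> z \<in> YA" unfolding ez YA_def using Y_inv[OF k] a by blast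
  then show "e \<notin> P" using P_iff[OF e] by blast
  have "a \<otimes> z \<in> YA" unfolding az YA_def using k e by blast
  then show "a \<notin> P" using P_iff[OF a] by blast
  have ec: "e \<otimes> ?c = a"
  proof -
    have "e \<otimes> ?c = (e \<otimes> a) \<otimes> inv e" using car by (simp add: m_assoc)
    also have "e \<otimes> a = a \<otimes> e" using A_comm a e by blast
    finally show ?thesis using car by (simp add: m_assoc)
  qed
  have "z \<otimes> ?c = inv a \<otimes> (a \<otimes> z) \<otimes> ?c" using car by (simp add: word_simps)
  also have "\<dots> = inv a \<otimes> k \<otimes> (e \<otimes> ?c)" unfolding az using car by (simp add: m_assoc)
  finally have zc1: "z \<otimes> ?c = inv a \<otimes> k \<otimes> a" unfolding ec .
  have "(z \<otimes> ?c) \<otimes> (z \<otimes> ?c) = inv a \<otimes> (k \<otimes> k) \<otimes> a" unfolding zc1 using car by (simp add: word_simps)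
  then show sq: "(z \<otimes> ?c) \<otimes> (z \<otimes> ?c) = zc a" unfolding Y_sq[OF k] zc_def .
  have "a \<otimes> inv ?c = (e \<otimes> ?c) \<otimes> inv ?c" unfolding ec ..
  also have "\<dots> = e" using car by (simp add: word_simps)
  finally have ac: "a \<otimes> inv ?c = e" .
  have "z \<otimes> ?c \<otimes> z \<otimes> inv e = (z \<otimes> ?c) \<otimes> (z \<otimes> ?c) \<otimes> inv ?c \<otimes> inv e" using car by (simp add: word_simps)
  also have "\<dots> = inv a \<otimes> z \<otimes> (a \<otimes> inv ?c) \<otimes> inv e" unfolding sq zc_def using car by (simp add: m_assoc)
  also have "\<dots> = inv a \<otimes> z" unfolding ac using car by (simp add: m_assoc)
  finally show "inv a \<otimes> z = z \<otimes> ?c \<otimes> z \<otimes> inv e" by simp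
  have "(?c \<otimes> z) \<otimes> (?c \<otimes> z) = z \<otimes> ((z \<otimes> ?c) \<otimes> (z \<otimes> ?c)) \<otimes> z" using car by (simp add: m_assoc)
  also have "\<dots> = zc (a \<otimes> z)" unfolding sq using car by (simp add: zc_mult)
  also have "\<dots> = zc e" unfolding az using zc_mult_B[of k e] k car by simp
  finally show "(?c \<otimes> z) \<otimes> (?c \<otimes> z) = zc e" .
  have zk: "z \<noteq> k" using z_X k XY_disjoint by blast
  show "e \<noteq> \<one>"
  proof
    assume "e = \<one>"
    then have "a \<otimes> z = k" using az car by simp
    then have "a \<otimes> z \<otimes> z = k \<otimes> z" by simp
    then have "a = k \<otimes> z" using car by (simp add: m_assoc z_sq)
    then have "a \<in> B" using YX_mult[OF z_X k] by simp
    then have "a = \<one>" using A_B_disjoint a by blast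
    then show False using \<open>a \<otimes> z = k\<close> zk by simp
  qed
  show "?c \<noteq> \<one>"
  proof
    assume "?c = \<one>"
    then have 1: "zc a = \<one>" using sq z_sq by simp
    have "z = a \<otimes> zc a \<otimes> inv a" unfolding zc_def using car by (simp add: word_simps)
    then show False unfolding 1 using car z_ne by simp
  qed
qed

lemma partner_exists:
  assumes "a \<in> A" "a \<notin> P"
  shows "\<exists>k\<in>Y. \<exists>e\<in>A. a \<otimes> z = k \<otimes> e"
  using P_iff[OF assms(1)] assms(2) unfolding YA_def by blast

lemma partner_ratio:
  assumes a: "a \<in> A" and k: "k \<in> Y" and e: "e \<in> A" and az: "a \<otimes> z = k \<otimes> e"
    and b: "b \<in> carrier G" and e': "e' \<in> A" and iaz: "inv a \<otimes> z = b \<otimes> e'"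
  shows "a \<otimes> inv e \<otimes> z = (z \<otimes> b) \<otimes> (e' \<otimes> e)"
proof -
  have "z \<otimes> (b \<otimes> e') \<otimes> e = z \<otimes> (z \<otimes> (a \<otimes> inv e) \<otimes> z \<otimes> inv e) \<otimes> e"
    unfolding iaz[symmetric] using partner(5)[OF a k e az] by simp
  also have "\<dots> = a \<otimes> inv e \<otimes> z" using a e by (simp add: m_assoc)
  finally show ?thesis using b e e' by (simp add: m_assoc)
qed

text \<open>Suppose that \<open>a\<close> and its inverse are both outside \<open>P\<close>.  Then \<open>partner_ratio\<close> for the two
elements yields conjugates of \<open>z\<close> under the same element of \<open>A\<close>, so the ratios \<open>a inv e\<close> and
\<open>inv a inv e'\<close> agree, and also \<open>k = k'\<close>.  Hence \<open>k\<close> commutes with \<open>a\<^sup>2\<close>, which forces \<open>a\<^sup>2 = 1\<close>, and then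
\<open>a = e\<^sup>2\<close>.  Now the same formula for the partner \<open>e\<close> of \<open>a\<close> leads to \<open>z \<in> A\<close>.\<close>

lemma inv_in_P:
  assumes a: "a \<in> A" "a \<notin> P"
  shows "inv a \<in> P"
proof (rule ccontr)
  assume n: "inv a \<notin> P"
  have ia: "inv a \<in> A" using a by simp
  obtain k e where k: "k \<in> Y" "e \<in> A" "a \<otimes> z = k \<otimes> e" using partner_exists[OF a] by blast
  obtain k' e' where k': "k' \<in> Y" "e' \<in> A" "inv a \<otimes> z = k' \<otimes> e'" using partner_exists[OF ia n] by blast
  have car: "a \<in> carrier G" "k \<in> carrier G" "e \<in> carrier G" "k' \<in> carrier G" "e' \<in> carrier G" using a k k' by auto
  have ee: "e' \<otimes> e = e \<otimes> e'" using A_comm k k' by blast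
  have 1: "a \<otimes> inv e \<otimes> z = (z \<otimes> k') \<otimes> (e' \<otimes> e)" using partner_ratio[OF a(1) k car(4) k'(2,3)] .
  have 2: "inv a \<otimes> inv e' \<otimes> z = (z \<otimes> k) \<otimes> (e' \<otimes> e)"
    using partner_ratio[OF ia k' car(2) k(2)] k(3) car unfolding ee by simp
  have zk: "z \<otimes> k \<in> B" "z \<otimes> k' \<in> B" using k(1) k'(1) z_X by auto
  have "zc (a \<otimes> inv e \<otimes> z) = zc (inv a \<otimes> inv e' \<otimes> z)"
    unfolding 1 2 using zc_mult_B[OF zk(1)] zc_mult_B[OF zk(2)] car by simp
  then have "z \<otimes> zc (a \<otimes> inv e) \<otimes> z = z \<otimes> zc (inv a \<otimes> inv e') \<otimes> z" using car by (simp add: zc_mult)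
  then have "zc (a \<otimes> inv e) = zc (inv a \<otimes> inv e')" using car by simp
  then have cc: "a \<otimes> inv e = inv a \<otimes> inv e'" using A_zc_inj a k k' by simp
  have "(z \<otimes> k') \<otimes> (e' \<otimes> e) = (z \<otimes> k) \<otimes> (e' \<otimes> e)" using 1 2 unfolding cc by (rule trans[OF sym])
  then have "z \<otimes> k' = z \<otimes> k" using factor_unique(1)[OF zk(2,1)] k(2) k'(2) by blast
  then have kk: "k' = k" using car by simp
  have "(a \<otimes> z) \<otimes> inv (inv a \<otimes> z) = a \<otimes> a" using car by (simp add: word_simps)
  then have aa1: "a \<otimes> a = k \<otimes> (e \<otimes> inv e') \<otimes> inv k" unfolding k(3) k'(3) kk using car by (simp add: word_simps)
  have aa2: "a \<otimes> a = e \<otimes> inv e'"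
  proof -
    have "a \<otimes> a = a \<otimes> (a \<otimes> inv e) \<otimes> e" using car by (simp add: m_assoc)
    also have "\<dots> = inv e' \<otimes> e" unfolding cc using car by (simp add: word_simps)
    also have "\<dots> = e \<otimes> inv e'" using A_comm k(2) k'(2) by simp
    finally show ?thesis .
  qed
  have "k \<otimes> (a \<otimes> a) = k \<otimes> (e \<otimes> inv e') \<otimes> inv k \<otimes> k" unfolding aa2 using car by (simp add: m_assoc)
  then have "k \<otimes> (a \<otimes> a) = (a \<otimes> a) \<otimes> k" unfolding aa1[symmetric] .
  then have kc: "k \<in> cent (a \<otimes> a)" using car by (simp add: cent_def)
  have aa: "a \<otimes> a = \<one>"
  proof (rule ccontr)
    assume ne: "a \<otimes> a \<noteq> \<one>"
    have "k \<in> A" using cent_A[OF A.m_closed[OF a(1) a(1)] ne kc] .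
    then have "k = \<one>" using A_B_disjoint[of k] k(1) by simp
    then show False using k(1) XY_disjoint X.one_closed by blast
  qed
  have ia_a: "inv a = a" using aa car by (simp add: inv_equality)
  have ez: "e \<otimes> z = (z \<otimes> k) \<otimes> a" using partner(1)[OF a(1) k] Y_inverse[OF k(1)] by simp
  have "a \<otimes> inv e = e"
    by (rule zA_ratio[OF _ k(2) _ _ a(1) _ ez, of _ "e' \<otimes> e"]) (use 1 kk a k k' car in simp_all)
  then have ae: "a = e \<otimes> e" using car by (metis inv_solve_right)
  have iae: "inv a = inv e \<otimes> inv e" unfolding ae using car by (simp add: inv_mult_group)
  have inve: "e \<otimes> inv a = inv e" unfolding iae using car by (simp add: word_simps)
  have "inv e \<otimes> z = z \<otimes> (e \<otimes> inv a) \<otimes> z \<otimes> inv a"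
    using partner(5)[OF k(2) Y_inv[OF k(1)] a(1) partner(1)[OF a(1) k]] .
  also have "\<dots> = z \<otimes> (inv e \<otimes> z) \<otimes> inv a" unfolding inve using car by (simp add: m_assoc)
  finally have ie: "inv e \<otimes> z = z \<otimes> (inv e \<otimes> z) \<otimes> inv a" .
  obtain b f where bf: "b \<in> B" "f \<in> A" "inv e \<otimes> z = b \<otimes> f" using factor_BA[of "inv e \<otimes> z"] car by auto
  have bc: "b \<in> carrier G" using B_carrier[OF bf(1)] .
  have "b \<otimes> f = z \<otimes> (b \<otimes> f) \<otimes> inv a" using ie unfolding bf(3) .
  also have "\<dots> = (z \<otimes> b) \<otimes> f \<otimes> inv a" using bc bf(2) car by (simp add: m_assoc)
  also have "z \<otimes> b = b \<otimes> z" using z_central_B[OF bf(1)] by simp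
  finally have bf2: "b \<otimes> f = b \<otimes> z \<otimes> f \<otimes> inv a" .
  have "f = inv b \<otimes> (b \<otimes> f)" using bc bf(2) by (simp add: word_simps)
  also have "\<dots> = z \<otimes> (f \<otimes> inv a)" unfolding bf2 using bc bf(2) car by (simp add: word_simps)
  finally have "f = z \<otimes> (f \<otimes> inv a)" .
  then have "f \<otimes> inv (f \<otimes> inv a) = z \<otimes> (f \<otimes> inv a) \<otimes> inv (f \<otimes> inv a)" by (rule arg_cong)
  then have "z = f \<otimes> inv (f \<otimes> inv a)" using bf(2) car by (simp add: m_assoc)
  then have "z \<in> A" using bf(2) a(1) by simp
  then show False using A_B_disjoint z_X z_ne by blast
qed

lemma ratio_in_P:
  assumes a: "a \<in> A" and k: "k \<in> Y" and e: "e \<in> A" and az: "a \<otimes> z = k \<otimes> e"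
  shows "a \<otimes> inv e \<in> P"
proof -
  have "inv a \<in> P" using inv_in_P[OF a] partner(3)[OF a k e az] by blast
  then obtain x e' where x: "x \<in> X" "e' \<in> A" "inv a \<otimes> z = x \<otimes> e'" unfolding P_def XA_def by blast
  have "a \<otimes> inv e \<otimes> z = (z \<otimes> x) \<otimes> (e' \<otimes> e)"
    using partner_ratio[OF a k e az X.mem_carrier[OF x(1)] x(2,3)] .
  moreover have "z \<otimes> x \<in> X" "e' \<otimes> e \<in> A" using x e z_X by auto
  ultimately have "a \<otimes> inv e \<otimes> z \<in> XA" unfolding XA_def by blast
  then show ?thesis using a e by (simp add: P_def)
qed

lemma inv_ratio_in_P:
  assumes a: "a \<in> A" and k: "k \<in> Y" and e: "e \<in> A" and az: "a \<otimes> z = k \<otimes> e"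
  shows "inv (a \<otimes> inv e) \<in> P"
proof -
  have "inv (a \<otimes> inv e) = e \<otimes> inv a" using a e by (simp add: inv_mult_group)
  then show ?thesis using ratio_in_P[OF e Y_inv[OF k] a partner(1)[OF a k e az]] by simp
qed

text \<open>The element \<open>h = c z\<close> has order 4, since its square is a conjugate of \<open>z\<close>.  By
\<open>ratio_in_P\<close> and \<open>inv_ratio_in_P\<close> two adjacent edges of the square belonging to \<open>h\<close> commute, so that
\<open>square_rotation\<close> applies.  The product \<open>g\<close> of two opposite edges commutes with \<open>h\<^sup>2\<close>, a
conjugate of \<open>z\<close> other than \<open>z\<close>, and is inverted by \<open>z\<close>; by \<open>frobenius\<close> it is trivial.  So opposite
edges are inverse to each other, which means that \<open>h\<^sup>2\<close> and likewise \<open>c\<^sup>2\<close> invert \<open>u c\<close>.\<close>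

lemma ratio_order:
  assumes a: "a \<in> A" and k: "k \<in> Y" and e: "e \<in> A" and az: "a \<otimes> z = k \<otimes> e"
    and c: "c = a \<otimes> inv e"
  shows "inv (c \<otimes> c) \<otimes> u c \<otimes> (c \<otimes> c) = inv (u c)" "c \<otimes> c \<otimes> (c \<otimes> c) = \<one>"
proof -
  define h where "h = c \<otimes> z"
  have cA: "c \<in> A" using a e c by simp
  have cc: "c \<in> carrier G" "e \<in> carrier G" using cA e by auto
  have hc: "h \<in> carrier G" unfolding h_def using cc by simp
  have ih: "inv h = z \<otimes> inv c" unfolding h_def using cc by (simp add: inv_mult_group)
  have hh: "h \<otimes> h = zc e" unfolding h_def c using partner(6)[OF a k e az] .
  have h4: "h \<otimes> h \<otimes> (h \<otimes> h) = \<one>" unfolding hh using zc_sq cc by simp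
  define w0 where "w0 = z \<otimes> inv h \<otimes> z \<otimes> h"
  have w0u: "w0 = u c" unfolding w0_def ih unfolding h_def u_def zc_def using cc by (simp add: m_assoc)
  define w1 where "w1 = inv h \<otimes> w0 \<otimes> h"
  define w2 where "w2 = inv h \<otimes> w1 \<otimes> h"
  have w0c: "w0 \<in> carrier G" using w0u cc by simp
  have w1c: "w1 \<in> carrier G" unfolding w1_def using w0c hc by simp
  have w2c: "w2 \<in> carrier G" unfolding w2_def using w1c hc by simp
  have "h \<otimes> z \<otimes> inv h \<otimes> z = u (inv c)" unfolding u_def zc_def ih unfolding h_def using cc by (simp add: m_assoc)
  moreover have "u c \<otimes> u (inv c) = u (inv c) \<otimes> u c"
    using u_commute ratio_in_P[OF a k e az] inv_ratio_in_P[OF a k e az] c by blast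
  ultimately have "w0 \<otimes> (h \<otimes> z \<otimes> inv h \<otimes> z) = (h \<otimes> z \<otimes> inv h \<otimes> z) \<otimes> w0" using w0u by simp
  note rot = square_rotation[OF z_carrier hc z_sq h4 w0_def w1_def w2_def this]
  define g where "g = w0 \<otimes> w2"
  have gc: "g \<in> carrier G" unfolding g_def using w0c w2c by simp
  have zg: "z \<otimes> g \<otimes> z = inv g"
  proof -
    have "z \<otimes> g \<otimes> z = (z \<otimes> w0 \<otimes> z) \<otimes> (z \<otimes> w2 \<otimes> z)" unfolding g_def using w0c w2c by (simp add: m_assoc)
    also have "\<dots> = inv (w2 \<otimes> w0)" unfolding rot(1,3) using w0c w2c by (simp add: inv_mult_group)
    finally show ?thesis unfolding g_def rot(4) .
  qed
  have g1: "g = \<one>"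
  proof (rule ccontr)
    assume gne: "g \<noteq> \<one>"
    have "inv (h \<otimes> h) \<otimes> g \<otimes> (h \<otimes> h) = (inv (h \<otimes> h) \<otimes> w0 \<otimes> (h \<otimes> h)) \<otimes> (inv (h \<otimes> h) \<otimes> w2 \<otimes> (h \<otimes> h))"
      unfolding g_def using w0c w2c hc by (simp add: word_simps)
    also have "\<dots> = g" unfolding rot(5,6) g_def rot(4) ..
    finally have g1: "inv (zc e) \<otimes> g \<otimes> zc e = g" unfolding hh .
    have "g \<otimes> zc e = zc e \<otimes> (inv (zc e) \<otimes> g \<otimes> zc e)" using gc cc by (simp add: word_simps)
    then have gz: "g \<in> cent (zc e)" unfolding g1 using gc by (simp add: cent_def)
    have e_back: "inv (inv e) \<otimes> zc e \<otimes> inv e = z" unfolding zc_def using cc by (simp add: word_simps)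
    have b: "e \<otimes> g \<otimes> inv e \<in> cent z"
      using cent_conj[OF zc_carrier[OF cc(2)] inv_closed[OF cc(2)] gz] unfolding e_back using cc by simp
    have bB: "e \<otimes> g \<otimes> inv e \<in> B" using cent_z_B[OF b] .
    have bne: "e \<otimes> g \<otimes> inv e \<noteq> \<one>"
    proof
      assume 1: "e \<otimes> g \<otimes> inv e = \<one>"
      have "g = inv e \<otimes> (e \<otimes> g \<otimes> inv e) \<otimes> e" using gc cc by (simp add: word_simps)
      then show False unfolding 1 using gne cc by simp
    qed
    define s where "s = e \<otimes> z \<otimes> inv e"
    have sc: "s \<in> carrier G" unfolding s_def using cc by simp
    have iss: "inv s = s" unfolding s_def using cc by (simp add: word_simps)
    have "inv s \<otimes> (e \<otimes> g \<otimes> inv e) \<otimes> s = e \<otimes> (z \<otimes> g \<otimes> z) \<otimes> inv e"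
      unfolding iss unfolding s_def using gc cc by (simp add: word_simps)
    also have "\<dots> = inv (e \<otimes> g \<otimes> inv e)" unfolding zg using gc cc by (simp add: word_simps)
    also have "\<dots> \<in> B" using subgroup.m_inv_closed[OF B_subgroup bB] .
    finally have "s \<in> B" using frobenius[OF bB bne sc] by blast
    moreover have "s \<otimes> s = \<one>" using iss sc by (metis r_inv)
    moreover have "s \<noteq> \<one>"
    proof
      assume 1: "s = \<one>"
      have "z = inv e \<otimes> s \<otimes> e" unfolding s_def using cc by (simp add: word_simps)
      then show False unfolding 1 using cc z_ne by simp
    qed
    ultimately have sz: "s = z" using B_involution by blast
    have "e \<otimes> z = s \<otimes> e" unfolding s_def using cc by (simp add: word_simps)
    then have "e \<in> cent z" unfolding sz using cc by (simp add: cent_def)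
    then have "e = \<one>" using cent_z_A[OF e] by blast
    then show False using partner(7)[OF a k e az] by blast
  qed
  have "w0 \<otimes> w2 = \<one>" using g1 unfolding g_def .
  then have "w2 \<otimes> w0 = \<one>" unfolding rot(4) .
  then have w2: "w2 = inv w0" using w0c w2c by (simp add: inv_equality)
  have ch: "c = h \<otimes> z" unfolding h_def using cc by (simp add: m_assoc z_sq)
  have c1: "inv c \<otimes> w0 \<otimes> c = inv w1"
  proof -
    have "inv c \<otimes> w0 \<otimes> c = z \<otimes> w1 \<otimes> z" unfolding ch w1_def using hc w0c by (simp add: word_simps)
    then show ?thesis unfolding rot(2) .
  qed
  have c2: "inv c \<otimes> inv w1 \<otimes> c = inv w0"
  proof -
    have "inv c \<otimes> inv w1 \<otimes> c = inv (z \<otimes> w2 \<otimes> z)" unfolding ch w2_def using hc w1c by (simp add: word_simps)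
    also have "\<dots> = w2" unfolding rot(3) using w2c by simp
    finally show ?thesis unfolding w2 .
  qed
  have "inv (c \<otimes> c) \<otimes> w0 \<otimes> (c \<otimes> c) = inv c \<otimes> (inv c \<otimes> w0 \<otimes> c) \<otimes> c" using cc w0c by (simp add: word_simps)
  then have inv2: "inv (c \<otimes> c) \<otimes> w0 \<otimes> (c \<otimes> c) = inv w0" unfolding c1 c2 .
  then show "inv (c \<otimes> c) \<otimes> u c \<otimes> (c \<otimes> c) = inv (u c)" unfolding w0u .
  let ?i = "c \<otimes> c"
  have ic: "?i \<in> carrier G" using cc by simp
  have "inv ?i \<otimes> inv w0 \<otimes> ?i = inv (inv ?i \<otimes> w0 \<otimes> ?i)" using ic w0c by (simp add: word_simps)
  then have inv2': "inv ?i \<otimes> inv w0 \<otimes> ?i = w0" unfolding inv2 using w0c by simp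
  have "inv (?i \<otimes> ?i) \<otimes> w0 \<otimes> (?i \<otimes> ?i) = inv ?i \<otimes> (inv ?i \<otimes> w0 \<otimes> ?i) \<otimes> ?i" using ic w0c by (simp add: word_simps)
  then have 4: "inv (?i \<otimes> ?i) \<otimes> w0 \<otimes> (?i \<otimes> ?i) = w0" unfolding inv2 inv2' .
  have "w0 \<otimes> (?i \<otimes> ?i) = (?i \<otimes> ?i) \<otimes> (inv (?i \<otimes> ?i) \<otimes> w0 \<otimes> (?i \<otimes> ?i))" using ic w0c by (simp add: word_simps)
  then have w0cent: "w0 \<in> cent (?i \<otimes> ?i)" unfolding 4 using w0c by (simp add: cent_def)
  show "?i \<otimes> ?i = \<one>"
  proof (rule ccontr)
    assume "?i \<otimes> ?i \<noteq> \<one>"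
    then have "u c \<in> A" using cent_A[of "?i \<otimes> ?i" w0] w0cent cA w0u by simp
    then have "c = \<one>" using u_not_A[OF cA] by blast
    then show False using partner(8)[OF a k e az] c by simp
  qed
qed

lemma A_or_inv_P: "a \<in> A \<Longrightarrow> a \<in> P \<or> inv a \<in> P"
  using inv_in_P by blast

text \<open>For \<open>\<gamma> = c\<close> or \<open>\<gamma> = inv c\<close> the element \<open>\<gamma> j\<close> is in \<open>P\<close>, and then the conjugate \<open>w\<close> of
\<open>u \<gamma>\<close> under \<open>j\<close> commutes with \<open>u \<gamma>\<close>.  The product of the two commutes with \<open>j\<close>, so it is in \<open>A\<close>, and it
is inverted by \<open>z\<close>, so it is trivial.  Thus \<open>j\<close> inverts \<open>u \<gamma>\<close> just as \<open>c\<^sup>2\<close> does, and the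
product of \<open>j\<close> and \<open>c\<^sup>2\<close> centralises \<open>u \<gamma>\<close>, which only the identity of \<open>A\<close> does.\<close>

lemma involution_unique:
  assumes c: "c \<in> A" "c \<in> P" "inv c \<in> P" "c \<noteq> \<one>"
    and inverts: "inv (c \<otimes> c) \<otimes> u c \<otimes> (c \<otimes> c) = inv (u c)"
    and j: "j \<in> A" "j \<noteq> \<one>" "j \<otimes> j = \<one>"
  shows "j = c \<otimes> c"
proof -
  let ?i = "c \<otimes> c"
  have car: "c \<in> carrier G" "j \<in> carrier G" "?i \<in> carrier G" using c j by auto
  have ij: "inv j = j" using j car by (simp add: inv_equality)
  have jP: "j \<in> P" using A_or_inv_P[OF j(1)] ij by simp
  have inverts': "inv ?i \<otimes> u (inv c) \<otimes> ?i = inv (u (inv c))"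
  proof -
    have e: "u (inv c) = c \<otimes> inv (u c) \<otimes> inv c" using car by (simp add: u_def zc_def word_simps)
    have "inv ?i \<otimes> u (inv c) \<otimes> ?i = c \<otimes> inv (inv ?i \<otimes> u c \<otimes> ?i) \<otimes> inv c"
      unfolding e using car by (simp add: word_simps)
    also have "\<dots> = inv (u (inv c))" unfolding inverts e using car by (simp add: word_simps)
    finally show ?thesis .
  qed
  have "c \<otimes> j \<in> P \<or> inv (c \<otimes> j) \<in> P" using A_or_inv_P c j by simp
  moreover have "inv (c \<otimes> j) = inv c \<otimes> j" using A_comm[of "inv c" j] c j car ij by (simp add: inv_mult_group)
  ultimately obtain \<gamma> where \<gamma>: "\<gamma> = c \<or> \<gamma> = inv c" "\<gamma> \<otimes> j \<in> P" by auto
  have \<gamma>P: "\<gamma> \<in> P" "\<gamma> \<in> A" "\<gamma> \<noteq> \<one>"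
  proof -
    have "inv c \<noteq> \<one>" using c(4) car by (metis inv_inv inv_one)
    then show "\<gamma> \<in> P" "\<gamma> \<in> A" "\<gamma> \<noteq> \<one>" using \<gamma>(1) c A.m_inv_closed by metis+
  qed
  have \<gamma>c: "\<gamma> \<in> carrier G" using \<gamma>P by auto
  have i\<gamma>: "inv ?i \<otimes> u \<gamma> \<otimes> ?i = inv (u \<gamma>)" using \<gamma>(1) inverts inverts' by blast
  define w where "w = j \<otimes> u \<gamma> \<otimes> j"
  have uc: "u \<gamma> \<in> carrier G" "u j \<in> carrier G" "u (\<gamma> \<otimes> j) \<in> carrier G" using \<gamma>c car by auto
  have wc: "w \<in> carrier G" unfolding w_def using car uc by simp
  have jj: "j \<otimes> (j \<otimes> g) = g" if "g \<in> carrier G" for g using that car j(3) by (simp add: m_assoc[symmetric])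
  have w: "w = u (\<gamma> \<otimes> j) \<otimes> inv (u j)"
    unfolding w_def u_def zc_def using car \<gamma>c by (simp add: word_simps ij jj)
  have "u (\<gamma> \<otimes> j) \<in> cent (u \<gamma>)" "u j \<in> cent (u \<gamma>)" "u (\<gamma> \<otimes> j) \<in> cent (u j)"
    using u_commute \<gamma>P \<gamma>(2) jP uc by (auto simp: cent_def)
  note cents = this
  have w\<gamma>: "w \<otimes> u \<gamma> = u \<gamma> \<otimes> w"
    using cent_mult[OF uc(1) cents(1) cent_inv[OF uc(1) cents(2)]] unfolding w by (simp add: cent_def)
  define v where "v = u \<gamma> \<otimes> w"
  have vc: "v \<in> carrier G" unfolding v_def using uc wc by simp
  have "j \<otimes> v \<otimes> j = (j \<otimes> u \<gamma> \<otimes> j) \<otimes> (j \<otimes> w \<otimes> j)" unfolding v_def using car uc wc by (simp add: m_assoc jj)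
  also have "j \<otimes> w \<otimes> j = u \<gamma>" unfolding w_def using car uc by (simp add: m_assoc jj j(3))
  finally have jvj: "j \<otimes> v \<otimes> j = v" unfolding w_def[symmetric] w\<gamma> v_def .
  have "v \<otimes> j = j \<otimes> (j \<otimes> v \<otimes> j)" using car vc by (simp add: m_assoc jj)
  then have "v \<in> cent j" unfolding jvj using vc by (simp add: cent_def)
  then have vA: "v \<in> A" using cent_A[OF j(1,2)] by blast
  have zw: "z \<otimes> w \<otimes> z = inv w"
  proof -
    have wj: "u (\<gamma> \<otimes> j) \<otimes> inv (u j) = inv (u j) \<otimes> u (\<gamma> \<otimes> j)"
    proof -
      have "inv (u j) \<in> cent (u (\<gamma> \<otimes> j))" using cent_inv[OF uc(3) cent_sym[OF uc(2) cents(3)]] .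
      then show ?thesis by (simp add: cent_def)
    qed
    have "z \<otimes> w \<otimes> z = (z \<otimes> u (\<gamma> \<otimes> j) \<otimes> z) \<otimes> inv (z \<otimes> u j \<otimes> z)" unfolding w using uc by (simp add: word_simps)
    also have "\<dots> = inv (u (\<gamma> \<otimes> j)) \<otimes> u j"
      using z_inverts_u[of "\<gamma> \<otimes> j"] z_inverts_u[of j] \<gamma>c car by simp
    also have "\<dots> = inv (inv (u j) \<otimes> u (\<gamma> \<otimes> j))" using uc by (simp add: inv_mult_group)
    finally show ?thesis unfolding w wj .
  qed
  have "z \<otimes> v \<otimes> z = (z \<otimes> u \<gamma> \<otimes> z) \<otimes> (z \<otimes> w \<otimes> z)" unfolding v_def using uc wc by (simp add: m_assoc)
  also have "\<dots> = inv (w \<otimes> u \<gamma>)" unfolding zw z_inverts_u[OF \<gamma>c] using uc wc by (simp add: inv_mult_group)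
  finally have "z \<otimes> v \<otimes> z = inv v" unfolding w\<gamma> v_def .
  then have "v = \<one>" using A_conj_z[OF vA] vA by simp
  then have "w \<otimes> u \<gamma> = \<one>" unfolding v_def w\<gamma> .
  then have w1: "w = inv (u \<gamma>)" using uc wc by (simp add: inv_equality)
  have "inv (?i \<otimes> j) \<otimes> u \<gamma> \<otimes> (?i \<otimes> j) = j \<otimes> (inv ?i \<otimes> u \<gamma> \<otimes> ?i) \<otimes> j" using car uc by (simp add: inv_mult_group ij m_assoc)
  also have "\<dots> = inv (j \<otimes> u \<gamma> \<otimes> j)" unfolding i\<gamma> using car uc by (simp add: inv_mult_group ij m_assoc)
  also have "\<dots> = u \<gamma>" unfolding w_def[symmetric] w1 using uc by simp
  finally have fixed: "inv (?i \<otimes> j) \<otimes> u \<gamma> \<otimes> (?i \<otimes> j) = u \<gamma>" .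
  have "u \<gamma> \<otimes> (?i \<otimes> j) = (?i \<otimes> j) \<otimes> (inv (?i \<otimes> j) \<otimes> u \<gamma> \<otimes> (?i \<otimes> j))" using car uc by (simp add: word_simps)
  then have cen: "u \<gamma> \<in> cent (?i \<otimes> j)" unfolding fixed using uc by (simp add: cent_def)
  have "?i \<otimes> j = \<one>"
  proof (rule ccontr)
    assume "?i \<otimes> j \<noteq> \<one>"
    then have "u \<gamma> \<in> A" using cent_A[OF _ _ cen] c j by simp
    then show False using u_not_A[OF \<gamma>P(2)] \<gamma>P(3) by blast
  qed
  then have "?i \<otimes> j \<otimes> j = j" using car by simp
  then show ?thesis using car j(3) by (simp add: m_assoc)
qed

end

section \<open>The quaternion case: conclusion\<close>

context quaternion_product
begin

text \<open>All elements \<open>c\<close> arising from elements outside \<open>P\<close> have the same square, the only involution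
of \<open>A\<close>.  So there are at most two of them, and \<open>c\<close> determines the element of \<open>A\<close> it comes from.\<close>

lemma finite_not_P: "finite (A - P)"
proof (cases "A - P = {}")
  case True
  show ?thesis unfolding True by (rule finite.emptyI)
next
  case False
  have data: "\<exists>c\<in>A. c \<in> P \<and> inv c \<in> P \<and> c \<noteq> \<one> \<and> c \<otimes> c \<otimes> (c \<otimes> c) = \<one> \<and>
      inv (c \<otimes> c) \<otimes> u c \<otimes> (c \<otimes> c) = inv (u c) \<and> zc a = (z \<otimes> c) \<otimes> (z \<otimes> c)" if a: "a \<in> A - P" for a
  proof -
    have aA: "a \<in> A" and aP: "a \<notin> P" using a by auto
    obtain k e where k: "k \<in> Y" "e \<in> A" "a \<otimes> z = k \<otimes> e" using partner_exists[OF aA aP] by blast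
    let ?c = "a \<otimes> inv e"
    have "?c \<in> A" using aA k(2) by simp
    then show ?thesis
      using ratio_in_P[OF aA k] inv_ratio_in_P[OF aA k] partner(8)[OF aA k]
        ratio_order[OF aA k refl] partner(4)[OF aA k] by (intro bexI[of _ ?c]) simp_all
  qed
  have square_ne: "c \<otimes> c \<noteq> \<one>"
    if c: "c \<in> A" "c \<noteq> \<one>" "inv (c \<otimes> c) \<otimes> u c \<otimes> (c \<otimes> c) = inv (u c)" for c
  proof
    assume "c \<otimes> c = \<one>"
    then have "u c = inv (u c)" using c by simp
    then have "u c \<otimes> u c = \<one>" using c(1) by (metis A.mem_carrier r_inv u_carrier)
    then show False using u_square[OF c(1)] c(2) by blast
  qed
  obtain a where "a \<in> A - P" using False by blast
  then obtain c where c: "c \<in> A" "c \<in> P" "inv c \<in> P" "c \<noteq> \<one>"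
      "inv (c \<otimes> c) \<otimes> u c \<otimes> (c \<otimes> c) = inv (u c)" using data by blast
  define S where "S = {c, (c \<otimes> c) \<otimes> c}"
  have "zc ` (A - P) \<subseteq> (\<lambda>c. (z \<otimes> c) \<otimes> (z \<otimes> c)) ` S"
  proof
    fix d assume "d \<in> zc ` (A - P)"
    then obtain a' where a': "a' \<in> A - P" "d = zc a'" by blast
    obtain c' where c': "c' \<in> A" "c' \<noteq> \<one>" "c' \<otimes> c' \<otimes> (c' \<otimes> c') = \<one>"
      "inv (c' \<otimes> c') \<otimes> u c' \<otimes> (c' \<otimes> c') = inv (u c')" "zc a' = (z \<otimes> c') \<otimes> (z \<otimes> c')" using data[OF a'(1)] by blast
    have cc: "c' \<otimes> c' = c \<otimes> c"
      using involution_unique[OF c, of "c' \<otimes> c'"] square_ne[OF c'(1,2,4)] c'(1,3) by simp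
    let ?j = "c' \<otimes> inv c"
    have j: "?j \<in> A" using c(1) c'(1) by simp
    have "?j \<otimes> ?j = c' \<otimes> (inv c \<otimes> c') \<otimes> inv c" using c(1) c'(1) by (simp add: m_assoc)
    also have "inv c \<otimes> c' = c' \<otimes> inv c" using A_comm c(1) c'(1) by simp
    also have "c' \<otimes> (c' \<otimes> inv c) \<otimes> inv c = (c' \<otimes> c') \<otimes> inv (c \<otimes> c)" using c(1) c'(1) by (simp add: word_simps)
    also have "\<dots> = \<one>" unfolding cc using c(1) by simp
    finally have "?j = \<one> \<or> ?j = c \<otimes> c" using involution_unique[OF c j] by blast
    moreover have "c' = ?j \<otimes> c" using c(1) c'(1) by (simp add: m_assoc)
    ultimately have "c' = \<one> \<otimes> c \<or> c' = (c \<otimes> c) \<otimes> c" by metis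
    then have "c' \<in> S" unfolding S_def using c(1) by auto
    then show "d \<in> (\<lambda>c. (z \<otimes> c) \<otimes> (z \<otimes> c)) ` S" using a'(2) c'(5) by blast
  qed
  then have "finite (zc ` (A - P))" using finite_subset[of "zc ` (A - P)"] S_def by blast
  moreover have "inj_on zc (A - P)" using A_zc_inj by (intro inj_onI) blast
  ultimately show ?thesis using finite_imageD by blast
qed

text \<open>Whether the products of three conjugates of \<open>z\<close> commute does not change when the three are
conjugated by some \<open>g \<in> A\<close>.  As \<open>A\<close> is infinite and nearly all of it is in \<open>P\<close>, the
elements 1, \<open>a\<close>, \<open>b\<close> can be moved into \<open>P\<close> by a common \<open>g\<close>.\<close>

lemma u_commute_all:
  assumes a: "a \<in> A" and b: "b \<in> A"
  shows "u a \<otimes> u b = u b \<otimes> u a"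
proof -
  have fin: "finite {g \<in> A. s \<otimes> g \<notin> P}" if s: "s \<in> A" for s
  proof -
    have "{g \<in> A. s \<otimes> g \<notin> P} \<subseteq> (\<lambda>g. s \<otimes> g) -` (A - P) \<inter> A" using s by auto
    moreover have "inj_on (\<lambda>g. s \<otimes> g) A" using s by (auto simp: inj_on_def)
    ultimately show ?thesis using finite_vimage_IntI[OF finite_not_P] finite_subset by blast
  qed
  have inf: "infinite (A - ({g \<in> A. \<one> \<otimes> g \<notin> P} \<union> {g \<in> A. a \<otimes> g \<notin> P} \<union> {g \<in> A. b \<otimes> g \<notin> P}))"
    using infinite_A fin[OF A.one_closed] fin[OF a] fin[OF b] by simp
  obtain g where "g \<in> A - ({g \<in> A. \<one> \<otimes> g \<notin> P} \<union> {g \<in> A. a \<otimes> g \<notin> P} \<union> {g \<in> A. b \<otimes> g \<notin> P})"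
    using infinite_imp_nonempty[OF inf] by blast
  then have g: "g \<in> A" "\<one> \<otimes> g \<in> P" "a \<otimes> g \<in> P" "b \<otimes> g \<in> P" by auto
  have gP: "g \<in> P" using g by simp
  have car: "a \<in> carrier G" "b \<in> carrier G" "g \<in> carrier G" using a b g by auto
  have shift: "inv (inv g) \<otimes> (u (s \<otimes> g) \<otimes> inv (u g)) \<otimes> inv g = u s" if "s \<in> carrier G" for s
    using that car unfolding u_def zc_def by (simp add: word_simps)
  define p q where "p = u (a \<otimes> g) \<otimes> inv (u g)" and "q = u (b \<otimes> g) \<otimes> inv (u g)"
  have pq: "p \<in> carrier G" "q \<in> carrier G" unfolding p_def q_def using car by auto
  have 1: "u (a \<otimes> g) \<in> cent (u (b \<otimes> g))" "u g \<in> cent (u (b \<otimes> g))" "u (a \<otimes> g) \<in> cent (u g)"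
    using u_commute g gP car by (auto simp: cent_def)
  have uc: "u (b \<otimes> g) \<in> carrier G" "u g \<in> carrier G" using car by auto
  have p1: "p \<in> cent (u (b \<otimes> g))" unfolding p_def by (rule cent_mult[OF uc(1) 1(1) cent_inv[OF uc(1) 1(2)]])
  have p2: "p \<in> cent (u g)" unfolding p_def by (rule cent_mult[OF uc(2) 1(3) cent_inv[OF uc(2) cent_self[OF uc(2)]]])
  have "q \<in> cent p" unfolding q_def
    by (rule cent_mult[OF pq(1) cent_sym[OF uc(1) p1] cent_inv[OF pq(1) cent_sym[OF uc(2) p2]]])
  then have "inv (inv g) \<otimes> q \<otimes> inv g \<in> cent (inv (inv g) \<otimes> p \<otimes> inv g)"
    by (rule cent_conj[OF pq(1) inv_closed[OF car(3)]])
  then have "u b \<in> cent (u a)" unfolding p_def q_def shift[OF car(1)] shift[OF car(2)] .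
  then show ?thesis by (simp add: cent_def)
qed

lemma zc_products_normal_abelian:
  defines "S \<equiv> {zc g \<otimes> zc h | g h. g \<in> carrier G \<and> h \<in> carrier G}"
  shows "generate G S \<lhd> G"
    and "\<And>s t. s \<in> generate G S \<Longrightarrow> t \<in> generate G S \<Longrightarrow> s \<otimes> t = t \<otimes> s"
proof -
  have S_car: "S \<subseteq> carrier G" unfolding S_def by auto
  show "generate G S \<lhd> G"
  proof (rule normal_generateI[OF S_car])
    fix s g assume s: "s \<in> S" and g: "g \<in> carrier G"
    obtain h h' where h: "h \<in> carrier G" "h' \<in> carrier G" "s = zc h \<otimes> zc h'" using s unfolding S_def by blast
    have "g \<otimes> s \<otimes> inv g = zc (h \<otimes> inv g) \<otimes> zc (h' \<otimes> inv g)"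
      unfolding h(3) zc_def using g h by (simp add: word_simps)
    moreover have "h \<otimes> inv g \<in> carrier G" "h' \<otimes> inv g \<in> carrier G" using g h by auto
    ultimately show "g \<otimes> s \<otimes> inv g \<in> S" unfolding S_def by blast
  qed
  have form: "\<exists>a\<in>A. \<exists>b\<in>A. s = u a \<otimes> inv (u b)" if s: "s \<in> S" for s
  proof -
    obtain h h' where h: "h \<in> carrier G" "h' \<in> carrier G" "s = zc h \<otimes> zc h'" using s unfolding S_def by blast
    obtain a where a: "a \<in> A" "zc h = zc a" using zc_A[OF h(1)] by blast
    obtain b where b: "b \<in> A" "zc h' = zc b" using zc_A[OF h(2)] by blast
    have "s = u a \<otimes> inv (u b)" using a b unfolding h(3) by (simp add: u_inverse) (simp add: u_def m_assoc)
    then show ?thesis using a b by blast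
  qed
  have "s \<otimes> t = t \<otimes> s" if "s \<in> S" "t \<in> S" for s t
  proof -
    obtain a b where ab: "a \<in> A" "b \<in> A" "s = u a \<otimes> inv (u b)" using form \<open>s \<in> S\<close> by blast
    obtain c d where cd: "c \<in> A" "d \<in> A" "t = u c \<otimes> inv (u d)" using form \<open>t \<in> S\<close> by blast
    have uu: "u p \<in> cent (u q)" if "p \<in> A" "q \<in> A" for p q using u_commute_all that by (simp add: cent_def)
    have uc: "u p \<in> carrier G" if "p \<in> A" for p using that by simp
    have tc: "t \<in> carrier G" unfolding cd(3) using uc cd by simp
    have "t \<in> cent (u p)" if p: "p \<in> A" for p unfolding cd(3)
      by (rule cent_mult[OF uc[OF p] uu[OF cd(1) p] cent_inv[OF uc[OF p] uu[OF cd(2) p]]])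
    then have "u p \<in> cent t" if "p \<in> A" for p using cent_sym[OF uc[OF that]] that by blast
    then have "s \<in> cent t" unfolding ab(3) using cent_mult[OF tc] cent_inv[OF tc] ab(1,2) by blast
    then show ?thesis by (simp add: cent_def)
  qed
  then show "\<And>s t. s \<in> generate G S \<Longrightarrow> t \<in> generate G S \<Longrightarrow> s \<otimes> t = t \<otimes> s"
    using abelian_generate[OF S_car] by blast
qed

end

section \<open>Solubility of the product\<close>

context abelian_dihedral_product
begin

text \<open>The extra clause about \<open>y\<close> keeps the dihedral type: the reduction never turns it into the
quaternion type.\<close>

lemma reduce_to_irreducible:
  assumes step: "\<And>(Q :: 'a set monoid) A' X' y' z'. irreducible_product Q A' X' y' z' \<Longrightarrow>
      (y \<otimes> y = \<one> \<Longrightarrow> y' \<otimes>\<^bsub>Q\<^esub> y' = \<one>\<^bsub>Q\<^esub>) \<Longrightarrow> solvable Q"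
  shows "solvable G"
proof -
  obtain H where H: "factorised H" and max: "\<And>F. factorised F \<Longrightarrow> H \<subseteq> F \<Longrightarrow> F = H"
    using exists_maximal_factorised by blast
  have Hn: "H \<lhd> G" using H unfolding factorised_def by blast
  interpret H: normal H G by fact
  interpret Q: abelian_dihedral_product "G Mod H" "(#>) H ` A" "(#>) H ` X" "H #> y"
    by (rule quotient[OF Hn])
  have "solvable (G Mod H)"
  proof (cases "(#>) H ` X = {\<one>\<^bsub>G Mod H\<^esub>}")
    case True
    then show ?thesis by (rule Q.trivial_X_solvable)
  next
    case False
    then obtain z where inv: "abelian_dihedral_product_inv (G Mod H) ((#>) H ` A) ((#>) H ` X) (H #> y) z"
      by (rule Q.obtain_involution)
    have "irreducible_product (G Mod H) ((#>) H ` A) ((#>) H ` X) (H #> y) z"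
      by (rule irreducible_product.intro[OF inv irreducible_product_axioms.intro[OF maximal_quotient[OF H max]]])
    moreover have "(H #> y) \<otimes>\<^bsub>G Mod H\<^esub> (H #> y) = \<one>\<^bsub>G Mod H\<^esub>" if 1: "y \<otimes> y = \<one>"
      using H.rcos_sum[OF y_carrier y_carrier] coset_mult_one[OF H.subset] by (simp add: 1)
    ultimately show ?thesis by (rule step)
  qed
  then show ?thesis by (rule solvable_if_quotient[OF H])
qed

end

lemma (in irreducible_product) dihedral_case:
  assumes "y \<otimes> y = \<one>"
  shows "solvable G"
proof (rule ccontr)
  assume "\<not> solvable G"
  then have "z \<notin> K" using solvable_or_z_notin_K by simp
  then have "nondegenerate_product G A X y z"
    by (intro nondegenerate_product.intro nondegenerate_product_axioms.intro irreducible_product_axioms)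
  then have "dihedral_product G A X y z"
    using assms by (intro dihedral_product.intro dihedral_product_axioms.intro)
  then show False by (rule dihedral_product.no_dihedral_product)
qed

context abelian_dihedral_product
begin

theorem dihedral_solvable:
  assumes "y \<otimes> y = \<one>"
  shows "solvable G"
proof (rule reduce_to_irreducible)
  fix Q :: "'a set monoid" and A' X' y' z'
  assume irr: "irreducible_product Q A' X' y' z'" and "y \<otimes> y = \<one> \<Longrightarrow> y' \<otimes>\<^bsub>Q\<^esub> y' = \<one>\<^bsub>Q\<^esub>"
  then have "y' \<otimes>\<^bsub>Q\<^esub> y' = \<one>\<^bsub>Q\<^esub>" using assms by blast
  then show "solvable Q" by (rule irreducible_product.dihedral_case[OF irr])
qed

lemma central_involution_solvable:
  assumes z: "z \<in> X" "z \<otimes> z = \<one>" and central: "\<And>g. g \<in> carrier G \<Longrightarrow> g \<otimes> z = z \<otimes> g"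
    and y: "y \<otimes> y = z"
  shows "solvable G"
proof -
  have zc: "z \<in> carrier G" using z by simp
  have zi: "inv z = z" using z zc by (simp add: inv_equality)
  have N: "{\<one>, z} \<lhd> G" unfolding normal_inv_iff
  proof (intro conjI ballI)
    show "subgroup {\<one>, z} G" by (rule subgroupI) (use zc zi z in auto)
    fix g h assume g: "g \<in> carrier G" and h: "h \<in> {\<one>, z}"
    have "g \<otimes> z \<otimes> inv g = z" unfolding central[OF g] using g zc by (simp add: m_assoc)
    then show "g \<otimes> h \<otimes> inv g \<in> {\<one>, z}" using g h by auto
  qed
  interpret N: normal "{\<one>, z}" G by (rule N)
  interpret Q: abelian_dihedral_product "G Mod {\<one>, z}" "(#>) {\<one>, z} ` A" "(#>) {\<one>, z} ` X" "{\<one>, z} #> y"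
    by (rule quotient[OF N])
  have "({\<one>, z} #> y) \<otimes>\<^bsub>G Mod {\<one>, z}\<^esub> ({\<one>, z} #> y) = {\<one>, z} #> z"
    using N.rcos_sum[OF y_carrier y_carrier] by (simp add: y)
  also have "\<dots> = \<one>\<^bsub>G Mod {\<one>, z}\<^esub>" using coset_join2[OF zc N.subgroup_axioms] by simp
  finally have sol: "solvable (G Mod {\<one>, z})" by (rule Q.dihedral_solvable)
  have "x \<otimes> w = w \<otimes> x" if "x \<in> {\<one>, z}" "w \<in> {\<one>, z}" for x w using that zc by auto
  then show ?thesis using solvable_abelian_extension[OF N _ sol] by blast
qed

end

text \<open>Modulo the abelian normal subgroup generated by the products of two conjugates of \<open>z\<close>, the element
\<open>z\<close> is central; and modulo \<open>z\<close> the quaternion type becomes dihedral.\<close>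

lemma (in quaternion_product) quaternion_solvable: "solvable G"
proof -
  define S where "S = {zc g \<otimes> zc h | g h. g \<in> carrier G \<and> h \<in> carrier G}"
  define L where "L = generate G S"
  have L: "L \<lhd> G" using zc_products_normal_abelian(1) unfolding L_def S_def .
  have ab: "s \<otimes> t = t \<otimes> s" if "s \<in> L" "t \<in> L" for s t
    using zc_products_normal_abelian(2) that unfolding L_def S_def .
  interpret L: normal L G by (rule L)
  interpret Q: abelian_dihedral_product "G Mod L" "(#>) L ` A" "(#>) L ` X" "L #> y"
    by (rule quotient[OF L])
  have hom: "(L #> g) \<otimes>\<^bsub>G Mod L\<^esub> (L #> h) = L #> (g \<otimes> h)" if "g \<in> carrier G" "h \<in> carrier G" for g h
    using L.rcos_sum[OF that] by simp
  have sol: "solvable (G Mod L)"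
  proof (rule Q.central_involution_solvable)
    show "L #> z \<in> (#>) L ` X" using z_X by blast
    show "(L #> z) \<otimes>\<^bsub>G Mod L\<^esub> (L #> z) = \<one>\<^bsub>G Mod L\<^esub>"
      unfolding hom[OF z_carrier z_carrier] z_sq using coset_mult_one[OF L.subset] by simp
    show "(L #> y) \<otimes>\<^bsub>G Mod L\<^esub> (L #> y) = L #> z"
      unfolding hom[OF y_carrier y_carrier] y_square_z ..
    fix U assume "U \<in> carrier (G Mod L)"
    then obtain g where g: "g \<in> carrier G" "U = L #> g" unfolding carrier_FactGroup by blast
    define l where "l = zc (inv g) \<otimes> zc \<one>"
    have lL: "l \<in> L" unfolding L_def l_def S_def using g(1) by (intro generate.incl) blast
    have lc: "l \<in> carrier G" using lL by (rule L.mem_carrier)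
    have "g \<otimes> z = l \<otimes> (z \<otimes> g)" unfolding l_def zc_def using g by (simp add: word_simps)
    then have "L #> (g \<otimes> z) = L #> l #> (z \<otimes> g)" using coset_mult_assoc[OF L.subset lc, of "z \<otimes> g"] g by simp
    also have "L #> l = L" by (rule coset_join2[OF lc L.subgroup_axioms lL])
    finally show "U \<otimes>\<^bsub>G Mod L\<^esub> (L #> z) = (L #> z) \<otimes>\<^bsub>G Mod L\<^esub> U"
      unfolding g(2) hom[OF g(1) z_carrier] hom[OF z_carrier g(1)] .
  qed
  show ?thesis using solvable_abelian_extension[OF L _ sol] ab by blast
qed

lemma (in irreducible_product) irreducible_solvable: "solvable G"
proof (rule ccontr)
  assume ns: "\<not> solvable G"
  then have "z \<notin> K" using solvable_or_z_notin_K by simp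
  then have nd: "nondegenerate_product G A X y z"
    by (intro nondegenerate_product.intro nondegenerate_product_axioms.intro irreducible_product_axioms)
  have "y \<otimes> y \<noteq> \<one>" using dihedral_case ns by blast
  then have "y \<otimes> y = z" using X_involution[OF y_square y_square_inverse] by blast
  then have "quaternion_product G A X y z"
    by (intro quaternion_product.intro quaternion_product_axioms.intro nd)
  then have "solvable G" by (rule quaternion_product.quaternion_solvable)
  then show False using ns by simp
qed

theorem (in abelian_dihedral_product) product_solvable: "solvable G"
  by (rule reduce_to_irreducible, erule irreducible_product.irreducible_solvable)

section \<open>Locally quaternion groups\<close>

text \<open>By induction, \<open>z\<^sup>2\<close> is a power of \<open>w\<^sup>2\<close>; this gives \<open>z\<close> up to sign, and the sign is a power of \<open>w\<close>.\<close>

lemma root_of_unity_power: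
  fixes w z :: complex
  assumes "w ^ (2 ^ n) = -1" "z ^ (2 ^ Suc n) = 1"
  shows "\<exists>i. z = w ^ i"
  using assms
proof (induction n arbitrary: w z)
  case 0
  then have "w = -1" "z\<^sup>2 = 1" by auto
  then have "z = w ^ 0 \<or> z = w ^ 1" by (auto simp: power2_eq_1_iff)
  then show ?case by blast
next
  case (Suc n)
  have "(w\<^sup>2) ^ (2 ^ n) = -1" "(z\<^sup>2) ^ (2 ^ Suc n) = 1"
    using Suc.prems by (simp_all flip: power_mult)
  then obtain i where "z\<^sup>2 = (w\<^sup>2) ^ i" using Suc.IH by blast
  then have "z\<^sup>2 = (w ^ i)\<^sup>2" by (simp add: power_mult[symmetric] mult.commute)
  then have "z = w ^ i \<or> z = - (w ^ i)" by (simp add: power2_eq_iff)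
  moreover have "- (w ^ i) = w ^ (i + 2 ^ Suc n)" using Suc.prems(1) by (simp add: power_add)
  ultimately show ?case by metis
qed

lemma quasicyclic_pow:
  fixes n :: nat
  shows "w [^]\<^bsub>quasicyclic_group p\<^esub> n = w ^ n"
  by (induction n) (auto simp: quasicyclic_group_def nat_pow_def)

text \<open>Of two roots of unity of 2-power order, the one of larger order has \<open>-1\<close> as a suitable power, and
\<open>root_of_unity_power\<close> applies.\<close>

lemma quasicyclic_chain:
  assumes "w \<in> carrier (quasicyclic_group 2)" "z \<in> carrier (quasicyclic_group 2)"
  shows "(\<exists>n::nat. w = z ^ n) \<or> (\<exists>n::nat. z = w ^ n)"
proof -
  have level: "\<exists>n. z ^ (2 ^ n) = 1 \<and> (n = 0 \<or> z ^ (2 ^ (n - 1)) = -1)"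
    if "z \<in> carrier (quasicyclic_group 2)" for z
  proof -
    define n where "n = (LEAST n. z ^ (2 ^ n) = 1)"
    have ex: "\<exists>n. z ^ (2 ^ n) = 1" using that by (simp add: quasicyclic_group_def)
    have n: "z ^ (2 ^ n) = 1" unfolding n_def by (rule LeastI_ex[OF ex])
    have "z ^ (2 ^ (n - 1)) = -1" if "n \<noteq> 0"
    proof -
      have "z ^ (2 ^ (n - 1)) \<noteq> 1" using not_less_Least[of "n - 1" "\<lambda>n. z ^ (2 ^ n) = 1"] that unfolding n_def by simp
      moreover have "(2::nat) ^ n = 2 ^ (n - 1) * 2" using that by (metis power_minus_mult neq0_conv)
      then have "(z ^ (2 ^ (n - 1)))\<^sup>2 = 1" using n by (simp add: power_mult)
      ultimately show ?thesis by (simp add: power2_eq_1_iff)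
    qed
    then show ?thesis using n by (intro exI[of _ n]) auto
  qed
  have main: "\<exists>i. z = w ^ i"
    if "z ^ (2 ^ m) = 1" "w ^ (2 ^ n) = 1" "n = 0 \<or> w ^ (2 ^ (n - 1)) = -1" "m \<le> n" for z w :: complex and m n
  proof (cases n)
    case 0
    then have "z = w ^ 0" using that by simp
    then show ?thesis by blast
  next
    case (Suc k)
    have "z ^ (2 ^ n) = (z ^ (2 ^ m)) ^ (2 ^ (n - m))" using that(4) by (simp flip: power_mult power_add)
    then have "z ^ (2 ^ n) = 1" using that(1) by simp
    then show ?thesis using root_of_unity_power[of w k z] that(3) Suc by simp
  qed
  obtain m where m: "w ^ (2 ^ m) = 1" "m = 0 \<or> w ^ (2 ^ (m - 1)) = -1" using level[OF assms(1)] by blast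
  obtain n where n: "z ^ (2 ^ n) = 1" "n = 0 \<or> z ^ (2 ^ (n - 1)) = -1" using level[OF assms(2)] by blast
  show ?thesis
  proof (cases "m \<le> n")
    case True
    then show ?thesis using main[OF m(1) n] by blast
  next
    case False
    then show ?thesis using main[OF n(1) m] by simp
  qed
qed

lemma quasicyclic_sqrt:
  assumes "w \<in> carrier (quasicyclic_group 2)"
  shows "\<exists>v\<in>carrier (quasicyclic_group 2). v * v = w"
proof -
  obtain n where n: "w ^ (2 ^ n) = 1" using assms by (auto simp: quasicyclic_group_def)
  have sq: "csqrt w * csqrt w = w" by (metis power2_csqrt power2_eq_square)
  have "csqrt w ^ (2 ^ Suc n) = (csqrt w * csqrt w) ^ (2 ^ n)" by (simp add: power_mult power2_eq_square)
  also have "\<dots> = 1" unfolding sq by (rule n)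
  finally have "csqrt w ^ (2 ^ Suc n) = 1" .
  then have "csqrt w \<in> carrier (quasicyclic_group 2)" unfolding quasicyclic_group_def by (simp del: power_Suc) blast
  then show ?thesis using sq by blast
qed

lemma (in group) abelian_dihedral_productI:
  assumes A: "subgroup A G" and B: "subgroup B G" and AB: "carrier G = A <#> B"
    and A_comm: "comm_group (G\<lparr>carrier := A\<rparr>)" and lq: "locally_quaternion (G\<lparr>carrier := B\<rparr>)"
  shows "\<exists>X y. abelian_dihedral_product G A X y"
proof -
  let ?GB = "G\<lparr>carrier := B\<rparr>"
  obtain X y where X: "subgroup X ?GB" and iso: "?GB\<lparr>carrier := X\<rparr> \<cong> quasicyclic_group 2"
    and y: "y \<in> B" and y2: "y [^]\<^bsub>?GB\<^esub> (2::nat) \<in> X"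
    and inverts: "\<And>x. x \<in> X \<Longrightarrow> inv\<^bsub>?GB\<^esub> y \<otimes> x \<otimes> y = inv\<^bsub>?GB\<^esub> x"
    and gen: "B = X <#> generate ?GB {y}"
    using lq unfolding locally_quaternion_def by (auto simp: set_mult_def)
  have XG: "subgroup X G" using incl_subgroup[OF B X] .
  interpret A: subgroup A G by (rule A)
  interpret B: subgroup B G by (rule B)
  interpret X: subgroup X G by (rule XG)
  have XB: "X \<subseteq> B" using subgroup.subset[OF X] by simp
  have yc: "y \<in> carrier G" using y by simp
  have inverts': "x \<otimes> y = y \<otimes> inv x" if x: "x \<in> X" for x
  proof -
    have xc: "x \<in> carrier G" using x by simp
    have "inv y \<otimes> x \<otimes> y = inv x"
      using inverts[OF x] m_inv_consistent[OF B] x y XB by (metis subsetD)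
    then have "y \<otimes> (inv y \<otimes> x \<otimes> y) = y \<otimes> inv x" by simp
    then show ?thesis using xc yc by (simp add: word_simps)
  qed
  have yy: "y \<otimes> y \<in> X"
  proof -
    have "y [^] (2::nat) \<in> X" using y2 by (simp add: nat_pow_consistent[symmetric])
    then show ?thesis using yc by (simp add: numeral_2_eq_2)
  qed
  have yx: "y \<otimes> x = inv x \<otimes> y" if "x \<in> X" for x
    using inverts'[OF X.m_inv_closed[OF that]] that by simp
  have gen_y: "\<exists>x\<in>X. h = x \<or> h = x \<otimes> y" if "h \<in> generate G {y}" for h
    using that
  proof (induction rule: generate.induct)
    case one
    show ?case using X.one_closed by blast
  next
    case (incl h)
    then have "h = \<one> \<otimes> y" using yc by simp
    then show ?case using X.one_closed by blast
  next
    case (inv h)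
    then have "inv h = inv (y \<otimes> y) \<otimes> y" using yc by (simp add: word_simps)
    then show ?case using X.m_inv_closed[OF yy] by blast
  next
    case (eng g h)
    obtain x where x: "x \<in> X" "g = x \<or> g = x \<otimes> y" using eng.IH(1) by blast
    obtain w where w: "w \<in> X" "h = w \<or> h = w \<otimes> y" using eng.IH(2) by blast
    have c: "x \<in> carrier G" "w \<in> carrier G" using x w by auto
    have 1: "x \<otimes> (w \<otimes> y) = (x \<otimes> w) \<otimes> y" using c yc by (simp add: m_assoc)
    have "(x \<otimes> y) \<otimes> w = x \<otimes> (y \<otimes> w)" using c yc by (simp add: m_assoc)
    then have 2: "(x \<otimes> y) \<otimes> w = (x \<otimes> inv w) \<otimes> y" unfolding yx[OF w(1)] using c yc by (simp add: m_assoc)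
    have "(x \<otimes> y) \<otimes> (w \<otimes> y) = ((x \<otimes> y) \<otimes> w) \<otimes> y" using c yc by (simp add: m_assoc)
    then have 3: "(x \<otimes> y) \<otimes> (w \<otimes> y) = (x \<otimes> inv w) \<otimes> (y \<otimes> y)" unfolding 2 using c yc by (simp add: m_assoc)
    have m: "x \<otimes> w \<in> X" "x \<otimes> inv w \<in> X" "(x \<otimes> inv w) \<otimes> (y \<otimes> y) \<in> X" using x(1) w(1) yy by auto
    show ?case using x(2) w(2)
    proof (elim disjE)
      assume "g = x" "h = w" then show ?thesis using m(1) by blast
    next
      assume "g = x" "h = w \<otimes> y" then show ?thesis using 1 m(1) by auto
    next
      assume "g = x \<otimes> y" "h = w" then show ?thesis using 2 m(2) by auto
    next
      assume "g = x \<otimes> y" "h = w \<otimes> y" then show ?thesis using 3 m(3) by auto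
    qed
  qed
  let ?GX = "G\<lparr>carrier := X\<rparr>"
  obtain \<phi> where \<phi>: "\<phi> \<in> iso ?GX (quasicyclic_group 2)" using iso by (auto simp: is_iso_def)
  interpret Q: comm_group "quasicyclic_group 2" by (rule comm_group_quasicyclic_group) simp
  interpret \<phi>: group_hom ?GX "quasicyclic_group 2" \<phi>
    using \<phi> by (intro group_hom.intro group_hom_axioms.intro subgroup_imp_group[OF XG] Q.is_group) (simp add: iso_def)
  have bij: "bij_betw \<phi> X (carrier (quasicyclic_group 2))" using \<phi> by (auto simp: iso_def)
  have mult: "\<phi> (x \<otimes> w) = \<phi> x * \<phi> w" if "x \<in> X" "w \<in> X" for x w
    using \<phi>.hom_mult that by (simp add: quasicyclic_group_def)
  have pow: "\<phi> (x [^] n) = \<phi> x ^ n" if "x \<in> X" for x and n :: nat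
    using \<phi>.hom_nat_pow[of x n] that by (simp add: quasicyclic_pow nat_pow_consistent[symmetric])
  have inj: "x = w" if "\<phi> x = \<phi> w" "x \<in> X" "w \<in> X" for x w
    using bij that by (auto simp: bij_betw_def dest: inj_onD)
  have img: "\<phi> x \<in> carrier (quasicyclic_group 2)" if "x \<in> X" for x
    using bij that by (auto simp: bij_betw_def)
  have X_pow: "x [^] (n::nat) \<in> X" if "x \<in> X" for x n using subgroup_pow_closed[OF XG that] .
  have "abelian_dihedral_product G A X y"
  proof (intro abelian_dihedral_product.intro abelian_dihedral_product_axioms.intro is_group A XG yc yy inverts')
    show "a \<otimes> a' = a' \<otimes> a" if "a \<in> A" "a' \<in> A" for a a'
      using comm_monoid.m_comm[OF comm_group.axioms(1)[OF A_comm], of a a'] that by simp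
    fix x assume x: "x \<in> X"
    show "\<exists>w\<in>X. w \<otimes> w = x"
    proof -
      obtain v where v: "v \<in> carrier (quasicyclic_group 2)" "v * v = \<phi> x" using quasicyclic_sqrt[OF img[OF x]] by blast
      have "v \<in> \<phi> ` X" using bij v(1) unfolding bij_betw_def by simp
      then obtain w where w: "w \<in> X" "\<phi> w = v" by blast
      then have "w \<otimes> w = x" using inj[of "w \<otimes> w" x] mult v(2) x by simp
      then show ?thesis using w(1) by blast
    qed
    show "\<exists>n::nat. x [^] ((2::nat) ^ n) = \<one>"
    proof -
      obtain n where "\<phi> x ^ (2 ^ n) = 1" using img[OF x] by (auto simp: quasicyclic_group_def)
      then have "\<phi> (x [^] ((2::nat) ^ n)) = \<phi> \<one>" using pow[OF x] \<phi>.hom_one by (simp add: quasicyclic_group_def)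
      then show ?thesis using inj X_pow[OF x] X.one_closed by blast
    qed
    fix w assume w: "w \<in> X"
    have "\<phi> (x \<otimes> w) = \<phi> (w \<otimes> x)" using mult x w by (simp add: mult.commute)
    then show "x \<otimes> w = w \<otimes> x" using inj x w by blast
    show "(\<exists>n::nat. x = w [^] n) \<or> (\<exists>n::nat. w = x [^] n)"
      using quasicyclic_chain[OF img[OF x] img[OF w]] pow[OF x, symmetric] pow[OF w, symmetric] inj X_pow x w by metis
  next
    fix g assume "g \<in> carrier G"
    then obtain a b where ab: "a \<in> A" "b \<in> B" "g = a \<otimes> b" unfolding AB set_mult_def by blast
    have "b \<in> X <#> generate G {y}" using ab(2) gen generate_consistent[OF _ B, of "{y}"] y by simp
    then obtain x h where xh: "x \<in> X" "h \<in> generate G {y}" "b = x \<otimes> h" unfolding set_mult_def by blast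
    obtain w where w: "w \<in> X" "h = w \<or> h = w \<otimes> y" using gen_y[OF xh(2)] by blast
    have "b = (x \<otimes> w) \<or> b = (x \<otimes> w) \<otimes> y" using w xh yc by (auto simp: m_assoc)
    then show "\<exists>a\<in>A. \<exists>x\<in>X. g = a \<otimes> x \<or> g = a \<otimes> (x \<otimes> y)" using ab X.m_closed[OF xh(1) w(1)] by blast
  qed
  then show ?thesis by blast
qed

theorem corollary1p2:
  fixes G :: "('a, 'b) monoid_scheme" and A B :: "'a set"
  assumes "group G"
    and "subgroup A G"
    and "subgroup B G"
    and "carrier G = A <#>\<^bsub>G\<^esub> B"
    and "comm_group (G\<lparr>carrier := A\<rparr>)"
    and "locally_quaternion (G\<lparr>carrier := B\<rparr>)"
  shows "solvable G"
proof -
  interpret group G by (rule assms(1))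
  obtain X y where "abelian_dihedral_product G A X y"
    using abelian_dihedral_productI[OF assms(2-6)] by blast
  then show ?thesis by (rule abelian_dihedral_product.product_solvable)
qed

end
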